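(* Let $p$ be a prime number, let $m>1$ be an integer, and let $\Gamma(m)=\ker\big(SL_2(\mathbb{Z})\to SL_2(\mathbb{Z}/m)\big)$ be the principal congruence subgroup of level $m$. Let $M=\mathbb{Z}[x,y]=\bigoplus_{n\ge 0}M_n$ be the polynomial representation of $SL_2(\mathbb{Z})$, decomposed into its homogeneous components $M_n$ of degree $n$. The subscript $(p)$ denotes the $p$-torsion component. (1) If $p$ does not divide $m$, the $p$-torsion component of $H^1(\Gamma(m);M_n)$ is given by $$H^1(\Gamma(m);M_n)_{(p)}= H^1(SL_2(\mathbb{Z});M_n)_{(p)}=\Delta^+_p[\mathcal{P}_p,\mathcal{Q}_p]_{\deg=n},$$ where $\mathcal{P}_p$ and $\mathcal{Q}_p$ are elements of degree $\deg\mathcal{P}_p=2(p+1)$ and $\deg\mathcal{Q}_p=2p(p-1)$. (2) If $p$ divides $m$, suppose $p^a\mid m$ and $p^{a+1}\nmid m$. Then $$H^1(\Gamma(m);M_{>0})_{(p)}\simeq\Delta^+_{p^a}[x,y],\qquad M_{>0}=\bigoplus_{n>0}M_n,$$ where $x,y$ on the right-hand side are elements of degree $1$.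
   Context: Group action: a matrix $A=\begin{pmatrix} a_{11} & a_{12} \\ a_{21} & a_{22} \end{pmatrix}\in SL_2(\mathbb{Z})$ acts on $M=\mathbb{Z}[x,y]$ by the ring automorphism $x\mapsto a_{11}x+a_{21}y$, $y\mapsto a_{12}x+a_{22}y$ (the natural action on $\mathbb{Z}^2=\mathbb{Z}x\oplus\mathbb{Z}y$ extended to the symmetric algebra). Each $M_n$ is a submodule. The module $M=\bigoplus_{n\ge0}M_n$ is also identified with $H^*((\mathbb{CP}^\infty)^2;\mathbb{Z})$ where the result for $SL_2(\mathbb{Z})$, with the same degrees $2(p+1)$ and $2p(p-1)$, is recalled. $H^*(G;N)$ denotes group cohomology with coefficients in the $G$-module $N$. The $p$-torsion component $H_{(p)}$ of an abelian group $H$ is the subgroup of elements killed by some power of $p$. Divided polynomial algebras: $\Delta[x]\subset\mathbb{Q}[x]$ is the subring generated as a $\mathbb{Z}$-submodule by the elements $x_n:=x^n/n!$, $n\in\mathbb{N}$. For a prime $p$ let $v$ be the $p$-adic valuation on positive integers. For a power $p^a$ with $a\ge1$, let $I_{p^a}$ be the ideal of $\Delta[x]$ generated by the elements $p^{v(i)+a}x_i$, $i\ge 1$, and set $\Delta_{p^a}[x]:=\Delta[x]/I_{p^a}$. In two variables, $\Delta_{p^a}[x,x']:=\Delta_{p^a}[x]\otimes_{\mathbb{Z}}\Delta_{p^a}[x']$. If the variable $x$ is given degree $k$, then $x_n$ has degree $kn$, and the tensor product has the induced grading. $\Delta^+_{p^a}[x,x']$ is the submodule of elements of strictly positive degree,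 and the subscript $\deg=n$ denotes the homogeneous component of degree $n$. The notation $\Delta_p$ is the case $a=1$; $\mathcal{P}_p,\mathcal{Q}_p$ are names of the two variables.
   Formalization: In part (1), M_n is taken in the grading where x and y have degree 2 (polynomials of polynomial degree n/2, zero for odd n); with polynomial degree the formula fails, e.g. for p=2, n=2. Part (2) uses degree 1. *)

theory Defs
  imports
    "HOL-Analysis.Determinants"
    "HOL-Algebra.QuotRing"
    "HOL-Algebra.Generated_Groups"
    "HOL-Algebra.Free_Abelian_Groups"
    "HOL-Number_Theory.Cong"
    "HOL-Computational_Algebra.Polynomial"
    "HOL-Computational_Algebra.Primes"
begin

section \<open>Group cohomology\<close>

text \<open>
  Cohomology of a group \<open>G\<close> with coefficients in a \<open>G\<close>-module, by inhomogeneous cochains.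
  The module is an additive subgroup \<open>N\<close> of a type, with \<open>act g\<close> the action of \<open>g\<close> on it.
  An \<open>n\<close>-cochain is a function of lists of \<open>n\<close> group elements, extended by \<open>0\<close> to all other lists
  so that equality of cochains is equality of functions.
\<close>

definition cochain_args :: "('g, 'c) monoid_scheme \<Rightarrow> nat \<Rightarrow> 'g list set" where
  "cochain_args G n = {gs. length gs = n \<and> set gs \<subseteq> carrier G}"

definition cochains ::
    "('g, 'c) monoid_scheme \<Rightarrow> 'b::ab_group_add set \<Rightarrow> nat \<Rightarrow> ('g list \<Rightarrow> 'b) set" where
  "cochains G N n = {f. (\<forall>gs \<in> cochain_args G n. f gs \<in> N) \<and> (\<forall>gs. gs \<notin> cochain_args G n \<longrightarrow> f gs = 0)}"

definition signed :: "nat \<Rightarrow> 'b::ab_group_add \<Rightarrow> 'b" where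
  "signed k b = (if even k then b else - b)"

definition merge_at :: "('g, 'c) monoid_scheme \<Rightarrow> nat \<Rightarrow> 'g list \<Rightarrow> 'g list" where
  "merge_at G i gs = take i gs @ (gs ! i \<otimes>\<^bsub>G\<^esub> gs ! Suc i) # drop (i + 2) gs"

text \<open>
  \<open>(df)(g\<^sub>0, \<dots>, g\<^sub>n) = g\<^sub>0 f(g\<^sub>1, \<dots>, g\<^sub>n) + \<Sum> (-1)\<^sup>i\<^sup>+\<^sup>1 f(\<dots>, g\<^sub>i g\<^sub>i\<^sub>+\<^sub>1, \<dots>) + (-1)\<^sup>n\<^sup>+\<^sup>1 f(g\<^sub>0, \<dots>, g\<^sub>n\<^sub>-\<^sub>1)\<close>,
  the sum being over \<open>0 \<le> i < n\<close>.
\<close>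

definition coboundary ::
    "('g, 'c) monoid_scheme \<Rightarrow> ('g \<Rightarrow> 'b \<Rightarrow> 'b) \<Rightarrow> nat \<Rightarrow> ('g list \<Rightarrow> 'b::ab_group_add) \<Rightarrow> 'g list \<Rightarrow> 'b" where
  "coboundary G act n f = (\<lambda>gs.
     if gs \<in> cochain_args G (Suc n)
     then act (hd gs) (f (tl gs))
          + (\<Sum>i<n. signed (Suc i) (f (merge_at G i gs)))
          + signed (Suc n) (f (butlast gs))
     else 0)"

definition cocycles ::
    "('g, 'c) monoid_scheme \<Rightarrow> ('g \<Rightarrow> 'b \<Rightarrow> 'b) \<Rightarrow> 'b::ab_group_add set \<Rightarrow> nat \<Rightarrow> ('g list \<Rightarrow> 'b) set" where
  "cocycles G act N n = {f \<in> cochains G N n. coboundary G act n f = (\<lambda>_. 0)}"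

definition coboundaries ::
    "('g, 'c) monoid_scheme \<Rightarrow> ('g \<Rightarrow> 'b \<Rightarrow> 'b) \<Rightarrow> 'b::ab_group_add set \<Rightarrow> nat \<Rightarrow> ('g list \<Rightarrow> 'b) set" where
  "coboundaries G act N n =
     (case n of 0 \<Rightarrow> {\<lambda>_. 0} | Suc k \<Rightarrow> coboundary G act k ` cochains G N k)"

definition cocycle_group ::
    "('g, 'c) monoid_scheme \<Rightarrow> ('g \<Rightarrow> 'b \<Rightarrow> 'b) \<Rightarrow> 'b::ab_group_add set \<Rightarrow> nat \<Rightarrow> ('g list \<Rightarrow> 'b) monoid" where
  "cocycle_group G act N n =
     \<lparr>carrier = cocycles G act N n, monoid.mult = (\<lambda>f h gs. f gs + h gs), one = (\<lambda>_. 0)\<rparr>"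

definition cohomology ::
    "('g, 'c) monoid_scheme \<Rightarrow> ('g \<Rightarrow> 'b \<Rightarrow> 'b) \<Rightarrow> 'b::ab_group_add set \<Rightarrow> nat \<Rightarrow> ('g list \<Rightarrow> 'b) set monoid" where
  "cohomology G act N n = cocycle_group G act N n Mod coboundaries G act N n"

text \<open>
  The restriction homomorphism \<open>H\<^sup>n(G; N) \<rightarrow> H\<^sup>n(K; N)\<close> for a subgroup \<open>K\<close>: all members \<open>f\<close> of a class
  \<open>c\<close> restrict to the same class, so the union is over equal cosets.
\<close>

definition restrict_cochain :: "'g set \<Rightarrow> ('g list \<Rightarrow> 'b::ab_group_add) \<Rightarrow> 'g list \<Rightarrow> 'b" where
  "restrict_cochain K f = (\<lambda>gs. if set gs \<subseteq> K then f gs else 0)"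

definition restriction ::
    "('g, 'c) monoid_scheme \<Rightarrow> 'g set \<Rightarrow> ('g \<Rightarrow> 'b \<Rightarrow> 'b) \<Rightarrow> 'b::ab_group_add set \<Rightarrow> nat
      \<Rightarrow> ('g list \<Rightarrow> 'b) set \<Rightarrow> ('g list \<Rightarrow> 'b) set" where
  "restriction G K act N n c =
     (let GK = G\<lparr>carrier := K\<rparr> in
      \<Union>f\<in>c. coboundaries GK act N n #>\<^bsub>cocycle_group GK act N n\<^esub> restrict_cochain K f)"

definition p_torsion :: "nat \<Rightarrow> ('a, 'c) monoid_scheme \<Rightarrow> ('a, 'c) monoid_scheme" where
  "p_torsion p H = H\<lparr>carrier := {h \<in> carrier H. \<exists>k::nat. h [^]\<^bsub>H\<^esub> (p ^ k) = \<one>\<^bsub>H\<^esub>}\<rparr>"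


section \<open>The group $SL_2(\mathbb{Z})$, its principal congruence subgroups and the module $\mathbb{Z}[x,y]$\<close>

definition SL2Z :: "(int^2^2) monoid" where
  "SL2Z = \<lparr>carrier = {A. det A = 1}, monoid.mult = (**), one = mat 1\<rparr>"

definition Gamma :: "nat \<Rightarrow> (int^2^2) set" where
  "Gamma m = {A \<in> carrier SL2Z. \<forall>i j. [A $ i $ j = mat 1 $ i $ j] (mod int m)}"

abbreviation Gamma_group :: "nat \<Rightarrow> (int^2^2) monoid" where
  "Gamma_group m \<equiv> SL2Z\<lparr>carrier := Gamma m\<rparr>"

text \<open>
  \<open>\<int>[x,y]\<close> is \<open>\<int>[x][y]\<close>: the coefficient of \<open>x\<^sup>i y\<^sup>j\<close> in \<open>f\<close> is \<open>coeff (coeff f j) i\<close>.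
\<close>

definition var_x :: "int poly poly" where "var_x = [:[:0, 1:]:]"
definition var_y :: "int poly poly" where "var_y = [:0, 1:]"

definition subst_xy :: "int poly poly \<Rightarrow> int poly poly \<Rightarrow> int poly poly \<Rightarrow> int poly poly" where
  "subst_xy u v f = poly (map_poly (\<lambda>q. poly (map_poly of_int q) u) f) v"

definition SL2_act :: "int^2^2 \<Rightarrow> int poly poly \<Rightarrow> int poly poly" where
  "SL2_act A = subst_xy (of_int (A $ 1 $ 1) * var_x + of_int (A $ 2 $ 1) * var_y)
                        (of_int (A $ 1 $ 2) * var_x + of_int (A $ 2 $ 2) * var_y)"

text \<open>
  The component of degree \<open>n\<close> of \<open>\<int>[x,y]\<close> when \<open>x\<close> and \<open>y\<close> both have degree \<open>d\<close>. Here \<open>d = 1\<close> is the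
  polynomial grading, and \<open>d = 2\<close> is the grading of \<open>H\<^sup>*((\<complex>P\<^sup>\<infinity>)\<^sup>2; \<int>)\<close>.
\<close>

definition M_part :: "nat \<Rightarrow> nat \<Rightarrow> int poly poly set" where
  "M_part d n = {f. \<forall>i j. coeff (coeff f j) i \<noteq> 0 \<longrightarrow> d * i + d * j = n}"

definition M_pos :: "int poly poly set" where
  "M_pos = {f. \<forall>i j. coeff (coeff f j) i \<noteq> 0 \<longrightarrow> 0 < i + j}"

text \<open>
  The classes in \<open>H\<^sup>k(G; N)\<close> represented by cocycles with values in \<open>N'\<close>, that is, for a submodule
  \<open>N'\<close> of \<open>N\<close>, the image of \<open>H\<^sup>k(G; N')\<close>.
\<close>

definition classes_with_values ::
    "('g, 'c) monoid_scheme \<Rightarrow> ('g \<Rightarrow> 'b \<Rightarrow> 'b) \<Rightarrow> 'b::ab_group_add set \<Rightarrow> nat \<Rightarrow> 'b set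
      \<Rightarrow> ('g list \<Rightarrow> 'b) set set" where
  "classes_with_values G act N k N' =
     {c \<in> carrier (cohomology G act N k). \<exists>f\<in>c. f \<in> cochains G N' k}"


section \<open>Tensor products of abelian groups\<close>

definition tensor_rels ::
    "('a, 'c) monoid_scheme \<Rightarrow> ('b, 'd) monoid_scheme \<Rightarrow> ('a \<times> 'b \<Rightarrow>\<^sub>0 int) set" where
  "tensor_rels A B = generate (free_Abelian_group (carrier A \<times> carrier B))
     ({frag_of (a \<otimes>\<^bsub>A\<^esub> a', b) - frag_of (a, b) - frag_of (a', b) |a a' b.
         a \<in> carrier A \<and> a' \<in> carrier A \<and> b \<in> carrier B} \<union>
      {frag_of (a, b \<otimes>\<^bsub>B\<^esub> b') - frag_of (a, b) - frag_of (a, b') |a b b'.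
         a \<in> carrier A \<and> b \<in> carrier B \<and> b' \<in> carrier B})"

definition tensor ::
    "('a, 'c) monoid_scheme \<Rightarrow> ('b, 'd) monoid_scheme \<Rightarrow> ('a \<times> 'b \<Rightarrow>\<^sub>0 int) set monoid" where
  "tensor A B = free_Abelian_group (carrier A \<times> carrier B) Mod tensor_rels A B"

definition pure_tensor ::
    "('a, 'c) monoid_scheme \<Rightarrow> ('b, 'd) monoid_scheme \<Rightarrow> 'a \<Rightarrow> 'b \<Rightarrow> ('a \<times> 'b \<Rightarrow>\<^sub>0 int) set" where
  "pure_tensor A B a b =
     tensor_rels A B #>\<^bsub>free_Abelian_group (carrier A \<times> carrier B)\<^esub> frag_of (a, b)"


section \<open>Divided polynomial algebras\<close>

definition divpow :: "nat \<Rightarrow> rat poly" where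
  "divpow n = monom (1 / fact n) n"

definition divpoly_set :: "rat poly set" where
  "divpoly_set = generate \<lparr>carrier = UNIV, monoid.mult = (+), one = 0\<rparr> (range divpow)"

definition divpoly_ring :: "rat poly ring" where
  "divpoly_ring = \<lparr>carrier = divpoly_set, monoid.mult = (*), one = 1, ring.zero = 0, ring.add = (+)\<rparr>"

definition divpoly_ideal :: "nat \<Rightarrow> nat \<Rightarrow> rat poly set" where
  "divpoly_ideal p a =
     Idl\<^bsub>divpoly_ring\<^esub> {of_nat (p ^ (multiplicity p i + a)) * divpow i |i. 1 \<le> i}"

definition divpoly_quot :: "nat \<Rightarrow> nat \<Rightarrow> rat poly set ring" where
  "divpoly_quot p a = divpoly_ring Quot divpoly_ideal p a"

definition divpow_class :: "nat \<Rightarrow> nat \<Rightarrow> nat \<Rightarrow> rat poly set" where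
  "divpow_class p a i = divpoly_ideal p a +>\<^bsub>divpoly_ring\<^esub> divpow i"

type_synonym divpoly2 = "(rat poly set \<times> rat poly set \<Rightarrow>\<^sub>0 int) set"

text \<open>
  Only the additive group structure of the tensor product is defined. This is \<open>\<Delta>\<^bsub>p\<^sup>a\<^esub>[x, x']\<close> as an abelian group.
\<close>

definition divpoly2 :: "nat \<Rightarrow> nat \<Rightarrow> divpoly2 monoid" where
  "divpoly2 p a = tensor (add_monoid (divpoly_quot p a)) (add_monoid (divpoly_quot p a))"

definition divpow2 :: "nat \<Rightarrow> nat \<Rightarrow> nat \<Rightarrow> nat \<Rightarrow> divpoly2" where
  "divpow2 p a i j = pure_tensor (add_monoid (divpoly_quot p a)) (add_monoid (divpoly_quot p a))
                       (divpow_class p a i) (divpow_class p a j)"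

text \<open>
  In the following, the first variable has degree \<open>k\<close> and the second one degree \<open>l\<close>, so that
  \<open>x\<^sub>i \<otimes> x'\<^sub>j\<close> has degree \<open>k i + l j\<close>.
\<close>

definition divpoly2_deg :: "nat \<Rightarrow> nat \<Rightarrow> nat \<Rightarrow> nat \<Rightarrow> nat \<Rightarrow> divpoly2 set" where
  "divpoly2_deg p a k l n = generate (divpoly2 p a) {divpow2 p a i j |i j. k * i + l * j = n}"

definition divpoly2_pos :: "nat \<Rightarrow> nat \<Rightarrow> nat \<Rightarrow> nat \<Rightarrow> divpoly2 monoid" where
  "divpoly2_pos p a k l =
     (divpoly2 p a)\<lparr>carrier := generate (divpoly2 p a) {divpow2 p a i j |i j. 0 < k * i + l * j}\<rparr>"

definition divpoly2_pos_deg :: "nat \<Rightarrow> nat \<Rightarrow> nat \<Rightarrow> nat \<Rightarrow> nat \<Rightarrow> divpoly2 monoid" where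
  "divpoly2_pos_deg p a k l n =
     (divpoly2 p a)\<lparr>carrier := carrier (divpoly2_pos p a k l) \<inter> divpoly2_deg p a k l n\<rparr>"

end

theory Submission
  imports Defs "HOL-Number_Theory.Residue_Primitive_Roots"
begin

text \<open>
  A class of \<open>H\<^sup>1(G; M)\<close> killed by \<open>p\<^sup>k\<close> is represented by \<open>g \<mapsto> (g v - v) / p\<^sup>k\<close> for some \<open>v\<close> that is
  \<open>G\<close>-invariant modulo \<open>p\<^sup>k\<close>, so that everything reduces to invariants modulo prime powers. If \<open>f\<close>
  is invariant under \<open>x \<mapsto> x + t y\<close> modulo \<open>p\<^sup>k\<close> with \<open>p\<close> dividing \<open>t\<close>, then \<open>p\<^sup>k\<close> divides \<open>t i c\<close> for
  every term \<open>c x\<^sup>i y\<^sup>j\<close> of \<open>f\<close>, by descending induction on \<open>i\<close>. With the same statement for \<open>y\<close> this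
  determines the invariants of \<open>\<Gamma>(m)\<close> when \<open>p\<close> divides \<open>m\<close>: the torsion is the sum of the cyclic
  groups generated by the classes of \<open>x\<^sup>i y\<^sup>j / p\<^sup>a\<^sup>+\<^sup>r\<close>, where \<open>p\<^sup>r\<close> is the \<open>p\<close>-part of \<open>gcd i j\<close>.

  If \<open>p\<close> does not divide \<open>m\<close>, then \<open>\<Gamma>(m)\<close> and \<open>SL\<^sub>2(\<int>)\<close> have the same invariants modulo \<open>p\<^sup>k\<close>. The
  preceding argument with \<open>t = p\<close> shows that the reduction modulo \<open>p\<close> of an invariant modulo \<open>p\<^sup>k\<^sup>+\<^sup>1\<close>
  is a \<open>p\<^sup>k\<close>-th power, hence by Dickson's theorem a polynomial in \<open>P\<close> and \<open>Q\<close> raised to the power \<open>p\<^sup>k\<close>. The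
  torsion is again the sum of cyclic groups, now generated by the classes of \<open>P\<^sup>i Q\<^sup>j / p\<^sup>1\<^sup>+\<^sup>r\<close>.
\<close>

section \<open>The action on $\mathbb{Z}[x,y]$\<close>

text \<open>The denominators come from Frobenius: if \<open>w\<close> is invariant modulo
  \<open>p^a\<close> with \<open>a > 0\<close>, then \<open>w^(p^r)\<close> is invariant modulo
  \<open>p^(a+r)\<close>, and \<open>X^i Y^j\<close> is a \<open>p^r\<close>-th power when
  \<open>p^r\<close> divides both exponents. The same exponent appears on the other side: for
  \<open>i > 0\<close> the class of \<open>x_i\<close> has order \<open>p^(a + v(i))\<close>, so
  \<open>x_i \<otimes> x'_j\<close> generates a cyclic group whose order is the smaller of two such
  powers, \<open>p^(a + v(gcd i j))\<close>. The finitely supported integer functions on a set of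
  pairs \<open>(i, j)\<close> map onto both sides with the same fibres: \<open>c\<close> and
  \<open>d\<close> are identified exactly when every difference of coefficients is divisible by
  \<open>tors_order p a i j\<close>. Lower bounds on orders rest, for cohomology, on the absence of
  nonzero invariants in positive degree; for the tensor product, on coefficient functionals that
  respect the relations modulo \<open>tors_order\<close>. The pair \<open>(0, 0)\<close> is left
  out, since constants are invariant and \<open>1 \<otimes> 1\<close> has infinite order.\<close>

abbreviation cf :: "int poly poly \<Rightarrow> nat \<Rightarrow> nat \<Rightarrow> int" where
  "cf f i j \<equiv> Polynomial.coeff (Polynomial.coeff f j) i"

definition mon :: "nat \<Rightarrow> nat \<Rightarrow> int poly poly" where
  "mon i j = Polynomial.monom (Polynomial.monom 1 i) j"

lemma poly2_eqI: "(\<And>i j. cf f i j = cf g i j) \<Longrightarrow> f = g"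
  by (intro poly_eqI)

lemma of_int_poly2: "(of_int c :: int poly poly) = [:[:c:]:]"
  by (simp add: of_int_poly)

lemma cf_of_int_mult [simp]: "cf (of_int c * f) i j = c * cf f i j"
  by (simp add: of_int_poly2)

lemma cf_mon [simp]: "cf (mon a b) i j = (if i = a \<and> j = b then 1 else 0)"
  by (simp add: mon_def)

lemma of_int_dvd_iff: "of_int c dvd (f :: int poly poly) \<longleftrightarrow> (\<forall>i j. c dvd cf f i j)"
  by (auto simp: of_int_poly2 const_poly_dvd_iff)

lemma mon_mult: "mon a b * mon c d = mon (a + c) (b + d)"
  by (simp add: mon_def mult_monom)

lemma mon_power: "mon a b ^ n = mon (a * n) (b * n)"
  by (induction n) (auto simp: mon_mult add.commute, simp add: mon_def)

lemma mon_eq: "mon i j = var_x ^ i * var_y ^ j"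
proof -
  have "var_x = mon 1 0" "var_y = mon 0 1"
    by (auto simp: var_x_def var_y_def mon_def monom_altdef)
  note v = this
  show ?thesis unfolding v mon_power mon_mult by simp
qed

lemma cf_sum: "cf (sum f A) i j = (\<Sum>a\<in>A. cf (f a) i j)"
  by (simp add: coeff_sum)

lemma poly2_induct [case_names mon add]:
  assumes mon: "\<And>c i j. P (of_int c * mon i j)"
    and add: "\<And>f g. P f \<Longrightarrow> P g \<Longrightarrow> P (f + g)"
  shows "P f"
proof -
  have P0: "P 0" using mon[of 0] by simp
  have sum: "P (sum h A)" if "finite A" "\<And>a. a \<in> A \<Longrightarrow> P (h a)" for h :: "nat \<Rightarrow> int poly poly" and A
    using that by (induction A rule: finite_induct) (auto intro: add P0)
  have mm: "of_int c * mon i j = Polynomial.monom (Polynomial.monom c i) j" for c i j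
    by (simp add: of_int_poly2 mon_def smult_monom)
  have "P (Polynomial.monom q j)" for q j
  proof -
    have "Polynomial.monom q j = Polynomial.monom (\<Sum>i\<le>degree q. Polynomial.monom (Polynomial.coeff q i) i) j"
      by (simp add: poly_as_sum_of_monoms)
    also have "\<dots> = (\<Sum>i\<le>degree q. of_int (Polynomial.coeff q i) * mon i j)"
      by (simp add: mm monom_sum)
    finally show ?thesis using sum[of "{..degree q}"] mon by simp
  qed
  hence "P (\<Sum>j\<le>degree f. Polynomial.monom (Polynomial.coeff f j) j)" by (intro sum) simp_all
  thus ?thesis by (simp add: poly_as_sum_of_monoms)
qed

lemma poly_map_poly_hom:
  fixes h :: "'a::comm_ring_1 \<Rightarrow> 'b::comm_ring_1"
  assumes [simp]: "h 0 = 0" and add: "\<And>a b. h (a + b) = h a + h b" and mult: "\<And>a b. h (a * b) = h a * h b"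
  shows "poly (map_poly h (f + g)) v = poly (map_poly h f) v + poly (map_poly h g) v"
    and "poly (map_poly h (f * g)) v = poly (map_poly h f) v * poly (map_poly h g) v"
proof -
  have A: "poly (map_poly h (f + g)) v = poly (map_poly h f) v + poly (map_poly h g) v" for f g
  proof -
    have "map_poly h (f + g) = map_poly h f + map_poly h g"
      by (rule poly_eqI) (simp add: coeff_map_poly add)
    thus ?thesis by simp
  qed
  have pC: "poly (map_poly h (pCons c q)) v = h c + v * poly (map_poly h q) v" for c q
    by (simp add: map_poly_pCons)
  have sm: "poly (map_poly h (Polynomial.smult c q)) v = h c * poly (map_poly h q) v" for c q
  proof -
    have "map_poly h (Polynomial.smult c q) = Polynomial.smult (h c) (map_poly h q)"
      by (rule poly_eqI) (simp add: coeff_map_poly mult)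
    thus ?thesis by simp
  qed
  show "poly (map_poly h (f + g)) v = poly (map_poly h f) v + poly (map_poly h g) v"
    by (rule A)
  show "poly (map_poly h (f * g)) v = poly (map_poly h f) v * poly (map_poly h g) v"
    by (induction f) (auto simp: A pC sm algebra_simps)
qed

lemma
  shows subst_xy_add: "subst_xy u v (f + g) = subst_xy u v f + subst_xy u v g"
    and subst_xy_mult: "subst_xy u v (f * g) = subst_xy u v f * subst_xy u v g"
  unfolding subst_xy_def
  by (rule poly_map_poly_hom; simp add: poly_map_poly_hom[of of_int])+

lemma subst_xy_of_int [simp]: "subst_xy u v (of_int c) = of_int c"
  by (simp add: subst_xy_def of_int_poly2 map_poly_pCons)

lemma subst_xy_0 [simp]: "subst_xy u v 0 = 0" and subst_xy_1 [simp]: "subst_xy u v 1 = 1"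
  using subst_xy_of_int[of u v 0] subst_xy_of_int[of u v 1] by simp_all

lemma subst_xy_diff: "subst_xy u v (f - g) = subst_xy u v f - subst_xy u v g"
  using subst_xy_add[of u v "f - g" g] by simp

lemma subst_xy_power: "subst_xy u v (f ^ n) = subst_xy u v f ^ n"
  by (induction n) (auto simp: subst_xy_mult)

lemma subst_xy_sum: "subst_xy u v (sum f A) = (\<Sum>a\<in>A. subst_xy u v (f a))"
  by (induction A rule: infinite_finite_induct) (auto simp: subst_xy_add)

lemma subst_xy_var [simp]: "subst_xy u v var_x = u" "subst_xy u v var_y = v"
  by (simp_all add: subst_xy_def var_x_def var_y_def map_poly_pCons)

lemma subst_xy_mon: "subst_xy u v (mon i j) = u ^ i * v ^ j"
  by (simp add: mon_eq subst_xy_mult subst_xy_power)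

section \<open>Homogeneous components and gradings\<close>

definition hcomp :: "nat \<Rightarrow> int poly poly \<Rightarrow> int poly poly" where
  "hcomp n f = (\<Sum>i\<le>n. of_int (cf f i (n - i)) * mon i (n - i))"

lemma cf_hcomp [simp]: "cf (hcomp n f) i j = (if i + j = n then cf f i j else 0)"
proof -
  have "cf (hcomp n f) i j = (\<Sum>k\<le>n. if k = i then (if j = n - i then cf f i (n - i) else 0) else 0)"
    unfolding hcomp_def cf_sum by (intro sum.cong) auto
  also have "\<dots> = (if i + j = n then cf f i j else 0)"
    by (subst sum.delta) auto
  finally show ?thesis .
qed

lemma hcomp_add: "hcomp n (f + g) = hcomp n f + hcomp n g"
  by (rule poly2_eqI) simp

lemma hcomp_diff: "hcomp n (f - g) = hcomp n f - hcomp n g"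
  by (rule poly2_eqI) simp

lemma hcomp_of_int_mult: "hcomp n (of_int c * f) = of_int c * hcomp n f"
  by (rule poly2_eqI) simp

text \<open>A set of degrees, rather than one degree, covers \<open>M_part\<close> and
  \<open>M_pos\<close> at once. The set is empty for \<open>M_part 2 n\<close> with odd
  \<open>n\<close>, which makes that module zero.\<close>

definition graded :: "nat set \<Rightarrow> int poly poly set" where
  "graded S = {f. \<forall>i j. cf f i j \<noteq> 0 \<longrightarrow> i + j \<in> S}"

lemma M_part_eq: "M_part d n = graded {k. d * k = n}"
  by (simp add: M_part_def graded_def distrib_left)

lemma M_pos_eq: "M_pos = graded {0<..}"
  by (simp add: M_pos_def graded_def)

lemma graded_add: "f \<in> graded S \<Longrightarrow> g \<in> graded S \<Longrightarrow> f + g \<in> graded S"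
  unfolding graded_def by (clarsimp, metis add.right_neutral)

lemma graded_0 [simp]: "0 \<in> graded S"
  by (simp add: graded_def)

lemma graded_uminus: "f \<in> graded S \<Longrightarrow> - f \<in> graded S"
  by (simp add: graded_def)

lemma graded_diff: "f \<in> graded S \<Longrightarrow> g \<in> graded S \<Longrightarrow> f - g \<in> graded S"
  using graded_add[of f S "- g"] graded_uminus by simp

lemma graded_of_int_mult: "f \<in> graded S \<Longrightarrow> of_int c * f \<in> graded S"
  by (auto simp: graded_def)

lemma graded_of_int_mult_iff: "c \<noteq> 0 \<Longrightarrow> of_int c * f \<in> graded S \<longleftrightarrow> f \<in> graded S"
  by (auto simp: graded_def)

lemma graded_sum: "(\<And>a. a \<in> A \<Longrightarrow> f a \<in> graded S) \<Longrightarrow> sum f A \<in> graded S"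
  by (induction A rule: infinite_finite_induct) (auto intro: graded_add)

lemma mon_graded: "i + j \<in> S \<Longrightarrow> mon i j \<in> graded S"
  by (simp add: graded_def)

lemma graded_mult:
  assumes "f \<in> graded {a}" "g \<in> graded {b}"
  shows "f * g \<in> graded {a + b}"
proof -
  have "i + j = a + b" if "cf (f * g) i j \<noteq> 0" for i j
  proof -
    have "cf (f * g) i j = (\<Sum>l\<le>j. \<Sum>k\<le>i. cf f k l * cf g (i - k) (j - l))"
      by (simp add: coeff_mult coeff_sum)
    with that obtain l where l: "l \<le> j" "(\<Sum>k\<le>i. cf f k l * cf g (i - k) (j - l)) \<noteq> 0"
      by (metis (no_types, lifting) atMost_iff sum.neutral)
    then obtain k where "k \<le> i" "cf f k l * cf g (i - k) (j - l) \<noteq> 0"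
      by (metis (no_types, lifting) atMost_iff sum.neutral)
    hence "k + l = a" "i - k + (j - l) = b" using assms by (auto simp: graded_def)
    thus ?thesis using \<open>k \<le> i\<close> l(1) by linarith
  qed
  thus ?thesis by (simp add: graded_def)
qed

lemma one_graded: "1 \<in> graded {0}"
  using mon_graded[of 0 0 "{0}"] by (simp add: mon_eq)

lemma graded_power: "f \<in> graded {a} \<Longrightarrow> f ^ n \<in> graded {a * n}"
  by (induction n) (auto simp: one_graded dest: graded_mult)

lemma var_graded: "var_x \<in> graded {1}" "var_y \<in> graded {1}"
  using mon_graded[of 1 0 "{1}"] mon_graded[of 0 1 "{1}"] by (simp_all add: mon_eq)

lemma hcomp_graded: "f \<in> graded {a} \<Longrightarrow> hcomp n f = (if n = a then f else 0)"
  by (intro poly2_eqI) (auto simp: graded_def)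

section \<open>The matrix action and its shears\<close>

abbreviation (input) act :: "int^2^2 \<Rightarrow> int poly poly \<Rightarrow> int poly poly" where
  "act \<equiv> SL2_act"

lemma act_add: "act A (f + g) = act A f + act A g"
  and act_diff: "act A (f - g) = act A f - act A g"
  and act_mult: "act A (f * g) = act A f * act A g"
  and act_power: "act A (f ^ n) = act A f ^ n"
  and act_sum: "act A (sum h S) = (\<Sum>s\<in>S. act A (h s))"
  and act_of_int [simp]: "act A (of_int c) = of_int c"
  and act_0 [simp]: "act A 0 = 0"
  by (simp_all add: SL2_act_def subst_xy_add subst_xy_diff subst_xy_mult subst_xy_power subst_xy_sum)

lemma act_x: "act A var_x = of_int (A $ 1 $ 1) * var_x + of_int (A $ 2 $ 1) * var_y"
  and act_y: "act A var_y = of_int (A $ 1 $ 2) * var_x + of_int (A $ 2 $ 2) * var_y"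
  by (simp_all add: SL2_act_def)

lemma act_mon: "act A (mon i j) = act A var_x ^ i * act A var_y ^ j"
  by (simp add: mon_eq act_mult act_power)

lemma act_matrix_mult: "act (A ** B) f = act A (act B f)"
proof (induction f rule: poly2_induct)
  case (mon c i j)
  have "act (A ** B) var_x = act A (act B var_x)" "act (A ** B) var_y = act A (act B var_y)"
    by (simp_all add: act_x act_y act_add act_mult matrix_matrix_mult_def sum_2 algebra_simps)
  thus ?case by (simp add: act_mult act_mon act_power)
qed (simp add: act_add)

text \<open>A matrix sends both variables to linear forms, so a monomial of degree \<open>d\<close>
  goes to a product of \<open>d\<close> linear forms.\<close>

lemma hcomp_act: "hcomp n (act A f) = act A (hcomp n f)"
proof (induction f rule: poly2_induct)
  case (mon c i j)
  have lin: "of_int a * var_x + of_int b * var_y \<in> graded {1}" for a b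
    by (intro graded_add graded_of_int_mult var_graded)
  have "act A (mon i j) \<in> graded {i + j}"
    unfolding act_mon act_x act_y using graded_mult graded_power lin
    by (metis mult_1)
  moreover have "mon i j \<in> graded {i + j}" by (simp add: mon_graded)
  ultimately show ?case
    by (simp add: act_mult hcomp_of_int_mult hcomp_graded)
qed (simp add: act_add hcomp_add)

lemma act_graded:
  assumes "f \<in> graded S" shows "act A f \<in> graded S"
proof -
  have "cf (act A f) i j = 0" if "i + j \<notin> S" for i j
  proof -
    have "hcomp (i + j) f = 0"
      using assms that by (intro poly2_eqI) (simp add: graded_def, metis)
    hence "hcomp (i + j) (act A f) = 0" by (simp add: hcomp_act)
    hence "cf (hcomp (i + j) (act A f)) i j = 0" by (simp only: coeff_0)
    thus ?thesis by simp
  qed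
  thus ?thesis by (auto simp: graded_def)
qed

definition upper :: "int \<Rightarrow> int^2^2" where "upper t = vector [vector [1, t], vector [0, 1]]"
definition lower :: "int \<Rightarrow> int^2^2" where "lower t = vector [vector [1, 0], vector [t, 1]]"

lemma act_lower: "act (lower t) var_x = var_x + of_int t * var_y" "act (lower t) var_y = var_y"
  and act_upper: "act (upper t) var_x = var_x" "act (upper t) var_y = of_int t * var_x + var_y"
  by (simp_all add: act_x act_y upper_def lower_def)

text \<open>Substituting \<open>x + t y\<close> for \<open>x\<close> only lowers powers of
  \<open>x\<close>, so just the terms with \<open>i \<ge> r\<close> contribute, and the term
  \<open>i = r\<close> enters with factor 1. This triangular shape drives the descending induction
  in \<open>dvd_of_shift_invariant\<close>.\<close>

lemma cf_act_lower:
  "cf (act (lower t) f) r s = (\<Sum>i=r..r + s. of_nat (i choose r) * t ^ (i - r) * cf f i (r + s - i))"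
proof (induction f rule: poly2_induct)
  case (mon c a b)
  have "act (lower t) (mon a b) = (\<Sum>k\<le>a. of_int (of_nat (a choose k) * t ^ (a - k)) * mon k (a - k + b))"
    unfolding act_mon act_lower binomial_ring[of var_x] sum_distrib_right
    by (intro sum.cong refl) (simp only: mon_eq power_add of_int_mult of_int_power of_int_of_nat_eq power_mult_distrib mult_ac)
  hence "cf (act (lower t) (of_int c * mon a b)) r s
      = (\<Sum>k\<le>a. c * (of_nat (a choose k) * t ^ (a - k) * cf (mon k (a - k + b)) r s))"
    by (simp only: act_mult act_of_int cf_of_int_mult cf_sum sum_distrib_left)
  also have "\<dots>
      = (\<Sum>k\<le>a. if k = r then (if s = a - r + b then c * (of_nat (a choose r) * t ^ (a - r)) else 0) else 0)"
    by (intro sum.cong) auto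
  also have "\<dots> = (if r \<le> a \<and> r + s = a + b then c * (of_nat (a choose r) * t ^ (a - r)) else 0)"
    by (subst sum.delta) auto
  also have "\<dots> = (\<Sum>i=r..r + s. if i = a then (if r + s = a + b then c * (of_nat (a choose r) * t ^ (a - r)) else 0) else 0)"
    by (subst sum.delta) auto
  also have "\<dots> = (\<Sum>i=r..r + s. of_nat (i choose r) * t ^ (i - r) * cf (of_int c * mon a b) i (r + s - i))"
    by (intro sum.cong) auto
  finally show ?case .
qed (simp only: act_add coeff_add distrib_left sum.distrib)

lemma cf_act_upper:
  "cf (act (upper t) f) r s = (\<Sum>i=s..r + s. of_nat (i choose s) * t ^ (i - s) * cf f (r + s - i) i)"
proof (induction f rule: poly2_induct)
  case (mon c a b)
  have "act (upper t) (mon a b) = (\<Sum>k\<le>b. of_int (of_nat (b choose k) * t ^ (b - k)) * mon (b - k + a) k)"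
    unfolding act_mon act_upper add.commute[of "of_int t * var_x" var_y] binomial_ring[of var_y] sum_distrib_left
    by (intro sum.cong refl) (simp only: mon_eq power_add of_int_mult of_int_power of_int_of_nat_eq power_mult_distrib mult_ac)
  hence "cf (act (upper t) (of_int c * mon a b)) r s
      = (\<Sum>k\<le>b. c * (of_nat (b choose k) * t ^ (b - k) * cf (mon (b - k + a) k) r s))"
    by (simp only: act_mult act_of_int cf_of_int_mult cf_sum sum_distrib_left)
  also have "\<dots>
      = (\<Sum>k\<le>b. if k = s then (if r = b - s + a then c * (of_nat (b choose s) * t ^ (b - s)) else 0) else 0)"
    by (intro sum.cong) auto
  also have "\<dots> = (if s \<le> b \<and> r + s = a + b then c * (of_nat (b choose s) * t ^ (b - s)) else 0)"
    by (subst sum.delta) auto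
  also have "\<dots> = (\<Sum>i=s..r + s. if i = b then (if r + s = a + b then c * (of_nat (b choose s) * t ^ (b - s)) else 0) else 0)"
    by (subst sum.delta) auto
  also have "\<dots> = (\<Sum>i=s..r + s. of_nat (i choose s) * t ^ (i - s) * cf (of_int c * mon a b) (r + s - i) i)"
    by (intro sum.cong) auto
  finally show ?case .
qed (simp only: act_add coeff_add distrib_left sum.distrib)

section \<open>Invariants modulo a prime power\<close>

text \<open>Since 0 divides only 0, \<open>inv_mod S 0\<close> is honest invariance, so one notion
  serves for it and for the prime power moduli.\<close>

definition inv_mod :: "(int^2^2) set \<Rightarrow> int \<Rightarrow> int poly poly \<Rightarrow> bool" where
  "inv_mod S q v \<longleftrightarrow> (\<forall>g\<in>S. of_int q dvd act g v - v)"

lemma inv_mod_of_int_mult: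
  assumes "c \<noteq> 0" shows "inv_mod S (c * q) (of_int c * v) \<longleftrightarrow> inv_mod S q v"
proof -
  have "act g (of_int c * v) - of_int c * v = of_int c * (act g v - v)" for g
    by (simp add: act_mult algebra_simps)
  thus ?thesis using assms by (simp add: inv_mod_def)
qed

lemma inv_mod_add: "inv_mod S q v \<Longrightarrow> inv_mod S q w \<Longrightarrow> inv_mod S q (v + w)"
  unfolding inv_mod_def act_add by (metis add_diff_add dvd_add)

lemma inv_mod_diff: "inv_mod S q v \<Longrightarrow> inv_mod S q w \<Longrightarrow> inv_mod S q (v - w)"
proof -
  have "act g (v - w) - (v - w) = (act g v - v) - (act g w - w)" for g
    by (simp add: act_diff)
  note eq = this
  show "inv_mod S q v \<Longrightarrow> inv_mod S q w \<Longrightarrow> inv_mod S q (v - w)"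
    unfolding inv_mod_def eq by (blast intro: dvd_diff)
qed

lemma inv_mod_mult:
  assumes "inv_mod S q v" "inv_mod S q w" shows "inv_mod S q (v * w)"
  unfolding inv_mod_def
proof
  fix g assume "g \<in> S"
  hence "of_int q dvd (act g v - v) * act g w + v * (act g w - w)"
    using assms by (auto simp: inv_mod_def)
  thus "of_int q dvd act g (v * w) - v * w" by (simp add: act_mult algebra_simps)
qed

lemma inv_mod_const: "inv_mod S q (of_int c)"
  by (simp add: inv_mod_def)

lemma inv_mod_power: "inv_mod S q v \<Longrightarrow> inv_mod S q (v ^ n)"
  by (induction n) (auto intro: inv_mod_mult inv_mod_const[of _ _ 1, simplified])

lemma inv_mod_sum: "(\<And>a. a \<in> A \<Longrightarrow> inv_mod S q (h a)) \<Longrightarrow> inv_mod S q (sum h A)"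
  by (induction A rule: infinite_finite_induct)
     (auto intro: inv_mod_add inv_mod_const[of _ _ 0, simplified])

lemma inv_mod_of_int_multI: "inv_mod S q v \<Longrightarrow> inv_mod S q (of_int c * v)"
  by (intro inv_mod_mult inv_mod_const)

lemma inv_mod_dvd: "inv_mod S q v \<Longrightarrow> r dvd q \<Longrightarrow> inv_mod S r v"
  unfolding inv_mod_def dvd_def[of r q] by (force intro: dvd_trans[rotated])

lemma inv_mod_cong:
  assumes "of_int q dvd v - w" shows "inv_mod S q v \<longleftrightarrow> inv_mod S q w"
proof -
  have "inv_mod S q (v - w)"
    using assms unfolding inv_mod_def
    by (metis act_mult act_of_int dvd_diff dvd_triv_left dvd_def)
  thus ?thesis using inv_mod_diff[of S q v "v - w"] inv_mod_add[of S q w "v - w"] by auto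
qed

text \<open>In \<open>a^p - b^p = (a - b) * s\<close> the cofactor \<open>s\<close> is congruent to
  \<open>p * b^(p-1)\<close> modulo \<open>p\<close>, because \<open>a\<close> and \<open>b\<close>
  agree modulo \<open>p\<close>. So \<open>s\<close> supplies one more factor
  \<open>p\<close>.\<close>

lemma dvd_power_diff_step:
  fixes a b :: "'a::comm_ring_1"
  assumes "of_int (int p ^ Suc s) dvd a - b"
  shows "of_int (int p ^ Suc (Suc s)) dvd a ^ p - b ^ p"
proof (cases p)
  case (Suc n)
  have ab: "of_int (int p) dvd a - b" using assms dvd_trans
    by (metis of_int_mult power_Suc dvd_triv_left)
  have pw: "of_int (int p) dvd a ^ i - b ^ i" for i
    using ab by (metis dvd_trans power_diff_sumr2 dvd_triv_left)
  have "(\<Sum>i<p. a ^ i * b ^ (p - 1 - i)) = (\<Sum>i<p. (a ^ i - b ^ i) * b ^ (p - 1 - i)) + of_int (int p) * b ^ (p - 1)"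
  proof -
    have "(\<Sum>i<p. b ^ i * b ^ (p - 1 - i)) = (\<Sum>i<p. b ^ (p - 1))"
      by (intro sum.cong) (auto simp flip: power_add)
    thus ?thesis by (simp add: left_diff_distrib sum_subtractf)
  qed
  hence "of_int (int p) dvd (\<Sum>i<p. a ^ i * b ^ (p - 1 - i))"
    using pw by (auto intro!: dvd_add dvd_sum)
  hence "of_int (int p ^ Suc s) * of_int (int p) dvd (a - b) * (\<Sum>i<p. a ^ i * b ^ (p - 1 - i))"
    using assms by (rule mult_dvd_mono[rotated])
  also have "(a - b) * (\<Sum>i<p. a ^ i * b ^ (p - 1 - i)) = a ^ p - b ^ p"
    using Suc by (simp add: diff_power_eq_sum mult.commute[of "a ^ _"] lessThan_Suc_atMost
        sum.nat_diff_reindex[of "\<lambda>i. a ^ i * b ^ (n - i)"] del: sum.lessThan_Suc power_Suc)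
  finally show ?thesis by (simp add: mult_ac)
qed (use assms in auto)

lemma dvd_power_diff:
  fixes a b :: "'a::comm_ring_1"
  assumes "of_int (int p ^ s) dvd a - b" "0 < s"
  shows "of_int (int p ^ (s + r)) dvd a ^ (p ^ r) - b ^ (p ^ r)"
proof (induction r)
  case (Suc r)
  obtain s' where "s = Suc s'" using assms(2) gr0_implies_Suc by blast
  hence "of_int (int p ^ Suc (s' + r)) dvd a ^ (p ^ r) - b ^ (p ^ r)" using Suc by simp
  from dvd_power_diff_step[OF this] show ?case
    by (simp add: \<open>s = Suc s'\<close> mult.commute[of p] power_mult)
qed (use assms in simp)

text \<open>The common order of the class of \<open>X^i Y^j\<close> divided by this number and of
  the tensor \<open>x_i \<otimes> x'_j\<close>. By the convention
  \<open>multiplicity p 0 = 0\<close> the value at \<open>(0, 0)\<close> is \<open>p^a\<close>,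
  although \<open>1 \<otimes> 1\<close> has infinite order; comparisons of the two sides exclude
  that pair.\<close>

definition tors_order :: "nat \<Rightarrow> nat \<Rightarrow> nat \<Rightarrow> nat \<Rightarrow> nat" where
  "tors_order p a i j = p ^ (a + multiplicity p (gcd i j))"

lemma tors_order_pos: "prime p \<Longrightarrow> 0 < tors_order p a i j"
  by (simp add: tors_order_def prime_gt_0_nat)

text \<open>With \<open>r\<close> the multiplicity of \<open>p\<close> in \<open>gcd i j\<close>,
  the product is the \<open>p^r\<close>-th power of an element invariant modulo \<open>p^a\<close>,
  and each \<open>p\<close>-th power gains one factor \<open>p\<close>. It is applied to the
  variables under \<open>Gamma m\<close> and to Dickson's invariants under
  \<open>SL2Z\<close>.\<close>

lemma inv_mod_tors_order:
  assumes "prime p" "0 < a" "inv_mod S (int p ^ a) X" "inv_mod S (int p ^ a) Y"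
  shows "inv_mod S (int (tors_order p a i j)) (X ^ i * Y ^ j)"
proof -
  define r where "r = multiplicity p (gcd i j)"
  have "p ^ r dvd i" "p ^ r dvd j"
    using multiplicity_dvd[of p "gcd i j"] unfolding r_def by auto
  then obtain i' j' where ij: "i = i' * p ^ r" "j = j' * p ^ r"
    by (metis dvd_def mult.commute)
  have "inv_mod S (int p ^ a) (X ^ i' * Y ^ j')"
    by (intro inv_mod_mult inv_mod_power assms)
  hence "of_int (int p ^ (a + r)) dvd act g (X ^ i' * Y ^ j') ^ (p ^ r) - (X ^ i' * Y ^ j') ^ (p ^ r)"
    if "g \<in> S" for g
    using dvd_power_diff[of p a _ _ r] \<open>0 < a\<close> that unfolding inv_mod_def by blast
  hence "inv_mod S (int p ^ (a + r)) ((X ^ i' * Y ^ j') ^ (p ^ r))"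
    unfolding inv_mod_def act_power by blast
  also have "(X ^ i' * Y ^ j') ^ (p ^ r) = X ^ i * Y ^ j"
    by (simp add: ij power_mult_distrib power_mult)
  finally show ?thesis by (simp add: tors_order_def r_def)
qed

text \<open>
  By \<open>(l + 1) (i + l choose l + 1) = (i + l) (i + l - 1 choose l)\<close>, only the \<open>p\<close>-part \<open>p\<^sup>s\<close> of \<open>l + 1\<close>
  is lost, and \<open>t\<^sup>l\<close> makes up for it because \<open>p\<^sup>s \<le> l + 1\<close> forces \<open>s \<le> l\<close>.
\<close>

lemma dvd_binomial_term:
  fixes t c :: int
  assumes p: "prime p" and t: "int p dvd t" and i: "0 < i"
    and dvd: "int p ^ k dvd t * int (i + l) * c"
  shows "int p ^ k dvd int ((i + l) choose (i - 1)) * t ^ Suc l * c"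
proof -
  obtain u where u: "\<not> p dvd u" "Suc l = p ^ multiplicity p (Suc l) * u"
    using multiplicity_decompose'[of "Suc l" p] p by (metis nat.distinct(1) not_prime_unit)
  define s where "s = multiplicity p (Suc l)"
  have "s < p ^ s" using p by (simp add: power_gt_expt prime_gt_Suc_0_nat)
  also have "p ^ s \<le> Suc l" using dvd_imp_le[of "p ^ s" "Suc l"] multiplicity_dvd s_def by blast
  finally have "s \<le> l" by simp
  hence "int p ^ s dvd t ^ l"
    using t by (meson dvd_power_same dvd_trans le_imp_power_dvd)
  then obtain t' where t': "t ^ l = int p ^ s * t'" by blast
  have "Suc l * (i + l choose (i - 1)) = (i + l) * (i + l - 1 choose l)"
    using binomial_symmetric[of "i - 1" "i + l"] i times_binomial_minus1_eq[of "Suc l" "i + l"] by simp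
  hence eq: "int (Suc l) * int (i + l choose (i - 1)) = int (i + l) * int (i + l - 1 choose l)"
    by (metis of_nat_mult)
  have "int p ^ s * (int u * (int (i + l choose (i - 1)) * t ^ Suc l * c))
      = (int (Suc l) * int (i + l choose (i - 1))) * t ^ Suc l * c"
    using u(2) unfolding s_def[symmetric] by (simp only: of_nat_mult of_nat_power mult_ac)
  also have "\<dots> = int p ^ s * ((t * int (i + l) * c) * (int (i + l - 1 choose l) * t'))"
    unfolding eq power_Suc t' by (simp only: mult_ac)
  finally have "int u * (int (i + l choose (i - 1)) * t ^ Suc l * c) = (t * int (i + l) * c) * (int (i + l - 1 choose l) * t')"
    using p by (simp add: prime_gt_0_nat)
  hence "int p ^ k dvd int u * (int (i + l choose (i - 1)) * t ^ Suc l * c)"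
    using dvd by (simp only: dvd_mult2)
  moreover have "coprime (int p ^ k) (int u)"
    using u(1) p prime_imp_coprime_nat[of p u] by simp
  ultimately show ?thesis by (simp add: coprime_dvd_mult_right_iff)
qed

text \<open>Row \<open>r = i - 1\<close> of the hypotheses begins with \<open>t * i * c i\<close>,
  because \<open>i choose (i - 1)\<close> is \<open>i\<close>. The later terms of that row involve
  larger indices only and are covered by induction through \<open>dvd_binomial_term\<close>.\<close>

lemma dvd_of_shift_invariant:
  fixes t :: int and c :: "nat \<Rightarrow> int"
  assumes p: "prime p" and t: "int p dvd t"
    and sums: "\<And>r. r < n \<Longrightarrow> int p ^ k dvd (\<Sum>i=Suc r..n. int (i choose r) * t ^ (i - r) * c i)"
    and "i \<le> n"
  shows "int p ^ k dvd t * int i * c i"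
  using \<open>i \<le> n\<close>
proof (induction "n - i" arbitrary: i rule: less_induct)
  case less
  show ?case
  proof (cases i)
    case (Suc r)
    have "int p ^ k dvd int (i' choose r) * t ^ (i' - r) * c i'" if i': "i' \<in> {Suc i..n}" for i'
    proof -
      have "int p ^ k dvd t * int i' * c i'" using i' by (intro less) auto
      moreover have "i + (i' - i) = i'" "Suc (i' - i) = i' - r" "i - 1 = r" "0 < i" using i' Suc by auto
      ultimately show ?thesis using dvd_binomial_term[of p t i k "i' - i" "c i'"] p t by (simp only:)
    qed
    hence "int p ^ k dvd (\<Sum>i'=Suc i..n. int (i' choose r) * t ^ (i' - r) * c i')"
      by (rule dvd_sum)
    moreover have "int p ^ k dvd (\<Sum>i'=i..n. int (i' choose r) * t ^ (i' - r) * c i')"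
      using sums[of r] Suc less.prems by simp
    moreover have "(\<Sum>i'=i..n. int (i' choose r) * t ^ (i' - r) * c i')
        = int (i choose r) * t ^ (i - r) * c i + (\<Sum>i'=Suc i..n. int (i' choose r) * t ^ (i' - r) * c i')"
      using less.prems by (rule sum.atLeast_Suc_atMost)
    ultimately have "int p ^ k dvd int (i choose r) * t ^ (i - r) * c i"
      by (simp only: dvd_add_left_iff)
    thus ?thesis using Suc by (simp add: mult_ac)
  qed simp
qed

lemma dvd_cf_of_lower:
  assumes "prime p" "int p dvd t" "of_int (int p ^ k) dvd act (lower t) f - f"
  shows "int p ^ k dvd t * int i * cf f i j"
proof -
  have "int p ^ k dvd (\<Sum>l=Suc r..i + j. int (l choose r) * t ^ (l - r) * cf f l (i + j - l))" if r: "r < i + j" for r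
  proof -
    have "int p ^ k dvd cf (act (lower t) f - f) r (i + j - r)"
      using assms(3) unfolding of_int_dvd_iff by blast
    moreover have "cf (act (lower t) f) r (i + j - r) =
        cf f r (i + j - r) + (\<Sum>l=Suc r..i + j. int (l choose r) * t ^ (l - r) * cf f l (i + j - l))"
      unfolding cf_act_lower using r by (simp add: sum.atLeast_Suc_atMost)
    ultimately show ?thesis by simp
  qed
  from dvd_of_shift_invariant[OF assms(1,2) this, where i = i] show ?thesis by simp
qed

lemma dvd_cf_of_upper:
  assumes "prime p" "int p dvd t" "of_int (int p ^ k) dvd act (upper t) f - f"
  shows "int p ^ k dvd t * int j * cf f i j"
proof -
  have "int p ^ k dvd (\<Sum>l=Suc r..i + j. int (l choose r) * t ^ (l - r) * cf f (i + j - l) l)" if r: "r < i + j" for r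
  proof -
    have "int p ^ k dvd cf (act (upper t) f - f) (i + j - r) r"
      using assms(3) unfolding of_int_dvd_iff by blast
    moreover have "cf (act (upper t) f) (i + j - r) r =
        cf f (i + j - r) r + (\<Sum>l=Suc r..i + j. int (l choose r) * t ^ (l - r) * cf f (i + j - l) l)"
      unfolding cf_act_upper using r by (simp add: sum.atLeast_Suc_atMost)
    ultimately show ?thesis by simp
  qed
  from dvd_of_shift_invariant[OF assms(1,2) this, where i = j] show ?thesis by simp
qed

lemma prime_power_dvd_multD:
  assumes p: "prime p" and "x \<noteq> 0" and "int p ^ k dvd int x * y"
  shows "int p ^ k dvd int (p ^ multiplicity p x) * y"
proof -
  obtain u where u: "\<not> p dvd u" "x = p ^ multiplicity p x * u"
    using multiplicity_decompose'[of x p] p assms(2) by (metis not_prime_unit)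
  have "int p ^ k dvd int u * (int (p ^ multiplicity p x) * y)"
    using assms(3) u(2) by (metis of_nat_mult mult.assoc mult.commute)
  moreover have "coprime (int p ^ k) (int u)"
    using u(1) p prime_imp_coprime_nat[of p u] by simp
  ultimately show ?thesis by (simp add: coprime_dvd_mult_right_iff)
qed

text \<open>The two shears show that \<open>p^k\<close> divides \<open>m * i * c\<close> and
  \<open>m * j * c\<close> for the coefficient \<open>c\<close>. A Bezout combination gives
  \<open>m * gcd i j * c\<close>, and \<open>tors_order p a i j\<close> is the \<open>p\<close>-part
  of \<open>m * gcd i j\<close>.\<close>

lemma dvd_tors_order_cf:
  assumes p: "prime p" and m: "0 < m" "multiplicity p m = a" "0 < a"
    and S: "lower (int m) \<in> S" "upper (int m) \<in> S"
    and inv: "inv_mod S (int p ^ k) f" and ij: "(i, j) \<noteq> (0, 0)"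
  shows "int p ^ k dvd int (tors_order p a i j) * cf f i j"
proof -
  have pm: "int p dvd int m" using m p by (metis dvd_power dvd_trans multiplicity_dvd of_nat_dvd_iff)
  have "int p ^ k dvd int m * int i * cf f i j"
    using inv S by (intro dvd_cf_of_lower[OF p pm]) (auto simp: inv_mod_def)
  moreover have "int p ^ k dvd int m * int j * cf f i j"
    using inv S by (intro dvd_cf_of_upper[OF p pm]) (auto simp: inv_mod_def)
  moreover obtain x y where xy: "gcd (int i) (int j) = x * int i + y * int j" using bezout_int by metis
  have "int m * gcd (int i) (int j) * cf f i j
      = x * (int m * int i * cf f i j) + y * (int m * int j * cf f i j)"
    unfolding xy by (simp only: algebra_simps)
  ultimately have "int p ^ k dvd int m * gcd (int i) (int j) * cf f i j"
    by (simp only: dvd_add dvd_mult)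
  hence "int p ^ k dvd int (m * gcd i j) * cf f i j" by simp
  hence "int p ^ k dvd int (p ^ multiplicity p (m * gcd i j)) * cf f i j"
    using ij m by (intro prime_power_dvd_multD p) auto
  thus ?thesis using ij m p by (simp add: prime_elem_multiplicity_mult_distrib tors_order_def)
qed

lemma zero_of_prime_powers_dvd:
  fixes z :: int
  assumes "prime p" "\<And>k. int p ^ k dvd z" shows "z = 0"
proof (rule ccontr)
  assume "z \<noteq> 0"
  with assms(2) have "int p ^ nat \<bar>z\<bar> \<le> \<bar>z\<bar>" by (metis zdvd_imp_le dvd_abs_iff zero_less_abs_iff)
  moreover have "nat \<bar>z\<bar> < p ^ nat \<bar>z\<bar>" using assms(1) by (simp add: power_gt_expt prime_gt_Suc_0_nat)
  ultimately show False by (metis int_nat_eq nat_less_iff abs_ge_zero not_le of_nat_power of_nat_less_iff)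
qed

text \<open>For a prime \<open>p\<close> dividing \<open>m\<close>, an invariant is invariant modulo
  every \<open>p^k\<close>. The product of a coefficient with the fixed nonzero factor
  \<open>tors_order\<close> is then divisible by all powers of \<open>p\<close>, hence zero.\<close>

lemma invariant_eq_0:
  assumes "1 < m" "lower (int m) \<in> S" "upper (int m) \<in> S"
    and f: "f \<in> graded {0<..}" and inv: "inv_mod S 0 f"
  shows "f = 0"
proof -
  obtain p where p: "prime p" "p dvd m" using assms(1) prime_factor_nat by (metis less_irrefl)
  have "cf f i j = 0" for i j
  proof (cases "(i, j) = (0, 0)")
    case True thus ?thesis using f by (force simp: graded_def)
  next
    case False
    have "multiplicity p m > 0" using p assms(1) by (simp add: prime_multiplicity_gt_zero_iff)
    hence "int (tors_order p (multiplicity p m) i j) * cf f i j = 0"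
      using assms False p
      by (intro zero_of_prime_powers_dvd[OF p(1)] dvd_tors_order_cf) (auto intro: inv_mod_dvd[OF inv])
    thus ?thesis using tors_order_pos[OF p(1)] by (metis mult_eq_0_iff of_nat_0_less_iff less_irrefl)
  qed
  thus ?thesis by (intro poly2_eqI) simp
qed

section \<open>Dickson invariants of $SL_2(\mathbb{F}_p)$\<close>

text \<open>Evaluation of a formal integer combination on a family \<open>e\<close>. The free
  abelian group of such combinations is the common source that is later mapped to cohomology and to
  the tensor product.\<close>

definition comb :: "('a \<Rightarrow> 'b::comm_ring_1) \<Rightarrow> ('a \<Rightarrow>\<^sub>0 int) \<Rightarrow> 'b" where
  "comb e c = (\<Sum>z\<in>Poly_Mapping.keys c. of_int (poly_mapping.lookup c z) * e z)"

lemma comb_superset: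
  "finite S \<Longrightarrow> Poly_Mapping.keys c \<subseteq> S \<Longrightarrow> comb e c = (\<Sum>z\<in>S. of_int (poly_mapping.lookup c z) * e z)"
  unfolding comb_def by (rule sum.mono_neutral_left) (auto simp: in_keys_iff)

lemma comb_add: "comb e (c + d) = comb e c + comb e d"
proof -
  let ?S = "Poly_Mapping.keys c \<union> Poly_Mapping.keys d"
  have "comb e (c + d) = (\<Sum>z\<in>?S. of_int (poly_mapping.lookup (c + d) z) * e z)"
    by (rule comb_superset) (auto simp: keys_add)
  moreover have "comb e c = (\<Sum>z\<in>?S. of_int (poly_mapping.lookup c z) * e z)"
    "comb e d = (\<Sum>z\<in>?S. of_int (poly_mapping.lookup d z) * e z)"
    by (rule comb_superset; simp)+
  ultimately show ?thesis
    by (simp add: lookup_add distrib_right sum.distrib)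
qed

lemma comb_cmul: "comb e (frag_cmul k c) = of_int k * comb e c"
proof -
  have "comb e (frag_cmul k c) = (\<Sum>z\<in>Poly_Mapping.keys c. of_int (poly_mapping.lookup (frag_cmul k c) z) * e z)"
    by (rule comb_superset) (auto simp: keys_cmul)
  thus ?thesis by (simp add: comb_def sum_distrib_left mult.assoc)
qed

lemma comb_0 [simp]: "comb e 0 = 0"
  by (simp add: comb_def)

lemma comb_of [simp]: "comb e (frag_of z) = e z"
  by (simp add: comb_def keys_frag_of)

lemma comb_minus: "comb e (- c) = - comb e c"
  using comb_cmul[of e "-1" c] by simp

lemma comb_diff: "comb e (c - d) = comb e c - comb e d"
  using comb_add[of e c "- d"] comb_minus[of e d] by simp

section \<open>Frobenius and Fermat congruences modulo a prime\<close>

lemma freshman: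
  fixes f g :: "'a::comm_ring_1"
  assumes "prime p" shows "of_int (int p) dvd (f + g) ^ p - (f ^ p + g ^ p)"
proof -
  obtain n where n: "p = Suc n" "0 < n" using prime_gt_1_nat[OF assms] by (cases p) auto
  have "(f + g) ^ p = (\<Sum>k\<le>Suc n. of_nat (p choose k) * f ^ k * g ^ (p - k))"
    by (subst binomial_ring) (simp add: n)
  also have "\<dots> = (\<Sum>k=1..n. of_nat (p choose k) * f ^ k * g ^ (p - k)) + (f ^ p + g ^ p)"
  proof -
    have "{..Suc n} = insert 0 (insert (Suc n) {1..n})" by auto
    thus ?thesis using n by simp
  qed
  finally have "(f + g) ^ p - (f ^ p + g ^ p) = (\<Sum>k=1..n. of_nat (p choose k) * f ^ k * g ^ (p - k))" by simp
  moreover have "of_int (int p) dvd of_nat (p choose k) * f ^ k * g ^ (p - k)" if "k \<in> {1..n}" for k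
  proof -
    have "p dvd p choose k" using that n assms by (intro dvd_choose_prime) auto
    hence "(of_nat p :: 'a) dvd of_nat (p choose k)" by (metis dvd_def of_nat_mult)
    thus ?thesis by (simp add: dvd_mult2)
  qed
  ultimately show ?thesis by (simp only: dvd_sum)
qed

lemma dvd_diff_trans: "(d::'a::comm_ring_1) dvd a - b \<Longrightarrow> d dvd b - c \<Longrightarrow> d dvd a - c"
  using dvd_add[of d "a - b" "b - c"] by simp

lemma dvd_diff_sym: "(d::'a::comm_ring_1) dvd a - b \<Longrightarrow> d dvd b - a"
  by (metis dvd_minus_iff minus_diff_eq)

lemma dvd_diff_mult:
  "(d::'a::comm_ring_1) dvd a - b \<Longrightarrow> d dvd a' - b' \<Longrightarrow> d dvd a * a' - b * b'"
  using dvd_add[OF dvd_mult2[of d "a - b" a'] dvd_mult[of d "a' - b'" b]] by (simp add: algebra_simps)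

lemma dvd_diff_add:
  "(d::'a::comm_ring_1) dvd a - b \<Longrightarrow> d dvd a' - b' \<Longrightarrow> d dvd (a + a') - (b + b')"
  using dvd_add[of d "a - b" "a' - b'"] by (simp add: algebra_simps)

lemma dvd_diff_power: "(d::'a::comm_ring_1) dvd a - b \<Longrightarrow> d dvd a ^ n - b ^ n"
  by (induction n) (auto intro: dvd_diff_mult)

lemma freshman_power:
  fixes f g :: "'a::comm_ring_1"
  assumes "prime p" shows "of_int (int p) dvd (f + g) ^ p ^ k - (f ^ p ^ k + g ^ p ^ k)"
proof (induction k)
  case (Suc k)
  have "of_int (int p) dvd ((f + g) ^ p ^ k) ^ p - (f ^ p ^ k + g ^ p ^ k) ^ p"
    by (rule dvd_diff_power[OF Suc])
  from dvd_diff_trans[OF this freshman[OF assms]] show ?case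
    by (simp add: power_mult[symmetric] mult.commute)
qed simp

lemma fermat_int:
  assumes "prime p" shows "int p dvd c ^ p - c"
proof (induction c rule: int_induct[where k = 0])
  case base thus ?case using prime_gt_0_nat[OF assms] by (simp add: power_0_left)
next
  case (step1 i)
  have "int p dvd (i + 1) ^ p - (i ^ p + 1)" using freshman[OF assms, of i 1] by simp
  moreover have "int p dvd (i ^ p + 1) - (i + 1)" using step1 by simp
  ultimately show ?case by (rule dvd_diff_trans)
next
  case (step2 i)
  have "int p dvd (i - 1 + 1) ^ p - ((i - 1) ^ p + 1)" using freshman[OF assms, of "i - 1" 1] by simp
  hence "int p dvd ((i - 1) ^ p + 1) - i ^ p" using dvd_diff_sym by force
  from dvd_diff_trans[OF this step2(2)] show ?case by (simp add: algebra_simps)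
qed

lemma fermat_int_power:
  assumes "prime p" shows "int p dvd c ^ p ^ k - c"
proof (induction k)
  case (Suc k)
  have "int p dvd (c ^ p ^ k) ^ p - c ^ p"
    by (rule dvd_diff_power[OF Suc])
  from dvd_diff_trans[OF this fermat_int[OF assms]] show ?case
    by (simp add: power_mult[symmetric] mult.commute)
qed simp

lemma of_int_dvd_of_int: "a dvd b \<Longrightarrow> (of_int a :: 'a::comm_ring_1) dvd of_int b"
  by (metis dvd_def of_int_mult)

text \<open>Modulo \<open>p\<close>, raising to the power \<open>p^k\<close> is additive and, by
  Fermat, fixes the integer coefficients, so only the variables are raised.\<close>

lemma frobenius_subst:
  assumes p: "prime p"
  shows "of_int (int p) dvd f ^ p ^ k - subst_xy (var_x ^ p ^ k) (var_y ^ p ^ k) f"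
proof (induction f rule: poly2_induct)
  case (mon c i j)
  have "of_int (int p) dvd of_int (c ^ p ^ k) * mon i j ^ p ^ k - of_int c * mon i j ^ p ^ k"
    using of_int_dvd_of_int[OF fermat_int_power[OF p, of c k], where 'a = "int poly poly"]
    by (simp add: left_diff_distrib[symmetric])
  moreover have "mon i j ^ p ^ k = (var_x ^ p ^ k) ^ i * (var_y ^ p ^ k) ^ j"
    by (simp add: mon_eq power_mult_distrib power_mult[symmetric] mult.commute)
  ultimately show ?case
    by (simp add: subst_xy_mult subst_xy_mon power_mult_distrib)
next
  case (add f g)
  show ?case
    using dvd_diff_trans[OF freshman_power[OF p, of f g k] dvd_diff_add[OF add]] by (simp add: subst_xy_add)
qed

section \<open>Dickson's invariants \<open>P\<close> and \<open>Q\<close>\<close>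

lemma prime_elem_of_int_poly2:
  assumes "prime p" shows "prime_elem (of_int (int p) :: int poly poly)"
  unfolding of_int_poly2 prime_elem_const_poly_iff using assms by simp

text \<open>Modulo \<open>p\<close> this is \<open>y\<close> times the product of all
  \<open>x - c y\<close> with \<open>c\<close> in the field of \<open>p\<close> elements: one linear
  form for each line through the origin.\<close>

definition dickson_P :: "nat \<Rightarrow> int poly poly" where
  "dickson_P p = var_x ^ p * var_y - var_x * var_y ^ p"

text \<open>With \<open>X = x^(p-1)\<close> and \<open>Y = y^(p-1)\<close> one has
  \<open>P = x y (X - Y)\<close>, and this sum is the cofactor of \<open>X - Y\<close> in
  \<open>X^(p+1) - Y^(p+1)\<close>. It is therefore the exact quotient of
  \<open>x^(p^2) y - x y^(p^2)\<close> by \<open>P\<close>.\<close>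

definition dickson_Q :: "nat \<Rightarrow> int poly poly" where
  "dickson_Q p = (\<Sum>i\<le>p. (var_x ^ (p - 1)) ^ (p - i) * (var_y ^ (p - 1)) ^ i)"

lemma dickson_P_mult_Q:
  assumes "0 < p"
  shows "dickson_P p * dickson_Q p = var_x ^ p ^ 2 * var_y - var_x * var_y ^ p ^ 2"
proof -
  let ?X = "var_x ^ (p - 1)" and ?Y = "var_y ^ (p - 1)"
  have sq: "Suc ((p - 1) * Suc p) = p ^ 2"
    using assms by (cases p) (auto simp: power2_eq_square algebra_simps)
  have "dickson_P p = var_x * var_y * (?X - ?Y)"
    using power_minus_mult[OF assms, of var_x] power_minus_mult[OF assms, of var_y]
    by (simp add: dickson_P_def algebra_simps)
  also have "\<dots> * dickson_Q p = var_x * var_y * ((?X - ?Y) * (\<Sum>i\<le>p. ?X ^ i * ?Y ^ (p - i)))"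
    unfolding dickson_Q_def
    by (subst (2) sum.nat_diff_reindex[symmetric, of _ "Suc p", unfolded lessThan_Suc_atMost]) (simp add: mult_ac)
  also have "(?X - ?Y) * (\<Sum>i\<le>p. ?X ^ i * ?Y ^ (p - i)) = ?X ^ Suc p - ?Y ^ Suc p"
    by (simp add: diff_power_eq_sum lessThan_Suc_atMost mult.commute del: power_Suc sum.lessThan_Suc)
  also have "var_x * var_y * \<dots> = var_x ^ Suc ((p - 1) * Suc p) * var_y - var_x * var_y ^ Suc ((p - 1) * Suc p)"
    unfolding power_Suc[of _ "(p - 1) * Suc p"] power_mult by (simp only: right_diff_distrib mult_ac)
  finally show ?thesis unfolding sq .
qed

lemma SL2Z_det: "A \<in> carrier SL2Z \<Longrightarrow> A $ 1 $ 1 * A $ 2 $ 2 - A $ 1 $ 2 * A $ 2 $ 1 = 1"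
  by (simp add: SL2Z_def det_2)

lemma act_var_power:
  assumes p: "prime p"
  shows "of_int (int p) dvd act A var_x ^ p ^ k - (of_int (A $ 1 $ 1) * var_x ^ p ^ k + of_int (A $ 2 $ 1) * var_y ^ p ^ k)"
    and "of_int (int p) dvd act A var_y ^ p ^ k - (of_int (A $ 1 $ 2) * var_x ^ p ^ k + of_int (A $ 2 $ 2) * var_y ^ p ^ k)"
  using frobenius_subst[OF p, of "act A var_x" k] frobenius_subst[OF p, of "act A var_y" k]
  by (simp_all add: act_x act_y subst_xy_add subst_xy_mult)

text \<open>The expression is the determinant of the rows \<open>(x^(p^k), y^(p^k))\<close> and
  \<open>(x, y)\<close>. Frobenius fixes the matrix entries modulo \<open>p\<close>, so both rows
  are transformed by the same matrix \<open>A\<close>, and the determinant is multiplied by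
  \<open>det A = 1\<close>.\<close>

lemma inv_mod_moore_det:
  assumes p: "prime p"
  shows "inv_mod (carrier SL2Z) (int p) (var_x ^ p ^ k * var_y - var_x * var_y ^ p ^ k)"
  unfolding inv_mod_def
proof
  fix A assume "A \<in> carrier SL2Z"
  note det = arg_cong[OF SL2Z_det[OF this], of "of_int :: int \<Rightarrow> int poly poly", simplified]
  let ?a = "of_int (A $ 1 $ 1) :: int poly poly" and ?b = "of_int (A $ 1 $ 2) :: int poly poly"
    and ?c = "of_int (A $ 2 $ 1) :: int poly poly" and ?d = "of_int (A $ 2 $ 2) :: int poly poly"
  let ?x = "act A var_x" and ?y = "act A var_y" and ?X = "var_x ^ p ^ k" and ?Y = "var_y ^ p ^ k"
  have "of_int (int p) dvd (?x ^ p ^ k * ?y - ?x * ?y ^ p ^ k)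
      - ((?a * ?X + ?c * ?Y) * ?y - ?x * (?b * ?X + ?d * ?Y))"
    using dvd_diff[OF dvd_mult2[OF act_var_power(1)[OF p, of A k], of ?y] dvd_mult[OF act_var_power(2)[OF p, of A k], of ?x]]
    by (simp add: algebra_simps)
  moreover have "(?a * ?X + ?c * ?Y) * ?y - ?x * (?b * ?X + ?d * ?Y)
      = (?a * ?d - ?b * ?c) * (?X * var_y - var_x * ?Y)"
    unfolding act_x act_y by (simp add: algebra_simps)
  ultimately show "of_int (int p) dvd act A (?X * var_y - var_x * ?Y) - (?X * var_y - var_x * ?Y)"
    unfolding det by (simp add: act_diff act_mult act_power)
qed

text \<open>It yields the invariance of \<open>Q\<close> from that of \<open>P\<close> and
  \<open>P Q\<close>, and it allows the induction in Dickson's theorem to divide by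
  \<open>P\<close>.\<close>

lemma inv_mod_cancel:
  assumes d: "prime_elem (of_int d :: int poly poly)" "\<not> of_int d dvd w"
    and w: "inv_mod S d w" and wv: "inv_mod S d (w * v)"
  shows "inv_mod S d v"
  unfolding inv_mod_def
proof
  fix g assume g: "g \<in> S"
  have "w * (act g v - v) = (act g (w * v) - w * v) - (act g w - w) * act g v"
    by (simp add: act_mult algebra_simps)
  hence "of_int d dvd w * (act g v - v)"
    using w wv g by (simp add: inv_mod_def)
  thus "of_int d dvd act g v - v"
    using d prime_elem_dvd_mult_iff by blast
qed

section \<open>Initial terms in \<open>y\<close> and independence of the monomials in
  \<open>P\<close> and \<open>Q\<close>\<close>

definition leads :: "int poly poly \<Rightarrow> nat \<Rightarrow> nat \<Rightarrow> bool" where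
  "leads f a i \<longleftrightarrow> (\<forall>r<i. Polynomial.coeff f r = 0) \<and> Polynomial.coeff f i = Polynomial.monom 1 a"

text \<open>The lowest power of \<open>y\<close> behaves like a valuation: below order
  \<open>i + j\<close> one of the two factors always vanishes, and at that order only the two
  initial coefficients meet.\<close>

lemma leads_mult:
  assumes "leads f a i" "leads g b j" shows "leads (f * g) (a + b) (i + j)"
proof -
  have z: "Polynomial.coeff f l * Polynomial.coeff g (r - l) = 0" if "r \<le> i + j" "l \<le> r" "\<not> (r = i + j \<and> l = i)" for r l
  proof -
    have "l < i \<or> r - l < j" using that by linarith
    thus ?thesis using assms by (auto simp: leads_def)
  qed
  have "Polynomial.coeff (f * g) r = 0" if "r < i + j" for r
    using that by (auto simp: coeff_mult intro!: sum.neutral z)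
  moreover have "Polynomial.coeff (f * g) (i + j) = (\<Sum>l\<le>i + j. if l = i then Polynomial.monom 1 (a + b) else 0)"
    unfolding coeff_mult using assms z[of "i + j"] by (intro sum.cong) (auto simp: leads_def mult_monom)
  ultimately show ?thesis by (simp add: leads_def)
qed

lemma leads_power: "leads f a i \<Longrightarrow> leads (f ^ n) (n * a) (n * i)"
proof (induction n)
  case 0 thus ?case by (simp add: leads_def)
next
  case (Suc n) thus ?case using leads_mult[of f a i "f ^ n" "n * a" "n * i"] by simp
qed

lemma leads_mon_add:
  assumes "\<forall>r\<le>i. Polynomial.coeff g r = 0" shows "leads (mon a i + g) a i"
  using assms by (simp add: leads_def mon_def)

lemma leads_dickson_P:
  assumes p: "1 < p" shows "leads (dickson_P p) p 1"
proof -
  have "dickson_P p = mon p 1 + (- mon 1 p)" by (simp add: dickson_P_def mon_eq)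
  moreover have "leads (mon p 1 + (- mon 1 p)) p 1" using p by (intro leads_mon_add) (auto simp: mon_def)
  ultimately show ?thesis by simp
qed

lemma leads_dickson_Q:
  assumes p: "1 < p" shows "leads (dickson_Q p) (p * (p - 1)) 0"
proof -
  have "dickson_Q p = (\<Sum>i\<le>p. mon ((p - 1) * (p - i)) ((p - 1) * i))"
    by (simp only: dickson_Q_def mon_eq power_mult)
  also have "\<dots> = mon (p * (p - 1)) 0 + (\<Sum>i\<in>{..p} - {0}. mon ((p - 1) * (p - i)) ((p - 1) * i))"
    by (subst sum.remove[of _ 0]) (auto simp: mult.commute)
  finally have "dickson_Q p = mon (p * (p - 1)) 0 + (\<Sum>i\<in>{..p} - {0}. mon ((p - 1) * (p - i)) ((p - 1) * i))" .
  moreover have "leads (mon (p * (p - 1)) 0 + (\<Sum>i\<in>{..p} - {0}. mon ((p - 1) * (p - i)) ((p - 1) * i))) (p * (p - 1)) 0"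
    using p by (intro leads_mon_add) (auto simp: coeff_sum mon_def intro!: sum.neutral)
  ultimately show ?thesis by simp
qed

lemma leads_not_dvd:
  assumes "prime p" "leads f a i" shows "\<not> of_int (int p) dvd f"
proof
  assume "of_int (int p) dvd f"
  hence "int p dvd cf f a i" by (simp only: of_int_dvd_iff)
  thus False using assms prime_gt_1_nat by (auto simp: leads_def)
qed

lemma inv_mod_dickson_P: "prime p \<Longrightarrow> inv_mod (carrier SL2Z) (int p) (dickson_P p)"
  using inv_mod_moore_det[of p 1] by (simp add: dickson_P_def)

lemma inv_mod_dickson_Q:
  assumes "prime p" shows "inv_mod (carrier SL2Z) (int p) (dickson_Q p)"
proof (rule inv_mod_cancel[where w = "dickson_P p"])
  show "inv_mod (carrier SL2Z) (int p) (dickson_P p * dickson_Q p)"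
    using assms inv_mod_moore_det[of p 2] by (simp add: dickson_P_mult_Q prime_gt_0_nat)
  show "\<not> of_int (int p) dvd dickson_P p"
    using assms leads_not_dvd leads_dickson_P prime_gt_1_nat by blast
qed (intro prime_elem_of_int_poly2 inv_mod_dickson_P assms)+

lemma dickson_P_graded: "0 < p \<Longrightarrow> dickson_P p \<in> graded {p + 1}"
  unfolding dickson_P_def
  using mon_graded[of p 1 "{p + 1}"] mon_graded[of 1 p "{p + 1}"] by (auto simp: mon_eq intro: graded_diff)

lemma dickson_Q_graded: "dickson_Q p \<in> graded {p * (p - 1)}"
proof -
  have "mon ((p - 1) * (p - i)) ((p - 1) * i) \<in> graded {p * (p - 1)}" if "i \<le> p" for i
  proof -
    have "(p - 1) * (p - i) + (p - 1) * i = (p - 1) * (p - i + i)" by (simp only: distrib_left)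
    thus ?thesis using that by (intro mon_graded) (simp add: mult.commute)
  qed
  thus ?thesis by (auto simp: dickson_Q_def mon_eq power_mult intro!: graded_sum)
qed

definition dickson_mon :: "nat \<Rightarrow> nat \<times> nat \<Rightarrow> int poly poly" where
  "dickson_mon p z = dickson_P p ^ fst z * dickson_Q p ^ snd z"

text \<open>The polynomial grading is used here, so the weights are half of the degrees
  \<open>2(p+1)\<close> and \<open>2p(p-1)\<close>.\<close>

definition dickson_index :: "nat \<Rightarrow> nat \<Rightarrow> (nat \<times> nat) set" where
  "dickson_index p n = {(i, j). (p + 1) * i + p * (p - 1) * j = n}"

lemma dickson_mon_graded:
  assumes "0 < p" "z \<in> dickson_index p n" shows "dickson_mon p z \<in> graded {n}"
  using graded_mult[OF graded_power[OF dickson_P_graded, of p "fst z"] graded_power[OF dickson_Q_graded[of p], of "snd z"]] assms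
  by (cases z) (auto simp: dickson_mon_def dickson_index_def)

lemma leads_dickson_mon:
  assumes "1 < p" shows "leads (dickson_mon p (i, j)) (i * p + j * (p * (p - 1))) i"
  using leads_mult[OF leads_power[OF leads_dickson_P[OF assms], of i] leads_power[OF leads_dickson_Q[OF assms], of j]]
  by (simp add: dickson_mon_def)

text \<open>\<open>P^i Q^j\<close> starts at \<open>y^i\<close>, and in fixed degree
  \<open>i\<close> determines \<open>j\<close>. At its initial position the monomials with larger
  first exponent vanish, and those with smaller first exponent have coefficients already known to be
  divisible by \<open>q\<close>, so only the coefficient sought remains.\<close>

lemma dickson_mon_independent:
  assumes p: "1 < p" and keys: "Poly_Mapping.keys d \<subseteq> dickson_index p n"
    and dvd: "of_int q dvd comb (dickson_mon p) d"
  shows "q dvd poly_mapping.lookup d (i, j)"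
proof (induction i arbitrary: j rule: less_induct)
  case (less i)
  show ?case
  proof (cases "(i, j) \<in> Poly_Mapping.keys d")
    case True
    let ?A = "i * p + j * (p * (p - 1))"
    have "q dvd poly_mapping.lookup d z * cf (dickson_mon p z) ?A i" if z: "z \<in> Poly_Mapping.keys d - {(i, j)}" for z
    proof -
      obtain i' j' where [simp]: "z = (i', j')" by (cases z)
      note l = leads_dickson_mon[OF p, of i' j']
      have "i' \<noteq> i"
      proof
        assume "i' = i"
        have "(i', j') \<in> dickson_index p n" "(i, j) \<in> dickson_index p n" using z True keys by auto
        hence "(p + 1) * i + p * (p - 1) * j = (p + 1) * i + p * (p - 1) * j'"
          using \<open>i' = i\<close> by (simp add: dickson_index_def)
        hence "j = j'" using p by simp
        thus False using z \<open>i' = i\<close> by simp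
      qed
      thus ?thesis using less.IH[of i' j'] l by (cases "i' < i") (auto simp: leads_def)
    qed
    hence "q dvd (\<Sum>z\<in>Poly_Mapping.keys d - {(i, j)}. poly_mapping.lookup d z * cf (dickson_mon p z) ?A i)"
      by (rule dvd_sum)
    moreover have "cf (comb (dickson_mon p) d) ?A i = (\<Sum>z\<in>Poly_Mapping.keys d. poly_mapping.lookup d z * cf (dickson_mon p z) ?A i)"
      unfolding comb_def cf_sum by simp
    moreover have "\<dots> = poly_mapping.lookup d (i, j) * cf (dickson_mon p (i, j)) ?A i
        + (\<Sum>z\<in>Poly_Mapping.keys d - {(i, j)}. poly_mapping.lookup d z * cf (dickson_mon p z) ?A i)"
      using True by (simp add: sum.remove)
    moreover have "cf (dickson_mon p (i, j)) ?A i = 1"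
      using leads_dickson_mon[OF p, of i j] by (simp add: leads_def)
    moreover have "q dvd cf (comb (dickson_mon p) d) ?A i"
      using dvd by (simp add: of_int_dvd_iff)
    ultimately show ?thesis by (simp add: dvd_add_left_iff)
  qed (simp add: in_keys_iff)
qed

section \<open>Evaluation at integral points\<close>

definition ev :: "int \<Rightarrow> int \<Rightarrow> int poly poly \<Rightarrow> int" where
  "ev a b f = poly (poly f [:b:]) a"

lemma ev_simps [simp]:
  "ev a b (f + g) = ev a b f + ev a b g" "ev a b (f - g) = ev a b f - ev a b g"
  "ev a b (f * g) = ev a b f * ev a b g" "ev a b (f ^ n) = ev a b f ^ n" "ev a b (of_int c) = c"
  "ev a b (sum h S) = (\<Sum>s\<in>S. ev a b (h s))"
  by (simp_all add: ev_def of_int_poly2 poly_sum)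

lemma ev_var [simp]: "ev a b var_x = a" "ev a b var_y = b"
  by (simp_all add: ev_def var_x_def var_y_def)

lemma ev_mon [simp]: "ev a b (mon i j) = a ^ i * b ^ j"
  by (simp add: mon_eq)

lemma ev_act: "ev a b (act A f) = ev (A $ 1 $ 1 * a + A $ 2 $ 1 * b) (A $ 1 $ 2 * a + A $ 2 $ 2 * b) f"
  by (induction f rule: poly2_induct) (simp_all add: act_add act_mult act_mon act_x act_y)

lemma dvd_ev: assumes "of_int q dvd f" shows "q dvd ev a b f"
proof -
  obtain g where "f = of_int q * g" using assms by blast
  thus ?thesis by simp
qed

lemma dvd_ev_diff:
  assumes "q dvd a - a'" "q dvd b - b'" shows "q dvd ev a b f - ev a' b' f"
proof (induction f rule: poly2_induct)
  case (mon c i j)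
  have "q dvd c * (a ^ i * b ^ j) - c * (a' ^ i * b' ^ j)"
    by (intro dvd_diff_mult dvd_diff_power assms) simp
  thus ?case by simp
next
  case (add f g) thus ?case using dvd_diff_add by fastforce
qed

lemma graded_expand: "f \<in> graded {n} \<Longrightarrow> f = (\<Sum>i\<le>n. of_int (cf f i (n - i)) * mon i (n - i))"
  using hcomp_graded[of f n n] by (simp add: hcomp_def)

lemma ev_graded_axis:
  assumes "f \<in> graded {n}" shows "ev a 0 f = cf f n 0 * a ^ n"
proof -
  have "ev a 0 f = (\<Sum>i\<le>n. cf f i (n - i) * (a ^ i * 0 ^ (n - i)))"
    by (subst graded_expand[OF assms]) simp
  also have "\<dots> = (\<Sum>i\<le>n. if i = n then cf f n 0 * a ^ n else 0)"
    by (intro sum.cong) (auto simp: power_0_left)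
  finally show ?thesis by simp
qed

text \<open>Bezout completes \<open>(a, b)\<close> to the first row of a matrix of determinant 1,
  and evaluating the transformed polynomial at \<open>(1, 0)\<close> is evaluating the original one
  at \<open>(a, b)\<close>.\<close>

lemma ev_primitive_vector:
  assumes inv: "inv_mod (carrier SL2Z) q f" and "coprime a b"
  shows "q dvd ev a b f - ev 1 0 f"
proof -
  obtain u v where uv: "u * a + v * b = 1" using assms(2) bezout_int[of a b] by auto
  let ?A = "vector [vector [a, b], vector [- v, u]] :: int^2^2"
  have "?A \<in> carrier SL2Z" using uv by (simp add: SL2Z_def det_2 algebra_simps)
  hence "q dvd ev 1 0 (act ?A f - f)" using inv by (intro dvd_ev) (auto simp: inv_mod_def)
  thus ?thesis by (simp add: ev_act)
qed

text \<open>
  The factor \<open>p\<close> comes from the shear \<open>x \<mapsto> x + y\<close>, and the factor \<open>p - 1\<close> from the fact that an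
  invariant is constant on the nonzero vectors of \<open>\<int>/p \<times> \<int>/p\<close>.
\<close>

lemma degree_dvd_of_axis:
  assumes p: "prime p" and f: "f \<in> graded {n}" and inv: "inv_mod (carrier SL2Z) (int p) f"
    and c: "\<not> int p dvd cf f n 0"
  shows "p * (p - 1) dvd n"
proof (cases n)
  case (Suc m)
  have "lower 1 \<in> carrier SL2Z" by (simp add: SL2Z_def det_2 lower_def)
  hence "of_int (int p) dvd act (lower 1) f - f" using inv unfolding inv_mod_def by blast
  hence "int p dvd cf (act (lower 1) f - f) m 1" unfolding of_int_dvd_iff by blast
  moreover have "cf (act (lower 1) f) m 1 = cf f m 1 + int n * cf f n 0"
    unfolding cf_act_lower using Suc by simp
  ultimately have "int p dvd int n * cf f n 0" by simp
  hence "p dvd n" using p c by (simp add: prime_dvd_mult_iff)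
  moreover have "p - 1 dvd n"
  proof -
    obtain g where g: "residue_primroot p g" using prime_primitive_root_exists[of p] p prime_gt_1_nat by blast
    \<comment> \<open>The axis point \<open>(g, 0)\<close> need not be primitive;
      \<open>(g, p)\<close> is, and the two are congruent modulo \<open>p\<close>.\<close>
    have "coprime (int g) (int p)" using g by (auto simp: residue_primroot_def coprime_commute)
    hence "int p dvd ev (int g) (int p) f - ev 1 0 f" by (rule ev_primitive_vector[OF inv])
    moreover have "int p dvd ev (int g) 0 f - ev (int g) (int p) f" by (rule dvd_ev_diff) auto
    ultimately have "int p dvd ev (int g) 0 f - ev 1 0 f" using dvd_diff_trans by blast
    hence "int p dvd cf f n 0 * (int g ^ n - 1)"
      by (simp add: ev_graded_axis[OF f] right_diff_distrib)
    hence "int p dvd int g ^ n - 1" using p c by (simp add: prime_dvd_mult_iff)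
    hence "[int (g ^ n) = int 1] (mod int p)" by (simp add: cong_iff_dvd_diff)
    hence "[g ^ n = 1] (mod p)" by (simp only: cong_int_iff)
    hence "ord p g dvd n" by (simp only: ord_divides)
    thus ?thesis using g p by (simp add: residue_primroot_def totient_prime)
  qed
  moreover have "coprime p (p - 1)" using p prime_gt_0_nat[OF p]
    by (metis coprime_diff_one_right_nat)
  ultimately show ?thesis by (simp add: divides_mult)
qed simp

text \<open>Over the field of \<open>p\<close> elements a nonzero polynomial of degree below
  \<open>d\<close> has fewer than \<open>d\<close> roots. The induction splits off a linear factor
  at the largest root by synthetic division; differences of distinct roots are not divisible by
  \<open>p\<close>, so the quotient inherits the remaining roots.\<close>

lemma prime_dvd_coeff_of_roots:
  fixes h :: "int poly"
  assumes p: "prime p" and "d \<le> p" "\<And>k. d \<le> k \<Longrightarrow> Polynomial.coeff h k = 0"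
    and "\<And>a. a < d \<Longrightarrow> int p dvd poly h (int a)"
  shows "int p dvd Polynomial.coeff h i"
  using assms(2-)
proof (induction d arbitrary: h i)
  case 0 thus ?case by simp
next
  case (Suc d)
  obtain q where q: "h = [:- int d, 1:] * q + [:poly h (int d):]"
    using synthetic_div_correct'[of "int d" h] by metis
  have coeffq: "Polynomial.coeff q k = 0" if "d \<le> k" for k
  proof (cases "q = 0")
    case False
    hence "degree ([:- int d, 1:] * q) = Suc (degree q)" by (subst degree_mult_eq) auto
    moreover from this have "degree ([:- int d, 1:] * q + [:poly h (int d):]) = degree ([:- int d, 1:] * q)"
      by (intro degree_add_eq_left) simp
    ultimately have "degree h = Suc (degree q)" using q by metis
    hence "h \<noteq> 0" by auto
    hence "degree h < Suc d" using Suc.prems(2) by (metis leading_coeff_neq_0 not_le)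
    thus ?thesis using that \<open>degree h = Suc (degree q)\<close> by (simp add: coeff_eq_0)
  qed simp
  have "int p dvd poly q (int a)" if a: "a < d" for a
  proof -
    have "poly h (int a) = (int a - int d) * poly q (int a) + poly h (int d)"
      by (subst q) (simp add: algebra_simps)
    moreover have "int p dvd poly h (int a)" "int p dvd poly h (int d)" using a Suc.prems by auto
    ultimately have "int p dvd (int a - int d) * poly q (int a)" by (metis dvd_add_left_iff)
    moreover have "\<not> int p dvd int a - int d"
    proof
      assume "int p dvd int a - int d"
      hence "int p dvd \<bar>int a - int d\<bar>" by (simp only: dvd_abs_iff)
      hence "int p \<le> \<bar>int a - int d\<bar>" using a by (intro zdvd_imp_le) auto
      thus False using a Suc.prems(1) by linarith
    qed
    ultimately show ?thesis using p by (simp add: prime_dvd_mult_iff)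
  qed
  hence "int p dvd Polynomial.coeff q k" for k using Suc.IH[of q] coeffq Suc.prems(1) by auto
  moreover have "int p dvd poly h (int d)" using Suc.prems(3) by auto
  ultimately show ?case by (subst q) (auto simp: coeff_pCons split: nat.split)
qed

text \<open>Modulo \<open>P\<close> one may replace \<open>x^p y\<close> by \<open>x y^p\<close>,
  which lowers the exponent of \<open>x\<close> but consumes a factor \<open>y\<close>; hence
  \<open>j\<close> must be positive. The degree set of \<open>g\<close> is empty when
  \<open>n < p + 1\<close>, which forces \<open>g = 0\<close>.\<close>

lemma mon_mod_dickson_P:
  assumes "1 < p" "i + j = n" "0 < j"
  shows "\<exists>g i' j'. g \<in> graded {k. k + (p + 1) = n} \<and> i' < p \<and> i' + j' = n \<and> mon i j = dickson_P p * g + mon i' j'"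
  using assms(2,3)
proof (induction i arbitrary: j rule: less_induct)
  case (less i)
  show ?case
  proof (cases "i < p")
    case True thus ?thesis using less.prems by (intro exI[of _ 0] exI[of _ i] exI[of _ j]) auto
  next
    case False
    then obtain i' j' where ij: "i = i' + p" "j = Suc j'" using less.prems
      by (metis add.commute gr0_implies_Suc le_add_diff_inverse not_le)
    have "i' + 1 < i" using ij assms by auto
    from less.IH[OF this, of "j' + p"] obtain g a b where
      g: "g \<in> graded {k. k + (p + 1) = n}" "a < p" "a + b = n" "mon (i' + 1) (j' + p) = dickson_P p * g + mon a b"
      using less.prems ij assms(1) by auto
    have "mon i j = dickson_P p * mon i' j' + mon (i' + 1) (j' + p)"
      unfolding dickson_P_def ij by (simp add: mon_eq algebra_simps power_add)
    hence "mon i j = dickson_P p * (mon i' j' + g) + mon a b" using g(4) by (simp add: distrib_left)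
    moreover have "mon i' j' + g \<in> graded {k. k + (p + 1) = n}"
      using g(1) ij less.prems by (intro graded_add mon_graded) auto
    ultimately show ?thesis using g by blast
  qed
qed

text \<open>
  Such an \<open>f\<close> vanishes modulo \<open>p\<close> at all integral points, and modulo \<open>P\<close> its degree in \<open>x\<close> can be made
  smaller than \<open>p\<close>.
\<close>

lemma dvd_dickson_P_of_axis:
  assumes p: "prime p" and f: "f \<in> graded {n}" and inv: "inv_mod (carrier SL2Z) (int p) f"
    and c: "int p dvd cf f n 0"
  shows "\<exists>g\<in>graded {k. k + (p + 1) = n}. of_int (int p) dvd f - dickson_P p * g"
proof -
  have p1: "1 < p" using p prime_gt_1_nat by blast
  have "\<forall>i. \<exists>g i' j'. i < n \<longrightarrow> g \<in> graded {k. k + (p + 1) = n} \<and> i' < p \<and> i' + j' = n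
      \<and> mon i (n - i) = dickson_P p * g + mon i' j'"
  proof
    fix i
    show "\<exists>g i' j'. i < n \<longrightarrow> g \<in> graded {k. k + (p + 1) = n} \<and> i' < p \<and> i' + j' = n
      \<and> mon i (n - i) = dickson_P p * g + mon i' j'"
      using mon_mod_dickson_P[OF p1, of i "n - i" n] by (cases "i < n") auto
  qed
  then obtain G I J where GIJ: "\<forall>i. i < n \<longrightarrow> G i \<in> graded {k. k + (p + 1) = n} \<and> I i < p \<and> I i + J i = n
      \<and> mon i (n - i) = dickson_P p * G i + mon (I i) (J i)"
    unfolding choice_iff by blast
  hence G: "\<And>i. i < n \<Longrightarrow> G i \<in> graded {k. k + (p + 1) = n}"
    and I: "\<And>i. i < n \<Longrightarrow> I i < p" "\<And>i. i < n \<Longrightarrow> I i + J i = n"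
    and eq: "\<And>i. i < n \<Longrightarrow> mon i (n - i) = dickson_P p * G i + mon (I i) (J i)"
    by blast+
  \<comment> \<open>\<open>g\<close> collects the quotients and \<open>r\<close> the remainders,
    whose degree in \<open>x\<close> is below \<open>p\<close>; \<open>h\<close> is \<open>r\<close>
    at \<open>y = 1\<close>, which loses nothing since \<open>r\<close> is homogeneous. The term in
    \<open>x^n\<close> is kept apart because it cannot be reduced modulo \<open>P\<close>.\<close>
  define g where "g = (\<Sum>i<n. of_int (cf f i (n - i)) * G i)"
  define r where "r = (\<Sum>i<n. of_int (cf f i (n - i)) * mon (I i) (J i))"
  define h where "h = (\<Sum>i<n. Polynomial.monom (cf f i (n - i)) (I i))"
  have "f = (\<Sum>i<n. of_int (cf f i (n - i)) * mon i (n - i)) + of_int (cf f n 0) * mon n 0"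
    by (subst graded_expand[OF f]) (simp add: lessThan_Suc_atMost[symmetric])
  also have "(\<Sum>i<n. of_int (cf f i (n - i)) * mon i (n - i)) = dickson_P p * g + r"
    unfolding g_def r_def sum_distrib_left sum.distrib[symmetric]
    by (intro sum.cong refl) (simp add: eq algebra_simps)
  finally have f_eq: "f = dickson_P p * g + r + of_int (cf f n 0) * mon n 0" .
  have gg: "g \<in> graded {k. k + (p + 1) = n}"
    unfolding g_def using G by (intro graded_sum graded_of_int_mult) auto
  have ev_h: "ev a 1 r = poly h a" for a
    by (simp add: r_def h_def poly_sum poly_monom)
  \<comment> \<open>The point \<open>(a, 1)\<close> is primitive, so modulo \<open>p\<close> the
    value of \<open>f\<close> there is its value at \<open>(1, 0)\<close>, the coefficient of
    \<open>x^n\<close>, which is divisible by \<open>p\<close>. By Fermat \<open>P\<close> vanishes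
    there as well.\<close>
  have "int p dvd poly h (int a)" for a
  proof -
    have "int p dvd ev 1 0 f" using c by (simp add: ev_graded_axis[OF f])
    moreover have "int p dvd ev (int a) 1 f - ev 1 0 f" by (rule ev_primitive_vector[OF inv]) simp
    ultimately have "int p dvd ev (int a) 1 f" using dvd_add[of "int p" "ev (int a) 1 f - ev 1 0 f" "ev 1 0 f"] by simp
    moreover have "int p dvd ev (int a) 1 (dickson_P p)"
      using fermat_int[OF p, of "int a"] by (simp add: dickson_P_def)
    moreover have "ev (int a) 1 r = ev (int a) 1 f - ev (int a) 1 (dickson_P p) * ev (int a) 1 g - cf f n 0 * int a ^ n"
      using arg_cong[OF f_eq, of "ev (int a) 1"] by simp
    ultimately show ?thesis unfolding ev_h[symmetric] using c by simp
  qed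
  moreover have "Polynomial.coeff h k = 0" if "p \<le> k" for k
    unfolding h_def coeff_sum using I(1) that by (intro sum.neutral) (fastforce simp: not_le[symmetric])
  ultimately have h: "int p dvd Polynomial.coeff h i" for i
    using prime_dvd_coeff_of_roots[OF p order_refl, of h] by blast
  have "int p dvd cf r i j" for i j
  proof -
    have "cf (of_int (cf f k (n - k)) * mon (I k) (J k)) i j
        = (if i + j = n then Polynomial.coeff (Polynomial.monom (cf f k (n - k)) (I k)) i else 0)" if "k < n" for k
      using I(2)[OF that] by auto
    hence "cf r i j = (if i + j = n then Polynomial.coeff h i else 0)"
      unfolding r_def h_def cf_sum coeff_sum by (cases "i + j = n") (auto intro!: sum.cong sum.neutral simp del: cf_of_int_mult)
    thus ?thesis using h by simp
  qed
  hence "of_int (int p) dvd r" by (simp only: of_int_dvd_iff) simp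
  moreover have "of_int (int p) dvd of_int (cf f n 0) * mon n 0"
    using c by (intro dvd_mult2 of_int_dvd_of_int)
  moreover have "f - dickson_P p * g = r + of_int (cf f n 0) * mon n 0" using f_eq by (simp add: algebra_simps)
  ultimately show ?thesis using gg by (metis dvd_add)
qed

text \<open>Induction on the degree. If the coefficient of \<open>x^n\<close> is not divisible by
  \<open>p\<close>, then \<open>n = p(p-1)j\<close>, and a multiple of \<open>Q^j\<close>, whose own
  coefficient of \<open>x^n\<close> is 1, removes it. What is left is a multiple of \<open>P\<close>
  modulo \<open>p\<close>, and the quotient is again invariant, of degree smaller by
  \<open>p + 1\<close>.\<close>

lemma dickson_SL2:
  assumes p: "prime p" and f: "f \<in> graded {n}" and inv: "inv_mod (carrier SL2Z) (int p) f"
  shows "\<exists>d. Poly_Mapping.keys d \<subseteq> dickson_index p n \<and> of_int (int p) dvd f - comb (dickson_mon p) d"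
  using f inv
proof (induction n arbitrary: f rule: less_induct)
  case (less n)
  have p1: "1 < p" using p prime_gt_1_nat by blast
  define c where "c = cf f n 0"
  obtain d0 where d0: "Poly_Mapping.keys d0 \<subseteq> dickson_index p n"
    and c0: "int p dvd cf (f - comb (dickson_mon p) d0) n 0"
    and inv0: "inv_mod (carrier SL2Z) (int p) (f - comb (dickson_mon p) d0)"
    and g0: "f - comb (dickson_mon p) d0 \<in> graded {n}"
  proof (cases "int p dvd c")
    case True thus ?thesis using that[of 0] less.prems by (simp add: c_def)
  next
    case False
    then obtain j where j: "n = p * (p - 1) * j"
      using degree_dvd_of_axis[OF p less.prems] c_def by (auto elim: dvdE)
    have idx: "(0, j) \<in> dickson_index p n" by (simp add: dickson_index_def j)
    have l: "cf (dickson_mon p (0, j)) n 0 = 1"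
      using leads_dickson_mon[OF p1, of 0 j] j by (simp add: leads_def mult_ac)
    show ?thesis
    proof (rule that[of "frag_cmul c (frag_of (0, j))"])
      show "inv_mod (carrier SL2Z) (int p) (f - comb (dickson_mon p) (frag_cmul c (frag_of (0, j))))"
        using p less.prems unfolding comb_cmul comb_of dickson_mon_def
        by (intro inv_mod_diff inv_mod_of_int_multI inv_mod_mult inv_mod_power inv_mod_dickson_P inv_mod_dickson_Q)
      show "f - comb (dickson_mon p) (frag_cmul c (frag_of (0, j))) \<in> graded {n}"
        using less.prems dickson_mon_graded[OF _ idx] p1 unfolding comb_cmul comb_of
        by (intro graded_diff graded_of_int_mult) auto
      show "int p dvd cf (f - comb (dickson_mon p) (frag_cmul c (frag_of (0, j)))) n 0"
        unfolding comb_cmul comb_of by (simp add: l c_def)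
      show "Poly_Mapping.keys (frag_cmul c (frag_of (0, j))) \<subseteq> dickson_index p n"
        using idx keys_cmul by (auto simp: keys_frag_of)
    qed
  qed
  obtain g where g: "g \<in> graded {k. k + (p + 1) = n}"
    "of_int (int p) dvd f - comb (dickson_mon p) d0 - dickson_P p * g"
    using dvd_dickson_P_of_axis[OF p g0 inv0 c0] by blast
  show ?case
  proof (cases "p + 1 \<le> n")
    case False
    hence "{k. k + (p + 1) = n} = {}" by auto
    hence "g = 0" using g(1) by (intro poly2_eqI) (auto simp: graded_def)
    thus ?thesis using g d0 by auto
  next
    case True
    hence "{k. k + (p + 1) = n} = {n - (p + 1)}" by auto
    hence gg: "g \<in> graded {n - (p + 1)}" using g(1) by simp
    have "inv_mod (carrier SL2Z) (int p) (dickson_P p * g)"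
      using inv0 inv_mod_cong[OF g(2)] by blast
    hence "inv_mod (carrier SL2Z) (int p) g"
      using inv_mod_cancel[OF prime_elem_of_int_poly2[OF p] leads_not_dvd[OF p leads_dickson_P[OF p1]] inv_mod_dickson_P[OF p]]
      by blast
    then obtain d1 where d1: "Poly_Mapping.keys d1 \<subseteq> dickson_index p (n - (p + 1))"
      "of_int (int p) dvd g - comb (dickson_mon p) d1"
      using less.IH[OF _ gg] True by auto
    \<comment> \<open>Multiplication by \<open>P\<close> shifts the first exponent of every
      monomial.\<close>
    define d2 where "d2 = frag_extend (\<lambda>(i, j). frag_of (Suc i, j)) d1"
    have keys_d2: "Poly_Mapping.keys d2 \<subseteq> dickson_index p n"
    proof
      fix z assume "z \<in> Poly_Mapping.keys d2"
      then obtain i j where "(i, j) \<in> Poly_Mapping.keys d1" "z = (Suc i, j)"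
        using keys_frag_extend[of "\<lambda>(i, j). frag_of (Suc i, j)" d1] unfolding d2_def
        by (fastforce simp: keys_frag_of)
      moreover have "(i, j) \<in> dickson_index p (n - (p + 1))" using calculation d1 by blast
      ultimately show "z \<in> dickson_index p n" using True by (auto simp: dickson_index_def)
    qed
    have "comb (dickson_mon p) (frag_extend (\<lambda>(i, j). frag_of (Suc i, j)) c) = dickson_P p * comb (dickson_mon p) c" for c
      using subset_UNIV
    proof (induction c rule: frag_induction)
      case (one z) thus ?case by (simp add: case_prod_beta dickson_mon_def mult_ac)
    qed (simp_all add: frag_extend_diff comb_diff right_diff_distrib)
    hence comb_d2: "comb (dickson_mon p) d2 = dickson_P p * comb (dickson_mon p) d1"
      by (simp add: d2_def)
    have "of_int (int p) dvd dickson_P p * (g - comb (dickson_mon p) d1)"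
      using d1(2) by (rule dvd_mult)
    from dvd_add[OF g(2) this] have "of_int (int p) dvd f - comb (dickson_mon p) (d0 + d2)"
      by (simp add: comb_add comb_d2 algebra_simps)
    moreover have "Poly_Mapping.keys (d0 + d2) \<subseteq> dickson_index p n"
      using d0 keys_d2 keys_add[of d0 d2] by blast
    ultimately show ?thesis by blast
  qed
qed

section \<open>Invariants of $SL_2(\mathbb{Z})$ modulo a prime power\<close>

text \<open>With \<open>q = p^k\<close>, only exponents divisible by \<open>q\<close> survive modulo
  \<open>p\<close>, so \<open>f\<close> is congruent to some \<open>G(x^q, y^q)\<close> and thus to
  \<open>G^q\<close>. Dickson's theorem is applied to \<open>G\<close>, whose invariance has to be
  recovered from that of its power.\<close>

lemma invariant_mod_prime_power_lead:
  assumes p: "prime p" and f: "f \<in> graded {n}" and inv: "inv_mod (carrier SL2Z) (int p ^ Suc k) f"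
  shows "\<exists>d. Poly_Mapping.keys d \<subseteq> dickson_index p n
      \<and> (\<forall>z\<in>Poly_Mapping.keys d. p ^ k dvd fst z \<and> p ^ k dvd snd z)
      \<and> of_int (int p) dvd f - comb (dickson_mon p) d"
proof -
  let ?q = "p ^ k"
  have q0: "0 < ?q" using p prime_gt_0_nat by simp
  have low: "lower (int p) \<in> carrier SL2Z" "upper (int p) \<in> carrier SL2Z"
    by (simp_all add: SL2Z_def det_2 lower_def upper_def)
  \<comment> \<open>A coefficient that is a unit modulo \<open>p\<close> forces
    \<open>p^(k+1)\<close> to divide \<open>tors_order p 1 i j\<close>, hence \<open>p^k\<close> to
    divide \<open>gcd i j\<close>.\<close>
  have dvd_cf: "int p dvd cf f i j" if ij: "\<not> (?q dvd i \<and> ?q dvd j)" for i j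
  proof (rule ccontr)
    assume ndvd: "\<not> int p dvd cf f i j"
    have "(i, j) \<noteq> (0, 0)" using ij by (metis Pair_inject dvd_0_right)
    hence "int p ^ Suc k dvd int (tors_order p 1 i j) * cf f i j"
      using p low inv by (intro dvd_tors_order_cf[where m = p and S = "carrier SL2Z"]) (auto simp: prime_gt_0_nat prime_imp_not_one)
    moreover have "coprime (int p ^ Suc k) (cf f i j)"
      using ndvd p by (simp add: prime_imp_coprime)
    ultimately have "int (p ^ Suc k) dvd int (tors_order p 1 i j)" by (simp add: coprime_dvd_mult_left_iff)
    hence "p ^ Suc k dvd p ^ Suc (multiplicity p (gcd i j))" by (simp only: of_nat_dvd_iff tors_order_def plus_1_eq_Suc)
    hence "k \<le> multiplicity p (gcd i j)" using p prime_gt_1_nat power_dvd_imp_le by blast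
    hence "?q dvd gcd i j" using multiplicity_dvd' by blast
    thus False using ij by simp
  qed
  show ?thesis
  proof (cases "?q dvd n")
    case False
    have "int p dvd cf f i j" for i j
    proof (cases "i + j = n")
      case True
      hence "\<not> (?q dvd i \<and> ?q dvd j)" using False by auto
      thus ?thesis by (rule dvd_cf)
    next
      case F: False
      hence "cf f i j = 0" using f unfolding graded_def by blast
      thus ?thesis by simp
    qed
    hence "of_int (int p) dvd f" unfolding of_int_dvd_iff by blast
    thus ?thesis by (intro exI[of _ 0]) simp
  next
    case True
    then obtain n' where n': "n = ?q * n'" by blast
    define G where "G = (\<Sum>i\<le>n'. of_int (cf f (?q * i) (?q * (n' - i))) * mon i (n' - i))"
    have G: "G \<in> graded {n'}"
      unfolding G_def by (intro graded_sum graded_of_int_mult mon_graded) auto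
    have "subst_xy (var_x ^ ?q) (var_y ^ ?q) G
        = (\<Sum>i\<le>n'. of_int (cf f (?q * i) (?q * (n' - i))) * mon (?q * i) (?q * (n' - i)))"
      by (simp add: G_def subst_xy_sum subst_xy_mult subst_xy_power mon_eq power_mult)
    note sub = this
    have "int p dvd cf (f - subst_xy (var_x ^ ?q) (var_y ^ ?q) G) i j" for i j
    proof (cases "?q dvd i \<and> ?q dvd j \<and> i + j = n")
      case True
      then obtain i' j' where ij: "i = ?q * i'" "j = ?q * j'" by blast
      hence "?q * (i' + j') = ?q * n'" using True n' by (simp add: distrib_left)
      hence n'_eq: "n' = i' + j'" using nat_mult_eq_cancel1[OF q0] by metis
      have "cf (subst_xy (var_x ^ ?q) (var_y ^ ?q) G) i j
          = (\<Sum>l\<le>n'. if l = i' then cf f (?q * i') (?q * (n' - i')) else 0)"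
        unfolding sub cf_sum using ij n'_eq q0 by (intro sum.cong) auto
      also have "\<dots> = cf f i j" using n'_eq ij by simp
      finally show ?thesis by simp
    next
      case False
      have "cf (subst_xy (var_x ^ ?q) (var_y ^ ?q) G) i j = 0"
        unfolding sub cf_sum
      proof (intro sum.neutral ballI)
        fix l assume "l \<in> {..n'}"
        hence "?q * l + ?q * (n' - l) = n" by (simp add: n' distrib_left[symmetric])
        hence "\<not> (i = ?q * l \<and> j = ?q * (n' - l))" using False by auto
        thus "cf (of_int (cf f (?q * l) (?q * (n' - l))) * mon (?q * l) (?q * (n' - l))) i j = 0" by auto
      qed
      moreover have "int p dvd cf f i j"
      proof (cases "i + j = n")
        case True thus ?thesis using False by (intro dvd_cf) auto
      next
        case F: False
        hence "cf f i j = 0" using f unfolding graded_def by blast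
        thus ?thesis by simp
      qed
      ultimately show ?thesis by simp
    qed
    hence "of_int (int p) dvd f - subst_xy (var_x ^ ?q) (var_y ^ ?q) G" unfolding of_int_dvd_iff by blast
    from dvd_diff_trans[OF this dvd_diff_sym[OF frobenius_subst[OF p]]]
    have fG: "of_int (int p) dvd f - G ^ ?q" .
    have "inv_mod (carrier SL2Z) (int p) f" using inv by (rule inv_mod_dvd) simp
    hence invGq: "inv_mod (carrier SL2Z) (int p) (G ^ ?q)" using inv_mod_cong[OF fG] by blast
    \<comment> \<open>Frobenius is injective modulo \<open>p\<close>: the \<open>q\<close>-th power
      of \<open>act A G - G\<close> is congruent to the difference of the \<open>q\<close>-th
      powers, hence to zero, and \<open>p\<close> is a prime element.\<close>
    have "inv_mod (carrier SL2Z) (int p) G"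
      unfolding inv_mod_def
    proof
      fix A assume "A \<in> carrier SL2Z"
      hence "of_int (int p) dvd act A G ^ ?q - G ^ ?q" using invGq by (simp add: inv_mod_def act_power)
      moreover have "of_int (int p) dvd (act A G - G + G) ^ ?q - ((act A G - G) ^ ?q + G ^ ?q)"
        by (rule freshman_power[OF p])
      ultimately have "of_int (int p) dvd (act A G ^ ?q - G ^ ?q) - ((act A G - G + G) ^ ?q - ((act A G - G) ^ ?q + G ^ ?q))"
        by (rule dvd_diff)
      hence "of_int (int p) dvd (act A G - G) ^ ?q" by simp
      thus "of_int (int p) dvd act A G - G" using prime_elem_dvd_power[OF prime_elem_of_int_poly2[OF p]] by blast
    qed
    then obtain d where d: "Poly_Mapping.keys d \<subseteq> dickson_index p n'" "of_int (int p) dvd G - comb (dickson_mon p) d"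
      using dickson_SL2[OF p G] by blast
    \<comment> \<open>Modulo \<open>p\<close>, the \<open>q\<close>-th power of a combination has
      the same coefficients and all exponents multiplied by \<open>q\<close>.\<close>
    define d' where "d' = frag_extend (\<lambda>z. frag_of (?q * fst z, ?q * snd z)) d"
    have keys: "z \<in> (\<lambda>z. (?q * fst z, ?q * snd z)) ` Poly_Mapping.keys d" if "z \<in> Poly_Mapping.keys d'" for z
      using that keys_frag_extend[of "\<lambda>z. frag_of (?q * fst z, ?q * snd z)" d] unfolding d'_def
      by (fastforce simp: keys_frag_of)
    have "of_int (int p) dvd comb (dickson_mon p) c ^ ?q
        - comb (dickson_mon p) (frag_extend (\<lambda>z. frag_of (?q * fst z, ?q * snd z)) c)" for c
      using subset_UNIV
    proof (induction c rule: frag_induction)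
      case zero show ?case using q0 by (simp add: power_0_left)
    next
      case (one z) thus ?case by (simp add: dickson_mon_def power_mult_distrib power_mult[symmetric] mult.commute)
    next
      case (diff a b)
      let ?A = "comb (dickson_mon p) a" and ?B = "comb (dickson_mon p) b"
      have "of_int (int p) dvd ((?A - ?B) + ?B) ^ ?q - ((?A - ?B) ^ ?q + ?B ^ ?q)"
        by (rule freshman_power[OF p])
      hence "of_int (int p) dvd (?A - ?B) ^ ?q - (?A ^ ?q - ?B ^ ?q)"
        using dvd_diff_sym[of "of_int (int p)" "?A ^ ?q" "(?A - ?B) ^ ?q + ?B ^ ?q"] by (simp add: algebra_simps)
      from dvd_add[OF this dvd_diff[OF diff]] show ?case
        by (simp add: comb_diff frag_extend_diff algebra_simps)
    qed
    from dvd_diff_trans[OF fG dvd_diff_trans[OF dvd_diff_power[OF d(2)] this]]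
    have "of_int (int p) dvd f - comb (dickson_mon p) d'" unfolding d'_def .
    moreover have "Poly_Mapping.keys d' \<subseteq> dickson_index p n"
    proof
      fix z assume "z \<in> Poly_Mapping.keys d'"
      from keys[OF this] obtain i j where ij: "(i, j) \<in> Poly_Mapping.keys d" "z = (?q * i, ?q * j)" by auto
      hence "(p + 1) * i + p * (p - 1) * j = n'" using d(1) by (auto simp: dickson_index_def)
      hence "?q * ((p + 1) * i + p * (p - 1) * j) = n" by (simp only: n')
      thus "z \<in> dickson_index p n" by (simp add: ij dickson_index_def algebra_simps)
    qed
    moreover have "\<forall>z\<in>Poly_Mapping.keys d'. ?q dvd fst z \<and> ?q dvd snd z" using keys by force
    ultimately show ?thesis by blast
  qed
qed

lemma keys_add_cmul_subset:
  "Poly_Mapping.keys c \<subseteq> I \<Longrightarrow> Poly_Mapping.keys d \<subseteq> I \<Longrightarrow> Poly_Mapping.keys (c + frag_cmul k d) \<subseteq> I"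
  using keys_add[of c "frag_cmul k d"] keys_cmul[of k d] by blast

text \<open>Successive approximation: remove the combination that represents \<open>f\<close> modulo
  \<open>p\<close>, divide the rest by \<open>p\<close> and continue. The removed monomials have
  exponents divisible by \<open>p^k\<close>, so they are themselves invariant modulo
  \<open>p^(k+1)\<close>, and the rest divided by \<open>p\<close> is invariant modulo
  \<open>p^k\<close>.\<close>

lemma invariant_mod_prime_power_dickson:
  assumes p: "prime p" and n: "0 < n" and f: "f \<in> graded {n}" and inv: "inv_mod (carrier SL2Z) (int p ^ k) f"
  shows "\<exists>d w. Poly_Mapping.keys d \<subseteq> dickson_index p n \<and> w \<in> graded {n}
      \<and> (\<forall>i j. int p ^ k dvd int (tors_order p 1 i j) * poly_mapping.lookup d (i, j))
      \<and> f = comb (dickson_mon p) d + of_int (int p ^ k) * w"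
  using f inv
proof (induction k arbitrary: f)
  case 0 thus ?case by (intro exI[of _ 0] exI[of _ f]) auto
next
  case (Suc k)
  have p0: "0 < p" using p prime_gt_0_nat by blast
  obtain d where d: "Poly_Mapping.keys d \<subseteq> dickson_index p n"
    "\<And>z. z \<in> Poly_Mapping.keys d \<Longrightarrow> p ^ k dvd fst z \<and> p ^ k dvd snd z"
    "of_int (int p) dvd f - comb (dickson_mon p) d"
    using invariant_mod_prime_power_lead[OF p Suc.prems] by blast
  have tors: "int p ^ Suc k dvd int (tors_order p 1 i j)" if "(i, j) \<in> Poly_Mapping.keys d" for i j
  proof -
    \<comment> \<open>Here \<open>0 < n\<close> matters: at \<open>(0, 0)\<close> the gcd is 0,
      whose multiplicity is 0 by convention although every power of \<open>p\<close> divides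
      it.\<close>
    have "(i, j) \<noteq> (0, 0)" using that d(1) n by (auto simp: dickson_index_def)
    hence "k \<le> multiplicity p (gcd i j)"
      using d(2)[OF that] p by (intro multiplicity_geI) (auto simp: prime_imp_not_one)
    hence "p ^ Suc k dvd tors_order p 1 i j" unfolding tors_order_def by (intro le_imp_power_dvd) simp
    thus ?thesis by (metis of_nat_dvd_iff of_nat_power)
  qed
  obtain u where u: "f - comb (dickson_mon p) d = of_int (int p) * u" using d(3) by blast
  have comb_graded: "comb (dickson_mon p) d \<in> graded {n}"
    unfolding comb_def using d(1) dickson_mon_graded[OF p0]
    by (intro graded_sum graded_of_int_mult) blast
  hence "of_int (int p) * u \<in> graded {n}" unfolding u[symmetric] by (intro graded_diff Suc.prems)
  hence ug: "u \<in> graded {n}" using p0 by (subst (asm) graded_of_int_mult_iff) auto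
  have "inv_mod (carrier SL2Z) (int p ^ Suc k) (comb (dickson_mon p) d)"
    unfolding comb_def
  proof (intro inv_mod_sum inv_mod_of_int_multI)
    fix z assume z: "z \<in> Poly_Mapping.keys d"
    have "inv_mod (carrier SL2Z) (int (tors_order p 1 (fst z) (snd z))) (dickson_mon p z)"
      unfolding dickson_mon_def
      using inv_mod_dickson_P[OF p] inv_mod_dickson_Q[OF p] by (intro inv_mod_tors_order p) auto
    thus "inv_mod (carrier SL2Z) (int p ^ Suc k) (dickson_mon p z)"
      using tors[of "fst z" "snd z"] z by (auto intro: inv_mod_dvd)
  qed
  hence "inv_mod (carrier SL2Z) (int p * int p ^ k) (of_int (int p) * u)"
    unfolding u[symmetric] power_Suc[symmetric] by (intro inv_mod_diff Suc.prems)
  hence "inv_mod (carrier SL2Z) (int p ^ k) u"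
    using p0 by (subst (asm) inv_mod_of_int_mult) auto
  from Suc.IH[OF ug this] obtain d' w where d': "Poly_Mapping.keys d' \<subseteq> dickson_index p n" "w \<in> graded {n}"
    "\<And>i j. int p ^ k dvd int (tors_order p 1 i j) * poly_mapping.lookup d' (i, j)"
    "u = comb (dickson_mon p) d' + of_int (int p ^ k) * w" by blast
  have "f = comb (dickson_mon p) (d + frag_cmul (int p) d') + of_int (int p ^ Suc k) * w"
    using u by (simp add: comb_add comb_cmul d'(4) algebra_simps)
  moreover have "int p ^ Suc k dvd int (tors_order p 1 i j) * poly_mapping.lookup (d + frag_cmul (int p) d') (i, j)" for i j
  proof -
    have "int p ^ Suc k dvd int (tors_order p 1 i j) * poly_mapping.lookup d (i, j)"
      using tors[of i j] by (cases "(i, j) \<in> Poly_Mapping.keys d") (auto simp: in_keys_iff)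
    moreover have "int p ^ Suc k dvd int p * (int (tors_order p 1 i j) * poly_mapping.lookup d' (i, j))"
      unfolding power_Suc by (intro mult_dvd_mono d'(3)) simp
    ultimately have "int p ^ Suc k dvd int (tors_order p 1 i j) * poly_mapping.lookup d (i, j)
        + int p * (int (tors_order p 1 i j) * poly_mapping.lookup d' (i, j))" by (rule dvd_add)
    thus ?thesis by (simp add: lookup_add distrib_left mult_ac)
  qed
  ultimately show ?case using keys_add_cmul_subset[OF d(1) d'(1)] d'(2) by blast
qed

lemma poly2_comb: obtains d where "f = comb (\<lambda>z. mon (fst z) (snd z)) d"
proof -
  have "\<exists>d. f = comb (\<lambda>z. mon (fst z) (snd z)) d"
  proof (induction f rule: poly2_induct)
    case (mon c i j)
    show ?case by (intro exI[of _ "frag_cmul c (frag_of (i, j))"]) (simp add: comb_cmul)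
  next
    case (add f g)
    then obtain c d where "f = comb (\<lambda>z. mon (fst z) (snd z)) c" "g = comb (\<lambda>z. mon (fst z) (snd z)) d" by blast
    thus ?case by (intro exI[of _ "c + d"]) (simp add: comb_add)
  qed
  thus ?thesis using that by blast
qed

lemma cf_comb_mon: "cf (comb (\<lambda>z. mon (fst z) (snd z)) d) i j = poly_mapping.lookup d (i, j)"
proof -
  have "cf (comb (\<lambda>z. mon (fst z) (snd z)) d) i j
      = (\<Sum>z\<in>Poly_Mapping.keys d. if z = (i, j) then poly_mapping.lookup d (i, j) else 0)"
    unfolding comb_def cf_sum by (intro sum.cong) auto
  also have "\<dots> = poly_mapping.lookup d (i, j)" by (auto simp: in_keys_iff)
  finally show ?thesis .
qed

section \<open>The groups SL_2(Z) and \<Gamma>(m), and generation by shears\<close>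

lemma SL2Z_mult: "monoid.mult SL2Z = (**)" and SL2Z_one: "\<one>\<^bsub>SL2Z\<^esub> = mat 1"
  by (simp_all add: SL2Z_def)

lemma SL2Z_carrier_iff: "A \<in> carrier SL2Z \<longleftrightarrow> A $ 1 $ 1 * A $ 2 $ 2 - A $ 1 $ 2 * A $ 2 $ 1 = 1"
  by (simp add: SL2Z_def det_2)

definition adj2 :: "int^2^2 \<Rightarrow> int^2^2" where
  "adj2 A = vector [vector [A $ 2 $ 2, - A $ 1 $ 2], vector [- A $ 2 $ 1, A $ 1 $ 1]]"

lemma mat2_eq_iff: "(A :: int^2^2) = B \<longleftrightarrow> A $ 1 $ 1 = B $ 1 $ 1 \<and> A $ 1 $ 2 = B $ 1 $ 2 \<and> A $ 2 $ 1 = B $ 2 $ 1 \<and> A $ 2 $ 2 = B $ 2 $ 2"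
  by (auto simp: vec_eq_iff forall_2)

lemma mat2_mult:
  "((A :: int^2^2) ** B) $ i $ j = A $ i $ 1 * B $ 1 $ j + A $ i $ 2 * B $ 2 $ j"
  by (simp add: matrix_matrix_mult_def sum_2)

lemma mat_1_entries: "(mat 1 :: int^2^2) $ 1 $ 1 = 1" "(mat 1 :: int^2^2) $ 1 $ 2 = 0"
  "(mat 1 :: int^2^2) $ 2 $ 1 = 0" "(mat 1 :: int^2^2) $ 2 $ 2 = 1"
  by (simp_all add: mat_def)

lemma adj2_carrier: "A \<in> carrier SL2Z \<Longrightarrow> adj2 A \<in> carrier SL2Z"
  by (simp add: SL2Z_carrier_iff adj2_def algebra_simps)

lemma adj2_mult: "A \<in> carrier SL2Z \<Longrightarrow> adj2 A ** A = mat 1"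
  by (simp add: SL2Z_carrier_iff adj2_def mat2_eq_iff mat2_mult mat_1_entries algebra_simps)

lemma group_SL2Z: "group SL2Z"
proof (rule groupI)
  fix x y assume "x \<in> carrier SL2Z" "y \<in> carrier SL2Z"
  thus "x \<otimes>\<^bsub>SL2Z\<^esub> y \<in> carrier SL2Z" by (simp add: SL2Z_def det_mul)
next
  fix x assume "x \<in> carrier SL2Z"
  thus "\<exists>y\<in>carrier SL2Z. y \<otimes>\<^bsub>SL2Z\<^esub> x = \<one>\<^bsub>SL2Z\<^esub>"
    using adj2_carrier adj2_mult by (auto simp: SL2Z_mult SL2Z_one)
qed (simp_all add: SL2Z_def matrix_mul_assoc)

lemma inv_SL2Z: "A \<in> carrier SL2Z \<Longrightarrow> inv\<^bsub>SL2Z\<^esub> A = adj2 A"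
  using group.inv_equality[OF group_SL2Z] adj2_carrier adj2_mult by (metis SL2Z_mult SL2Z_one)

lemma Gamma_iff:
  "A \<in> Gamma m \<longleftrightarrow> A \<in> carrier SL2Z \<and> int m dvd A $ 1 $ 1 - 1 \<and> int m dvd A $ 1 $ 2 \<and> int m dvd A $ 2 $ 1 \<and> int m dvd A $ 2 $ 2 - 1"
  by (auto simp: Gamma_def forall_2 mat_1_entries cong_iff_dvd_diff)

lemma subgroup_Gamma: "subgroup (Gamma m) SL2Z"
proof (rule group.subgroupI[OF group_SL2Z])
  show "Gamma m \<subseteq> carrier SL2Z" by (auto simp: Gamma_iff)
  have "mat 1 \<in> Gamma m" by (simp add: Gamma_iff SL2Z_carrier_iff mat_1_entries)
  thus "Gamma m \<noteq> {}" by auto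
next
  fix A assume "A \<in> Gamma m"
  thus "inv\<^bsub>SL2Z\<^esub> A \<in> Gamma m"
    by (auto simp: Gamma_iff inv_SL2Z adj2_carrier) (auto simp: adj2_def)
next
  fix A B assume A: "A \<in> Gamma m" and B: "B \<in> Gamma m"
  hence "A ** B \<in> carrier SL2Z" by (simp add: Gamma_iff SL2Z_def det_mul)
  moreover have "int m dvd A $ 1 $ 1 * B $ 1 $ 1 - 1 * 1" "int m dvd A $ 2 $ 2 * B $ 2 $ 2 - 1 * 1"
    using A B by (intro dvd_diff_mult; simp add: Gamma_iff)+
  hence "int m dvd (A $ 1 $ 1 * B $ 1 $ 1 - 1 * 1) + A $ 1 $ 2 * B $ 2 $ 1"
    "int m dvd (A $ 2 $ 2 * B $ 2 $ 2 - 1 * 1) + A $ 2 $ 1 * B $ 1 $ 2"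
    using A by (simp_all only: Gamma_iff dvd_add dvd_mult2)
  moreover have "int m dvd A $ 1 $ 1 * B $ 1 $ 2 + A $ 1 $ 2 * B $ 2 $ 2"
    "int m dvd A $ 2 $ 1 * B $ 1 $ 1 + A $ 2 $ 2 * B $ 2 $ 1"
    using A B by (simp_all only: Gamma_iff dvd_add dvd_mult2 dvd_mult)
  ultimately show "A \<otimes>\<^bsub>SL2Z\<^esub> B \<in> Gamma m"
    by (simp add: Gamma_iff SL2Z_mult mat2_mult algebra_simps)
qed

lemma shear_in_Gamma: "int m dvd t \<Longrightarrow> lower t \<in> Gamma m" "int m dvd t \<Longrightarrow> upper t \<in> Gamma m"
  by (simp_all add: Gamma_iff SL2Z_carrier_iff lower_def upper_def)

lemma inv_mod_Gamma_var:
  assumes "q dvd int m" shows "inv_mod (Gamma m) q var_x" "inv_mod (Gamma m) q var_y"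
proof -
  have *: "of_int q dvd (of_int a * u + of_int b * v :: int poly poly)" if "q dvd a" "q dvd b" for a b u v
    using that by (intro dvd_add dvd_mult2 of_int_dvd_of_int)
  show "inv_mod (Gamma m) q var_x" unfolding inv_mod_def
  proof
    fix A assume "A \<in> Gamma m"
    hence "q dvd A $ 1 $ 1 - 1" "q dvd A $ 2 $ 1" using assms dvd_trans by (auto simp: Gamma_iff)
    from *[OF this, of var_x var_y] show "of_int q dvd act A var_x - var_x"
      by (simp add: act_x algebra_simps)
  qed
  show "inv_mod (Gamma m) q var_y" unfolding inv_mod_def
  proof
    fix A assume "A \<in> Gamma m"
    hence "q dvd A $ 2 $ 2 - 1" "q dvd A $ 1 $ 2" using assms dvd_trans by (auto simp: Gamma_iff)
    from *[OF this, of var_y var_x] show "of_int q dvd act A var_y - var_y"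
      by (simp add: act_y algebra_simps)
  qed
qed

text \<open>Shears generate the group by the Euclidean algorithm on the first column: multiplying by
  a shear on the left is one division step, and the lower left entry becomes smaller once both
  entries have been reduced.\<close>

lemma SL2Z_induct [consumes 1, case_names lower upper mult]:
  assumes A: "A \<in> carrier SL2Z"
    and lower: "\<And>t. P (lower t)" and upper: "\<And>t. P (upper t)"
    and mult: "\<And>A B. A \<in> carrier SL2Z \<Longrightarrow> B \<in> carrier SL2Z \<Longrightarrow> P A \<Longrightarrow> P B \<Longrightarrow> P (A ** B)"
  shows "P A"
  using A
proof (induction "nat \<bar>A $ 2 $ 1\<bar>" arbitrary: A rule: less_induct)
  case less
  have sh: "lower t \<in> carrier SL2Z" "upper t \<in> carrier SL2Z" for t
    by (simp_all add: SL2Z_carrier_iff lower_def upper_def)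
  have cl: "B ** C \<in> carrier SL2Z" if "B \<in> carrier SL2Z" "C \<in> carrier SL2Z" for B C
    using that by (simp add: SL2Z_def det_mul)
  have lowerD: "P B" if "P (lower t ** B)" "B \<in> carrier SL2Z" for t B
  proof -
    have "B = lower (- t) ** (lower t ** B)" by (simp add: mat2_eq_iff mat2_mult lower_def)
    thus ?thesis using mult[OF sh(1) cl[OF sh(1) that(2)] lower[of "- t"] that(1)] by simp
  qed
  have upperD: "P B" if "P (upper t ** B)" "B \<in> carrier SL2Z" for t B
  proof -
    have "B = upper (- t) ** (upper t ** B)" by (simp add: mat2_eq_iff mat2_mult upper_def)
    thus ?thesis using mult[OF sh(2) cl[OF sh(2) that(2)] upper[of "- t"] that(1)] by simp
  qed
  have low1: "(lower s ** X) $ 1 $ 1 = X $ 1 $ 1" "(lower s ** X) $ 2 $ 1 = s * X $ 1 $ 1 + X $ 2 $ 1" for s X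
    by (simp_all add: mat2_mult lower_def)
  have up1: "(upper s ** X) $ 1 $ 1 = X $ 1 $ 1 + s * X $ 2 $ 1" "(upper s ** X) $ 2 $ 1 = X $ 2 $ 1" for s X
    by (simp_all add: mat2_mult upper_def)
  let ?a = "A $ 1 $ 1" and ?c = "A $ 2 $ 1"
  note det = SL2Z_det[OF less.prems]
  have base: "P B" if B: "B \<in> carrier SL2Z" "B $ 2 $ 1 = 0" "B $ 1 $ 1 = 1" for B
  proof -
    have "B = upper (B $ 1 $ 2)" using SL2Z_det[OF B(1)] B by (simp add: mat2_eq_iff upper_def)
    thus ?thesis using upper by metis
  qed
  show ?case
  proof (cases "?c = 0")
    case True
    hence "?a * A $ 2 $ 2 = 1" using det by simp
    hence "?a = 1 \<or> ?a = -1" using zmult_eq_1_iff by blast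
    thus ?thesis
    proof
      \<comment> \<open>The first column runs through \<open>(-1, 0)\<close>,
        \<open>(-1, -1)\<close>, \<open>(1, -1)\<close>, \<open>(1, 0)\<close>.\<close>
      assume "?a = -1"
      have "P (lower 1 ** (upper (-2) ** (lower 1 ** A)))"
        by (intro base cl sh less.prems) (simp_all add: low1 up1 True \<open>?a = -1\<close>)
      thus ?thesis by (intro lowerD[of 1 A] upperD[of "-2" "lower 1 ** A"] lowerD[of 1 "upper (-2) ** (lower 1 ** A)"] cl sh less.prems)
    qed (use base less.prems True in auto)
  next
    case False
    define r where "r = ?a mod ?c"
    define t where "t = ?a div ?c"
    have r: "?a - t * ?c = r" by (simp add: r_def t_def minus_div_mult_eq_mod)
    have rc: "\<bar>r\<bar> < \<bar>?c\<bar>" unfolding r_def by (rule abs_mod_less[OF False])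
    let ?B = "upper (- t) ** A"
    have B: "?B \<in> carrier SL2Z" by (intro cl sh less.prems)
    have B1: "?B $ 1 $ 1 = r" "?B $ 2 $ 1 = ?c" using r by (simp_all add: mat2_mult upper_def)
    have "P ?B"
    proof (cases "r = 0")
      case True
      \<comment> \<open>The column \<open>(0, c)\<close> becomes \<open>(c, c)\<close> and then
        \<open>(c, 0)\<close>.\<close>
      have z: "(lower (-1) ** (upper 1 ** ?B)) $ 2 $ 1 = 0"
        unfolding low1 up1[of 1 ?B] B1 True by simp
      have "P (lower (-1) ** (upper 1 ** ?B))"
        by (intro less.hyps cl sh less.prems) (use \<open>?c \<noteq> 0\<close> in \<open>simp add: z\<close>)
      thus ?thesis by (intro upperD[of 1 ?B] lowerD[of "-1" "upper 1 ** ?B"] cl sh B)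
    next
      case False
      have "\<bar>?c mod r\<bar> < \<bar>?c\<bar>" using rc abs_mod_less[OF False, of ?c] by linarith
      moreover have "(lower (- (?c div r)) ** ?B) $ 2 $ 1 = ?c mod r"
        unfolding low1 B1 by (simp add: minus_mult_div_eq_mod[symmetric] mult.commute)
      ultimately have "P (lower (- (?c div r)) ** ?B)"
        by (intro less.hyps cl sh less.prems) simp
      thus ?thesis by (rule lowerD) (rule B)
    qed
    thus ?thesis by (rule upperD) (rule less.prems)
  qed
qed

lemma dvd_act: assumes "of_int q dvd f" shows "of_int q dvd act A f"
proof -
  obtain g where "f = of_int q * g" using assms by blast
  thus ?thesis by (simp add: act_mult)
qed

text \<open>With \<open>u m + v q = 1\<close>, a shear by \<open>t\<close> is a shear by
  \<open>t u m\<close>, which lies in \<open>Gamma m\<close>, composed with a shear by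
  \<open>t v q\<close>, which acts trivially modulo \<open>q\<close>. So the two groups have the
  same image modulo \<open>q\<close>.\<close>

lemma inv_mod_Gamma_imp_SL2Z:
  assumes cop: "coprime (int m) q" and inv: "inv_mod (Gamma m) q f"
  shows "inv_mod (carrier SL2Z) q f"
  unfolding inv_mod_def
proof
  have comp: "of_int q dvd act (A ** B) f - f" if "of_int q dvd act A f - f" "of_int q dvd act B f - f" for A B
    using dvd_diff_trans[OF dvd_act[OF that(2), of A, unfolded act_diff] that(1)] by (simp add: act_matrix_mult)
  have id: "of_int q dvd act A f - f" if "of_int q dvd act A var_x - var_x" "of_int q dvd act A var_y - var_y" for A
  proof (induction f rule: poly2_induct)
    case (mon c i j)
    show ?case unfolding act_mult act_of_int mon_eq act_power
      using that by (intro dvd_diff_mult dvd_diff_power) auto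
  next
    case (add f g) thus ?case unfolding act_add by (rule dvd_diff_add)
  qed
  obtain u v where uv: "u * int m + v * q = 1" using cop bezout_int[of "int m" q] by auto
  fix A assume "A \<in> carrier SL2Z"
  thus "of_int q dvd act A f - f"
  proof (induction A rule: SL2Z_induct)
    case (lower t)
    have "lower (t * u * int m) \<in> Gamma m" by (intro shear_in_Gamma) simp
    moreover have "of_int q dvd act (lower (t * v * q)) f - f"
      by (rule id) (simp_all add: act_lower)
    ultimately have "of_int q dvd act (lower (t * u * int m) ** lower (t * v * q)) f - f"
      using inv comp by (simp add: inv_mod_def)
    moreover have "lower (t * u * int m) ** lower (t * v * q) = lower (t * (u * int m + v * q))"
      by (simp add: mat2_eq_iff mat2_mult lower_def algebra_simps)
    ultimately show ?case using uv by simp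
  next
    case (upper t)
    have "upper (t * u * int m) \<in> Gamma m" by (intro shear_in_Gamma) simp
    moreover have "of_int q dvd act (upper (t * v * q)) f - f"
      by (rule id) (simp_all add: act_upper)
    ultimately have "of_int q dvd act (upper (t * u * int m) ** upper (t * v * q)) f - f"
      using inv comp by (simp add: inv_mod_def)
    moreover have "upper (t * u * int m) ** upper (t * v * q) = upper (t * (u * int m + v * q))"
      by (simp add: mat2_eq_iff mat2_mult upper_def algebra_simps)
    ultimately show ?case using uv by simp
  qed (rule comp)
qed

text \<open>A polynomial divisible by every power of \<open>p\<close> vanishes, so honest invariance
  can be tested modulo all \<open>p^k\<close>, and these are coprime to \<open>m\<close>.\<close>

lemma inv_mod_0_Gamma_imp_SL2Z:
  assumes p: "prime p" "\<not> p dvd m" and inv: "inv_mod (Gamma m) 0 f"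
  shows "inv_mod (carrier SL2Z) 0 f"
  unfolding inv_mod_def
proof
  fix A assume A: "A \<in> carrier SL2Z"
  have cop: "coprime (int m) (int p ^ k)" for k
  proof -
    have "coprime m p" using p prime_imp_coprime_nat[of p m] by (simp add: coprime_commute)
    thus ?thesis by simp
  qed
  have "inv_mod (carrier SL2Z) (int p ^ k) f" for k
    using inv_mod_Gamma_imp_SL2Z[OF cop inv_mod_dvd[OF inv]] by simp
  hence "of_int (int p ^ k) dvd act A f - f" for k using A unfolding inv_mod_def by blast
  hence "int p ^ k dvd cf (act A f - f) i j" for k i j unfolding of_int_dvd_iff by blast
  hence "cf (act A f - f) i j = 0" for i j by (rule zero_of_prime_powers_dvd[OF p(1)])
  hence "act A f - f = 0" by (intro poly2_eqI) simp
  thus "of_int 0 dvd act A f - f" by simp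
qed

section \<open>The group $\Delta_{p^a}[x,x']$\<close>

lemma (in group) rcos_eq_iff:
  assumes "subgroup H G" "x \<in> carrier G" "y \<in> carrier G"
  shows "H #> x = H #> y \<longleftrightarrow> x \<otimes> inv y \<in> H"
proof
  assume "H #> x = H #> y"
  then obtain h where h: "h \<in> H" "x = h \<otimes> y"
    using rcos_self[OF assms(2,1)] by (auto simp: r_coset_def)
  moreover have "h \<in> carrier G" using h assms(1) subgroup.mem_carrier by metis
  ultimately show "x \<otimes> inv y \<in> H" using assms by (simp add: m_assoc)
next
  assume h: "x \<otimes> inv y \<in> H"
  have "x = (x \<otimes> inv y) \<otimes> y" using assms by (simp add: m_assoc)
  hence "x \<in> H #> y" using h unfolding r_coset_def by blast
  thus "H #> x = H #> y" using repr_independence assms by metis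
qed

text \<open>Coordinate with respect to the divided powers \<open>x^i / i!\<close>. The floor serves
  to land in \<open>int\<close>; on \<open>divpoly_set\<close> it is exact by
  \<open>of_int_dcoeff\<close>.\<close>

definition dcoeff :: "rat poly \<Rightarrow> nat \<Rightarrow> int" where
  "dcoeff f i = \<lfloor>fact i * Polynomial.coeff f i\<rfloor>"

text \<open>The modulus \<open>0\<close> for \<open>i = 0\<close> reflects that the degree \<open>0\<close> part of the quotient is \<open>\<int>\<close>.\<close>

definition divpoly_modulus :: "nat \<Rightarrow> nat \<Rightarrow> nat \<Rightarrow> nat" where
  "divpoly_modulus p a i = (if i = 0 then 0 else p ^ (a + multiplicity p i))"

abbreviation (input) rat_poly_group :: "rat poly monoid" where
  "rat_poly_group \<equiv> \<lparr>carrier = UNIV, monoid.mult = (+), one = 0\<rparr>"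

lemma group_rat_poly: "group rat_poly_group"
  by (rule groupI) (auto simp: add.assoc intro: exI[of _ "- _"])

lemma inv_rat_poly: "inv\<^bsub>rat_poly_group\<^esub> f = - f"
  by (rule group.inv_equality[OF group_rat_poly]) auto

lemma divpoly_set_0: "0 \<in> divpoly_set"
  unfolding divpoly_set_def using generate.one[of rat_poly_group] by simp

lemma divpoly_set_add: "f \<in> divpoly_set \<Longrightarrow> g \<in> divpoly_set \<Longrightarrow> f + g \<in> divpoly_set"
  unfolding divpoly_set_def using generate.eng[of f rat_poly_group _ g] by simp

lemma divpoly_set_uminus: "f \<in> divpoly_set \<Longrightarrow> - f \<in> divpoly_set"
  unfolding divpoly_set_def
  using group.generate_m_inv_closed[OF group_rat_poly, of "range divpow" f] by (simp add: inv_rat_poly)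

lemma coeff_divpow: "Polynomial.coeff (divpow n) i = (if i = n then 1 / fact n else 0)"
  by (simp add: divpow_def)

lemma divpow_in: "divpow n \<in> divpoly_set"
  unfolding divpoly_set_def by (rule generate.incl) simp

lemma divpoly_set_of_nat_mult: "f \<in> divpoly_set \<Longrightarrow> of_nat n * f \<in> divpoly_set"
  by (induction n) (auto simp: divpoly_set_0 distrib_right intro: divpoly_set_add)

lemma divpoly_set_of_int_mult: "f \<in> divpoly_set \<Longrightarrow> of_int n * f \<in> divpoly_set"
  by (cases n) (auto intro: divpoly_set_of_nat_mult divpoly_set_uminus[of "of_nat _ * f", simplified]
      simp del: of_nat_Suc)

lemma divpoly_set_sum: "(\<And>x. x \<in> A \<Longrightarrow> f x \<in> divpoly_set) \<Longrightarrow> sum f A \<in> divpoly_set"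
  by (induction A rule: infinite_finite_induct) (auto intro: divpoly_set_0 divpoly_set_add)

lemma divpoly_set_iff: "f \<in> divpoly_set \<longleftrightarrow> (\<forall>i. fact i * Polynomial.coeff f i \<in> \<int>)"
proof
  assume "f \<in> divpoly_set"
  thus "\<forall>i. fact i * Polynomial.coeff f i \<in> \<int>"
    unfolding divpoly_set_def
    by (induction f rule: generate.induct) (auto simp: inv_rat_poly coeff_divpow distrib_left)
next
  assume f: "\<forall>i. fact i * Polynomial.coeff f i \<in> \<int>"
  have "Polynomial.monom (Polynomial.coeff f i) i \<in> divpoly_set" for i
  proof -
    obtain n :: int where "fact i * Polynomial.coeff f i = of_int n" using f by (auto elim: Ints_cases)
    hence "Polynomial.monom (Polynomial.coeff f i) i = of_int n * divpow i"
      by (simp add: divpow_def of_int_poly smult_monom field_simps)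
    thus ?thesis by (simp add: divpoly_set_of_int_mult divpow_in)
  qed
  hence "(\<Sum>i\<le>degree f. Polynomial.monom (Polynomial.coeff f i) i) \<in> divpoly_set" by (intro divpoly_set_sum)
  thus "f \<in> divpoly_set" by (simp add: poly_as_sum_of_monoms)
qed

lemma of_int_dcoeff: "f \<in> divpoly_set \<Longrightarrow> of_int (dcoeff f i) = fact i * Polynomial.coeff f i"
  by (simp add: dcoeff_def divpoly_set_iff)

lemma dcoeff_add:
  assumes "f \<in> divpoly_set" "g \<in> divpoly_set" shows "dcoeff (f + g) i = dcoeff f i + dcoeff g i"
proof -
  have "(of_int (dcoeff (f + g) i) :: rat) = of_int (dcoeff f i + dcoeff g i)"
    using assms by (simp add: of_int_dcoeff divpoly_set_add distrib_left)
  thus ?thesis by (simp only: of_int_eq_iff)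
qed

lemma dcoeff_divpow: "dcoeff (divpow k) i = (if i = k then 1 else 0)"
  by (simp add: dcoeff_def coeff_divpow)

text \<open>The rule \<open>x_j * x_k = (j + k choose j) * x_(j+k)\<close> turns products into
  binomial convolutions of coordinates.\<close>

lemma fact_mult_coeff_mult:
  assumes "f \<in> divpoly_set" "g \<in> divpoly_set"
  shows "fact i * Polynomial.coeff (f * g) i = of_int (\<Sum>j\<le>i. int (i choose j) * dcoeff f j * dcoeff g (i - j))"
proof -
  have "fact i * (Polynomial.coeff f j * Polynomial.coeff g (i - j)) = of_int (int (i choose j) * dcoeff f j * dcoeff g (i - j))"
    if "j \<le> i" for j
    using binomial_fact[OF that, where 'a = rat] assms
    by (simp add: of_int_dcoeff field_simps)
  thus ?thesis by (simp add: coeff_mult sum_distrib_left)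
qed

lemma divpoly_set_mult: "f \<in> divpoly_set \<Longrightarrow> g \<in> divpoly_set \<Longrightarrow> f * g \<in> divpoly_set"
  unfolding divpoly_set_iff[of "f * g"] by (simp only: fact_mult_coeff_mult Ints_of_int) simp

lemma dcoeff_mult:
  assumes "f \<in> divpoly_set" "g \<in> divpoly_set"
  shows "dcoeff (f * g) i = (\<Sum>j\<le>i. int (i choose j) * dcoeff f j * dcoeff g (i - j))"
  unfolding dcoeff_def[of "f * g"] fact_mult_coeff_mult[OF assms] by (rule floor_of_int)

lemma one_in_divpoly_set: "1 \<in> divpoly_set"
  by (auto simp: divpoly_set_iff coeff_1)

lemma cring_divpoly: "cring divpoly_ring"
proof (rule cringI)
  show "abelian_group divpoly_ring"
    by (rule abelian_groupI)
       (auto simp: divpoly_ring_def divpoly_set_add divpoly_set_0 add.assoc add.commute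
         intro!: bexI[of _ "- _"] divpoly_set_uminus)
  show "Group.comm_monoid divpoly_ring"
    by (rule Group.comm_monoidI)
       (auto simp: divpoly_ring_def divpoly_set_mult one_in_divpoly_set mult.assoc mult.commute)
qed (auto simp: divpoly_ring_def distrib_right)

lemma minus_divpoly: "f \<in> divpoly_set \<Longrightarrow> \<ominus>\<^bsub>divpoly_ring\<^esub> f = - f"
proof -
  interpret cring divpoly_ring by (rule cring_divpoly)
  assume "f \<in> divpoly_set"
  thus ?thesis by (intro minus_equality) (auto simp: divpoly_ring_def divpoly_set_uminus)
qed

text \<open>From \<open>j * (i choose j) = i * (i - 1 choose (j - 1))\<close> one gets
  \<open>v(i) \<le> v(j) + v(i choose j)\<close>; for \<open>j = 0\<close> the modulus is 0. This
  makes the coordinatewise conditions in \<open>ideal_divpoly_moduli\<close> stable under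
  multiplication.\<close>

lemma dvd_binomial_modulus:
  assumes p: "prime p" and "j \<le> i"
  shows "divpoly_modulus p a i dvd (i choose j) * divpoly_modulus p a j"
proof (cases "j = 0")
  case False
  have "p ^ multiplicity p i dvd i * (i - 1 choose (j - 1))"
    by (intro dvd_mult2 multiplicity_dvd)
  also have "i * (i - 1 choose (j - 1)) = j * (i choose j)"
    using times_binomial_minus1_eq[of j i] False by simp
  finally have d: "p ^ multiplicity p i dvd j * (i choose j)" .
  obtain u where u: "\<not> p dvd u" "j = p ^ multiplicity p j * u"
    using multiplicity_decompose'[of j p] False p by (metis not_prime_unit)
  have "j * (i choose j) = u * ((i choose j) * p ^ multiplicity p j)"
    using u(2) by (metis mult.assoc mult.commute)
  moreover have "coprime (p ^ multiplicity p i) u" using u(1) p prime_imp_coprime_nat by simp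
  ultimately have "p ^ multiplicity p i dvd (i choose j) * p ^ multiplicity p j"
    using d by (simp only: coprime_dvd_mult_right_iff)
  hence "p ^ a * p ^ multiplicity p i dvd p ^ a * ((i choose j) * p ^ multiplicity p j)"
    by (rule mult_dvd_mono[OF dvd_refl])
  thus ?thesis using False \<open>j \<le> i\<close> by (simp add: divpoly_modulus_def power_add mult_ac)
qed (simp add: divpoly_modulus_def)

text \<open>This ideal will be seen to contain the generators of \<open>divpoly_ideal\<close>. So
  products in the divided power ring create no smaller multiple of \<open>x_i\<close>, which bounds
  the orders in the quotient from below.\<close>

lemma ideal_divpoly_moduli:
  assumes p: "prime p"
  shows "ideal {f \<in> divpoly_set. \<forall>i. int (divpoly_modulus p a i) dvd dcoeff f i} divpoly_ring" (is "ideal ?J _")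
proof -
  interpret R: cring divpoly_ring by (rule cring_divpoly)
  have dcoeff0: "dcoeff 0 i = 0" for i by (simp add: dcoeff_def)
  have dcoeff_minus: "dcoeff (- f) i = - dcoeff f i" if "f \<in> divpoly_set" for f i
    using dcoeff_add[OF that divpoly_set_uminus[OF that], of i] by (simp add: dcoeff0)
  have cl: "f * g \<in> ?J" if f: "f \<in> ?J" and g: "g \<in> divpoly_set" for f g
  proof -
    have "int (divpoly_modulus p a i) dvd int (i choose j) * dcoeff f j * dcoeff g (i - j)" if "j \<le> i" for i j
    proof -
      have "int (divpoly_modulus p a i) dvd int (i choose j) * int (divpoly_modulus p a j)"
        using dvd_binomial_modulus[OF p that, of a] by (metis of_nat_dvd_iff of_nat_mult)
      also have "\<dots> dvd int (i choose j) * dcoeff f j" using f by (intro mult_dvd_mono) auto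
      finally show ?thesis by (rule dvd_mult2)
    qed
    thus ?thesis using f g by (auto simp: divpoly_set_mult dcoeff_mult intro!: dvd_sum)
  qed
  show ?thesis
  proof (rule idealI)
    show "subgroup ?J (add_monoid divpoly_ring)"
    proof (rule R.add.subgroupI)
      show "?J \<noteq> {}" using divpoly_set_0 by (auto simp: dcoeff0 intro!: exI[of _ 0])
    next
      fix f assume "f \<in> ?J"
      thus "\<ominus>\<^bsub>divpoly_ring\<^esub> f \<in> ?J" by (auto simp: minus_divpoly divpoly_set_uminus dcoeff_minus)
    next
      fix f g assume "f \<in> ?J" "g \<in> ?J"
      thus "f \<oplus>\<^bsub>divpoly_ring\<^esub> g \<in> ?J" by (auto simp: divpoly_ring_def divpoly_set_add dcoeff_add)
    qed (auto simp: divpoly_ring_def)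
  next
    fix f g assume "f \<in> ?J" "g \<in> carrier divpoly_ring"
    thus "g \<otimes>\<^bsub>divpoly_ring\<^esub> f \<in> ?J" "f \<otimes>\<^bsub>divpoly_ring\<^esub> g \<in> ?J"
      using cl by (simp_all add: divpoly_ring_def mult.commute)
  qed (rule R.ring_axioms)
qed

lemma divpoly_gens_subset:
  "{of_nat (p ^ (multiplicity p i + a)) * divpow i |i. 1 \<le> i} \<subseteq> carrier divpoly_ring"
  by (auto simp: divpoly_ring_def simp del: of_nat_power intro!: divpoly_set_of_nat_mult divpow_in)

lemma ideal_divpoly_ideal: "ideal (divpoly_ideal p a) divpoly_ring"
  unfolding divpoly_ideal_def
  by (rule ring.genideal_ideal[OF _ divpoly_gens_subset]) (use cring_divpoly cring_def in blast)

lemma divpow_mult_in_ideal: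
  "0 < i \<Longrightarrow> of_nat (divpoly_modulus p a i) * divpow i \<in> divpoly_ideal p a"
  unfolding divpoly_ideal_def
  using ring.genideal_self[OF _ divpoly_gens_subset, of p a] cring_divpoly
  by (force simp: cring_def divpoly_modulus_def add.commute)

lemma dvd_dcoeff_ideal:
  assumes "prime p" "f \<in> divpoly_ideal p a"
  shows "int (divpoly_modulus p a i) dvd dcoeff f i" "f \<in> divpoly_set"
proof -
  interpret R: cring divpoly_ring by (rule cring_divpoly)
  let ?J = "{f \<in> divpoly_set. \<forall>i. int (divpoly_modulus p a i) dvd dcoeff f i}"
  have m: "dcoeff (of_nat n * divpow k) i = (if i = k then int n else 0)" for n i k
    unfolding dcoeff_def by (simp add: coeff_divpow of_nat_poly)
  have "divpoly_ideal p a \<subseteq> ?J" unfolding divpoly_ideal_def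
  proof (rule R.genideal_minimal[OF ideal_divpoly_moduli[OF assms(1)]])
    show "{of_nat (p ^ (multiplicity p i + a)) * divpow i |i. 1 \<le> i} \<subseteq> ?J"
      by (auto simp del: of_nat_power simp: m divpoly_modulus_def add.commute
          intro!: divpoly_set_of_nat_mult divpow_in)
  qed
  thus "int (divpoly_modulus p a i) dvd dcoeff f i" "f \<in> divpoly_set" using assms(2) by auto
qed

section \<open>The tensor product of two quotients\<close>

locale divpoly_tensor =
  fixes p a :: nat
  assumes p: "prime p"
begin

abbreviation "Q \<equiv> divpoly_quot p a"
abbreviation "cls i \<equiv> divpow_class p a i"
abbreviation "FA \<equiv> free_Abelian_group (carrier Q \<times> carrier Q)"
definition "R = tensor_rels (add_monoid Q) (add_monoid Q)"

sublocale I: ideal "divpoly_ideal p a" divpoly_ring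
  by (rule ideal_divpoly_ideal)

sublocale proj: ring_hom_ring divpoly_ring Q "(+>\<^bsub>divpoly_ring\<^esub>) (divpoly_ideal p a)"
  unfolding divpoly_quot_def by (rule I.rcos_ring_hom_ring)

lemma carrier_Q: "carrier Q = (\<lambda>f. divpoly_ideal p a +>\<^bsub>divpoly_ring\<^esub> f) ` divpoly_set"
  by (auto simp: divpoly_quot_def FactRing_def A_RCOSETS_def' divpoly_ring_def)

lemma mem_coset_iff: "f' \<in> divpoly_ideal p a +>\<^bsub>divpoly_ring\<^esub> f \<longleftrightarrow> (\<exists>h\<in>divpoly_ideal p a. f' = h + f)"
  by (auto simp: a_r_coset_def' divpoly_ring_def)

text \<open>
  The coefficient of \<open>x\<^sub>i\<close> in a class. It depends on the chosen representative, but not modulo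
  \<open>divpoly_modulus p a i\<close>.
\<close>

definition cq :: "nat \<Rightarrow> rat poly set \<Rightarrow> int" where
  "cq i A = dcoeff (SOME f. f \<in> A) i"

lemma dvd_cq_coset:
  assumes f: "f \<in> divpoly_set"
  shows "int (divpoly_modulus p a i) dvd cq i (divpoly_ideal p a +>\<^bsub>divpoly_ring\<^esub> f) - dcoeff f i"
proof -
  let ?A = "divpoly_ideal p a +>\<^bsub>divpoly_ring\<^esub> f"
  have "f \<in> ?A" using f I.a_rcos_self by (simp add: divpoly_ring_def)
  hence "(SOME f. f \<in> ?A) \<in> ?A" by (rule someI)
  then obtain h where h: "h \<in> divpoly_ideal p a" "(SOME f. f \<in> ?A) = h + f" using mem_coset_iff by blast
  thus ?thesis using dvd_dcoeff_ideal[OF p h(1)] f by (simp add: cq_def dcoeff_add)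
qed

lemma dvd_cq_add:
  assumes "A \<in> carrier Q" "B \<in> carrier Q"
  shows "int (divpoly_modulus p a i) dvd cq i (A \<oplus>\<^bsub>Q\<^esub> B) - cq i A - cq i B"
proof -
  obtain f g where fg: "f \<in> divpoly_set" "A = divpoly_ideal p a +>\<^bsub>divpoly_ring\<^esub> f"
    "g \<in> divpoly_set" "B = divpoly_ideal p a +>\<^bsub>divpoly_ring\<^esub> g"
    using assms by (auto simp: carrier_Q)
  have AB: "A \<oplus>\<^bsub>Q\<^esub> B = divpoly_ideal p a +>\<^bsub>divpoly_ring\<^esub> (f + g)"
    using proj.hom_add[of f g] fg by (simp add: divpoly_ring_def)
  have "int (divpoly_modulus p a i) dvd (cq i (A \<oplus>\<^bsub>Q\<^esub> B) - dcoeff (f + g) i) - (cq i A - dcoeff f i) - (cq i B - dcoeff g i)"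
    unfolding AB unfolding fg(2,4) using fg by (intro dvd_diff dvd_cq_coset divpoly_set_add)
  moreover have "(cq i (A \<oplus>\<^bsub>Q\<^esub> B) - dcoeff (f + g) i) - (cq i A - dcoeff f i) - (cq i B - dcoeff g i)
      = cq i (A \<oplus>\<^bsub>Q\<^esub> B) - cq i A - cq i B"
    using fg by (simp add: dcoeff_add)
  ultimately show ?thesis by (simp only:)
qed

lemma dvd_cq_cls: "int (divpoly_modulus p a i) dvd cq i (cls k) - (if i = k then 1 else 0)"
  using dvd_cq_coset[OF divpow_in[of k], of i] by (simp add: divpow_class_def dcoeff_divpow)

lemma cls_in: "cls i \<in> carrier Q"
  by (auto simp: carrier_Q divpow_class_def divpow_in)

lemma tors_order_dvd:
  assumes "(i, j) \<noteq> (0, 0)"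
  shows "tors_order p a i j dvd divpoly_modulus p a i" "tors_order p a i j dvd divpoly_modulus p a j"
  using assms p by (auto simp: tors_order_def divpoly_modulus_def intro!: le_imp_power_dvd dvd_imp_multiplicity_le)

text \<open>For positive indices \<open>multiplicity p (gcd i j)\<close> is the minimum of the two
  multiplicities; if one index is 0, the gcd is the other index. So one of the two tensor factors is
  already killed by \<open>tors_order\<close>.\<close>

lemma tors_order_eq:
  assumes "(i, j) \<noteq> (0, 0)"
  shows "(0 < i \<and> tors_order p a i j = divpoly_modulus p a i) \<or> (0 < j \<and> tors_order p a i j = divpoly_modulus p a j)"
  using assms p by (auto simp: tors_order_def divpoly_modulus_def multiplicity_gcd min_def)

text \<open>Reads off the coefficient of \<open>x_i \<otimes> x'_j\<close>. Being defined on the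
  free abelian group, it needs no descent to the tensor product. The representatives chosen in
  \<open>cq\<close> spoil additivity only by multiples of the moduli, and \<open>tors_order\<close>
  divides both of them.\<close>

definition coef_form :: "nat \<Rightarrow> nat \<Rightarrow> (rat poly set \<times> rat poly set \<Rightarrow>\<^sub>0 int) \<Rightarrow> int" where
  "coef_form i j = comb (\<lambda>z. cq i (fst z) * cq j (snd z))"

definition rel1 where
  "rel1 A A' B = frag_of (A \<oplus>\<^bsub>Q\<^esub> A', B) - frag_of (A, B) - frag_of (A', B)"
definition rel2 where
  "rel2 A B B' = frag_of (A, B \<oplus>\<^bsub>Q\<^esub> B') - frag_of (A, B) - frag_of (A, B')"

definition rels where
  "rels = {rel1 A A' B |A A' B. A \<in> carrier Q \<and> A' \<in> carrier Q \<and> B \<in> carrier Q}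
    \<union> {rel2 A B B' |A B B'. A \<in> carrier Q \<and> B \<in> carrier Q \<and> B' \<in> carrier Q}"

lemma R_eq: "R = generate FA rels"
  by (simp add: R_def tensor_rels_def rels_def rel1_def rel2_def)

lemma rels_subset: "rels \<subseteq> carrier FA"
proof -
  have cl: "Poly_Mapping.keys (frag_of z - frag_of x - frag_of y) \<subseteq> carrier Q \<times> carrier Q"
    if "z \<in> carrier Q \<times> carrier Q" "x \<in> carrier Q \<times> carrier Q" "y \<in> carrier Q \<times> carrier Q" for x y z
    using that keys_diff[of "frag_of z - frag_of x" "frag_of y"] keys_diff[of "frag_of z" "frag_of x"]
    by (auto simp: keys_frag_of)
  show ?thesis unfolding rels_def rel1_def rel2_def by (auto dest!: subsetD[OF cl, rotated -1])
qed

lemma subgroup_R: "subgroup R FA"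
  unfolding R_eq by (rule group.generate_is_subgroup[OF _ rels_subset]) simp

lemma R_closed:
  "u \<in> R \<Longrightarrow> v \<in> R \<Longrightarrow> u + v \<in> R" "u \<in> R \<Longrightarrow> - u \<in> R" "0 \<in> R"
  "u \<in> R \<Longrightarrow> v \<in> R \<Longrightarrow> u - v \<in> R" "u \<in> R \<Longrightarrow> frag_cmul k u \<in> R"
proof -
  show add: "u \<in> R \<Longrightarrow> v \<in> R \<Longrightarrow> u + v \<in> R" for u v
    using subgroup.m_closed[OF subgroup_R, of u v] by simp
  show minus: "u \<in> R \<Longrightarrow> - u \<in> R" for u
    using subgroup.m_inv_closed[OF subgroup_R, of u] subgroup.mem_carrier[OF subgroup_R, of u] by simp
  show zero: "0 \<in> R"
    using subgroup.one_closed[OF subgroup_R] by simp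
  show "u \<in> R \<Longrightarrow> v \<in> R \<Longrightarrow> u - v \<in> R"
    using add[of u "- v"] minus[of v] by simp
  show "u \<in> R \<Longrightarrow> frag_cmul k u \<in> R"
  proof (induction k rule: int_induct[where k = 0])
    case (step1 i) thus ?case using add[of "frag_cmul i u" u] by (simp add: frag_cmul_distrib)
  next
    case (step2 i) thus ?case using add[of "frag_cmul i u" "- u"] minus[of u]
      by (simp add: frag_cmul_diff_distrib)
  qed (simp add: zero)
qed

lemma rel_in_R:
  assumes "A \<in> carrier Q" "B \<in> carrier Q" "C \<in> carrier Q"
  shows "rel1 A B C \<in> R" "rel2 A B C \<in> R"
proof -
  have "rel1 A B C \<in> rels" "rel2 A B C \<in> rels" unfolding rels_def using assms by blast+
  thus "rel1 A B C \<in> R" "rel2 A B C \<in> R" unfolding R_eq by (simp_all only: generate.incl)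
qed

lemma dvd_coef_form:
  assumes "u \<in> R" and ij: "(i, j) \<noteq> (0, 0)"
  shows "int (tors_order p a i j) dvd coef_form i j u"
proof -
  have rel: "int (tors_order p a i j) dvd coef_form i j h" if "h \<in> rels" for h
  proof -
    from that show ?thesis unfolding rels_def
    proof (elim UnE CollectE exE conjE)
      fix A A' B assume 1: "A \<in> carrier Q" "A' \<in> carrier Q" "h = rel1 A A' B"
      have "int (tors_order p a i j) dvd cq i (A \<oplus>\<^bsub>Q\<^esub> A') - cq i A - cq i A'"
        by (rule dvd_trans[OF _ dvd_cq_add[OF 1(1,2)]]) (simp add: tors_order_dvd(1)[OF ij])
      hence "int (tors_order p a i j) dvd (cq i (A \<oplus>\<^bsub>Q\<^esub> A') - cq i A - cq i A') * cq j B" by (rule dvd_mult2)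
      also have "\<dots> = coef_form i j h"
        by (simp add: 1(3) rel1_def coef_form_def comb_diff left_diff_distrib)
      finally show "int (tors_order p a i j) dvd coef_form i j h" .
    next
      fix A B B' assume 2: "B \<in> carrier Q" "B' \<in> carrier Q" "h = rel2 A B B'"
      have "int (tors_order p a i j) dvd cq j (B \<oplus>\<^bsub>Q\<^esub> B') - cq j B - cq j B'"
        by (rule dvd_trans[OF _ dvd_cq_add[OF 2(1,2)]]) (simp add: tors_order_dvd(2)[OF ij])
      hence "int (tors_order p a i j) dvd cq i A * (cq j (B \<oplus>\<^bsub>Q\<^esub> B') - cq j B - cq j B')" by (rule dvd_mult)
      also have "\<dots> = coef_form i j h"
        by (simp add: 2(3) rel2_def coef_form_def comb_diff right_diff_distrib)
      finally show "int (tors_order p a i j) dvd coef_form i j h" .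
    qed
  qed
  have "u \<in> generate FA rels" using assms(1) by (simp only: R_eq)
  thus ?thesis
  proof (induction u rule: generate.induct)
    case (inv h)
    have "inv\<^bsub>FA\<^esub> h = - h"
      by (rule inv_free_Abelian_group) (use subsetD[OF rels_subset inv] in simp)
    thus ?case using rel[OF inv] by (simp add: coef_form_def comb_minus)
  qed (auto simp: rel, auto simp: coef_form_def comb_add)
qed

lemma frag_zero_in_R:
  assumes "B \<in> carrier Q" shows "frag_of (\<zero>\<^bsub>Q\<^esub>, B) \<in> R" "frag_of (B, \<zero>\<^bsub>Q\<^esub>) \<in> R"
proof -
  have z: "\<zero>\<^bsub>Q\<^esub> \<in> carrier Q" by simp
  show "frag_of (\<zero>\<^bsub>Q\<^esub>, B) \<in> R" "frag_of (B, \<zero>\<^bsub>Q\<^esub>) \<in> R"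
    using R_closed(2)[OF rel_in_R(1)[OF z z assms]] R_closed(2)[OF rel_in_R(2)[OF assms z z]]
    by (simp_all add: rel1_def rel2_def)
qed

lemma coset_ideal:
  assumes "f \<in> divpoly_ideal p a"
  shows "divpoly_ideal p a +>\<^bsub>divpoly_ring\<^esub> f = \<zero>\<^bsub>Q\<^esub>"
  using I.a_rcos_const[OF assms] by (simp only: divpoly_quot_def FactRing_def ring_record_simps)

text \<open>An integer is moved into one tensor factor by repeated use of bilinearity. When
  \<open>n\<close> is the modulus of a positive index \<open>i\<close>, the factor
  \<open>M n i\<close> is zero, which bounds the order of the pure tensor from above.\<close>

lemma multiple_in_R:
  assumes B: "B \<in> carrier Q"
  defines "M \<equiv> \<lambda>n i. divpoly_ideal p a +>\<^bsub>divpoly_ring\<^esub> (of_nat n * divpow i)"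
  shows "frag_cmul (int n) (frag_of (cls i, B)) - frag_of (M n i, B) \<in> R"
    and "frag_cmul (int n) (frag_of (B, cls i)) - frag_of (B, M n i) \<in> R"
proof -
  have M0: "M 0 i = \<zero>\<^bsub>Q\<^esub>"
    using coset_ideal[OF subgroup.one_closed[OF I.a_subgroup]] by (simp add: M_def divpoly_ring_def)
  have M_in: "M n i \<in> carrier Q" for n
    by (auto simp: M_def carrier_Q intro!: divpoly_set_of_nat_mult divpow_in)
  have MSuc: "M (Suc n) i = M n i \<oplus>\<^bsub>Q\<^esub> cls i" for n
    using proj.hom_add[of "of_nat n * divpow i" "divpow i"]
    by (simp add: M_def divpow_class_def divpoly_ring_def divpoly_set_of_nat_mult divpow_in distrib_right add.commute)
  show "frag_cmul (int n) (frag_of (cls i, B)) - frag_of (M n i, B) \<in> R"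
  proof (induction n)
    case 0 show ?case using R_closed(2)[OF frag_zero_in_R(1)[OF B]] by (simp add: M0)
  next
    case (Suc n)
    from R_closed(4)[OF Suc rel_in_R(1)[OF M_in[of n] cls_in[of i] B]] show ?case
      by (simp add: rel1_def MSuc frag_cmul_distrib algebra_simps)
  qed
  show "frag_cmul (int n) (frag_of (B, cls i)) - frag_of (B, M n i) \<in> R"
  proof (induction n)
    case 0 show ?case using R_closed(2)[OF frag_zero_in_R(2)[OF B]] by (simp add: M0)
  next
    case (Suc n)
    from R_closed(4)[OF Suc rel_in_R(2)[OF B M_in[of n] cls_in[of i]]] show ?case
      by (simp add: rel2_def MSuc frag_cmul_distrib algebra_simps)
  qed
qed

lemma tors_order_cls_in_R:
  assumes "(i, j) \<noteq> (0, 0)"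
  shows "frag_cmul (int (tors_order p a i j)) (frag_of (cls i, cls j)) \<in> R"
  using tors_order_eq[OF assms]
proof (elim disjE conjE)
  assume i: "0 < i" and eq: "tors_order p a i j = divpoly_modulus p a i"
  from R_closed(1)[OF multiple_in_R(1)[OF cls_in[of j], of "divpoly_modulus p a i" i] frag_zero_in_R(1)[OF cls_in[of j]]]
  show ?thesis by (simp add: eq coset_ideal[OF divpow_mult_in_ideal[OF i]])
next
  assume j: "0 < j" and eq: "tors_order p a i j = divpoly_modulus p a j"
  from R_closed(1)[OF multiple_in_R(2)[OF cls_in[of i], of "divpoly_modulus p a j" j] frag_zero_in_R(2)[OF cls_in[of i]]]
  show ?thesis by (simp add: eq coset_ideal[OF divpow_mult_in_ideal[OF j]])
qed

definition lift :: "(nat \<times> nat \<Rightarrow>\<^sub>0 int) \<Rightarrow> (rat poly set \<times> rat poly set \<Rightarrow>\<^sub>0 int)" where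
  "lift = frag_extend (\<lambda>z. frag_of (cls (fst z), cls (snd z)))"

definition psi :: "(nat \<times> nat \<Rightarrow>\<^sub>0 int) \<Rightarrow> divpoly2" where
  "psi c = R #>\<^bsub>FA\<^esub> lift c"

lemma lift_in: "lift c \<in> carrier FA"
  using keys_frag_extend[of "\<lambda>z. frag_of (cls (fst z), cls (snd z))" c] cls_in
  by (auto simp: lift_def keys_frag_of)

lemma coef_form_lift:
  assumes ij: "(i, j) \<noteq> (0, 0)"
  shows "int (tors_order p a i j) dvd coef_form i j (lift c) - poly_mapping.lookup c (i, j)"
  using subset_UNIV
proof (induction c rule: frag_induction)
  case (one z)
  obtain k l where z: "z = (k, l)" by (metis surj_pair)
  have "int (tors_order p a i j) dvd cq i (cls k) - (if i = k then 1 else 0)"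
    "int (tors_order p a i j) dvd cq j (cls l) - (if j = l then 1 else 0)"
    by (rule dvd_trans[OF _ dvd_cq_cls], simp add: tors_order_dvd[OF ij])+
  from dvd_diff_mult[OF this] show ?case by (auto simp: z lift_def coef_form_def)
next
  case (diff c d)
  from dvd_diff[OF diff] show ?case
    by (simp add: lift_def frag_extend_diff coef_form_def comb_diff lookup_minus algebra_simps)
qed (simp add: lift_def coef_form_def)

text \<open>One direction applies \<open>coef_form\<close>, which is divisible by
  \<open>tors_order\<close> on all relations; the other sums multiples of the elements in
  \<open>tors_order_cls_in_R\<close>. Together they say that the tensors
  \<open>x_i \<otimes> x'_j\<close> other than \<open>1 \<otimes> 1\<close> span a direct sum of
  cyclic groups of these orders.\<close>

lemma lift_in_R_iff:
  assumes "(0, 0) \<notin> Poly_Mapping.keys c"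
  shows "lift c \<in> R \<longleftrightarrow> (\<forall>i j. int (tors_order p a i j) dvd poly_mapping.lookup c (i, j))"
proof
  assume R: "lift c \<in> R"
  show "\<forall>i j. int (tors_order p a i j) dvd poly_mapping.lookup c (i, j)"
  proof (intro allI)
    fix i j
    show "int (tors_order p a i j) dvd poly_mapping.lookup c (i, j)"
    proof (cases "(i, j) = (0, 0)")
      case True thus ?thesis using assms by (simp add: in_keys_iff)
    next
      case False
      from dvd_diff[OF dvd_coef_form[OF R False] coef_form_lift[OF False, of c]] show ?thesis by simp
    qed
  qed
next
  assume dvd: "\<forall>i j. int (tors_order p a i j) dvd poly_mapping.lookup c (i, j)"
  have "frag_cmul (poly_mapping.lookup c z) (frag_of (cls (fst z), cls (snd z))) \<in> R"
    if z: "z \<in> Poly_Mapping.keys c" for z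
  proof -
    obtain e where "poly_mapping.lookup c z = e * int (tors_order p a (fst z) (snd z))"
      using dvd by (metis dvd_def mult.commute prod.collapse)
    moreover have "(fst z, snd z) \<noteq> (0, 0)" using z assms by (metis prod.collapse)
    ultimately show ?thesis using R_closed(5)[OF tors_order_cls_in_R, of "fst z" "snd z" e] by simp
  qed
  moreover have "finite K \<Longrightarrow> (\<And>z. z \<in> K \<Longrightarrow> h z \<in> R) \<Longrightarrow> sum h K \<in> R" for K :: "(nat \<times> nat) set" and h
    by (induction K rule: finite_induct) (auto intro: R_closed)
  ultimately show "lift c \<in> R" unfolding lift_def frag_extend_def by simp
qed

lemma psi_eq_iff_lift: "psi c = psi d \<longleftrightarrow> lift (c - d) \<in> R"
  using group.rcos_eq_iff[OF group_free_Abelian_group subgroup_R lift_in lift_in, of c d] lift_in[of d]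
  by (simp add: psi_def lift_def frag_extend_diff)

lemma psi_eq_iff:
  assumes "(0, 0) \<notin> Poly_Mapping.keys c" "(0, 0) \<notin> Poly_Mapping.keys d"
  shows "psi c = psi d \<longleftrightarrow> (\<forall>i j. int (tors_order p a i j) dvd poly_mapping.lookup c (i, j) - poly_mapping.lookup d (i, j))"
proof -
  have "(0, 0) \<notin> Poly_Mapping.keys (c - d)" using assms keys_diff[of c d] by blast
  thus ?thesis by (simp add: psi_eq_iff_lift lift_in_R_iff lookup_minus)
qed

lemma normal_R: "R \<lhd> FA"
  using comm_group.normal_iff_subgroup[OF abelian_free_Abelian_group] subgroup_R by blast

lemma divpoly2_eq: "divpoly2 p a = FA Mod R"
  by (simp add: R_def divpoly2_def tensor_def)

lemma group_divpoly2: "group (divpoly2 p a)"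
  unfolding divpoly2_eq by (rule normal.factorgroup_is_group[OF normal_R])

lemma psi_add: "psi (c + d) = psi c \<otimes>\<^bsub>divpoly2 p a\<^esub> psi d"
  using normal.rcos_sum[OF normal_R lift_in[of c] lift_in[of d]]
  by (simp add: psi_def divpoly2_eq lift_def frag_extend_add)

lemma psi_in: "psi c \<in> carrier (divpoly2 p a)"
  using lift_in[of c] by (auto simp: psi_def divpoly2_eq carrier_FactGroup)

lemma psi_frag_of: "psi (frag_of (i, j)) = divpow2 p a i j"
  by (simp add: R_def psi_def lift_def divpow2_def pure_tensor_def)

lemma psi_zero: "psi 0 = \<one>\<^bsub>divpoly2 p a\<^esub>"
  using psi_add[of 0 0] psi_in[of 0] group.l_cancel_one[OF group_divpoly2] by force

lemma psi_minus: "psi (- c) = inv\<^bsub>divpoly2 p a\<^esub> psi c"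
  using psi_add[of "- c" c] psi_zero psi_in by (metis add.left_inverse group.inv_equality group_divpoly2)

lemma generate_divpow2:
  "generate (divpoly2 p a) {divpow2 p a i j |i j. (i, j) \<in> K} = psi ` {c. Poly_Mapping.keys c \<subseteq> K}"
proof (intro equalityI subsetI)
  fix x assume "x \<in> generate (divpoly2 p a) {divpow2 p a i j |i j. (i, j) \<in> K}"
  thus "x \<in> psi ` {c. Poly_Mapping.keys c \<subseteq> K}"
  proof (induction x rule: generate.induct)
    case one thus ?case using psi_zero by (metis (mono_tags) empty_subsetI image_eqI keys_zero mem_Collect_eq)
  next
    case (incl h)
    then obtain i j where "h = psi (frag_of (i, j))" "(i, j) \<in> K" by (auto simp: psi_frag_of)
    thus ?case by (auto simp: keys_frag_of)
  next
    case (inv h)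
    then obtain i j where "h = psi (frag_of (i, j))" "(i, j) \<in> K" by (auto simp: psi_frag_of)
    thus ?case by (auto simp: keys_frag_of psi_minus[symmetric] intro!: imageI)
  next
    case (eng x y)
    then obtain c d where "x = psi c" "y = psi d" "Poly_Mapping.keys c \<subseteq> K" "Poly_Mapping.keys d \<subseteq> K" by blast
    thus ?case using keys_add[of c d] by (auto simp: psi_add[symmetric] intro!: imageI)
  qed
next
  let ?S = "{divpow2 p a i j |i j. (i, j) \<in> K}"
  have sub: "subgroup (generate (divpoly2 p a) ?S) (divpoly2 p a)"
    by (rule group.generate_is_subgroup[OF group_divpoly2]) (auto simp: psi_frag_of[symmetric] psi_in)
  fix x assume "x \<in> psi ` {c. Poly_Mapping.keys c \<subseteq> K}"
  then obtain c where c: "Poly_Mapping.keys c \<subseteq> K" "x = psi c" by blast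
  from c(1) have "psi c \<in> generate (divpoly2 p a) ?S"
  proof (induction c rule: frag_induction)
    case zero show ?case by (simp add: psi_zero generate.one)
  next
    case (one z)
    obtain i j where "z = (i, j)" by (metis surj_pair)
    thus ?case using one by (auto simp: psi_frag_of intro: generate.incl)
  next
    case (diff c d)
    have "psi (c - d) = psi c \<otimes>\<^bsub>divpoly2 p a\<^esub> inv\<^bsub>divpoly2 p a\<^esub> psi d"
      using psi_add[of c "- d"] by (simp add: psi_minus)
    thus ?case using diff subgroup.m_closed[OF sub] subgroup.m_inv_closed[OF sub] by simp
  qed
  thus "x \<in> generate (divpoly2 p a) ?S" using c(2) by simp
qed

lemma carrier_divpoly2_pos:
  assumes "0 < k" "0 < l"
  shows "carrier (divpoly2_pos p a k l) = psi ` {c. Poly_Mapping.keys c \<subseteq> - {(0, 0)}}"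
proof -
  have "{divpow2 p a i j |i j. 0 < k * i + l * j} = {divpow2 p a i j |i j. (i, j) \<in> - {(0, 0)}}"
    using assms by auto
  hence "carrier (divpoly2_pos p a k l) = generate (divpoly2 p a) {divpow2 p a i j |i j. (i, j) \<in> - {(0, 0)}}"
    unfolding divpoly2_pos_def by simp
  thus ?thesis by (simp only: generate_divpow2)
qed

text \<open>For \<open>n > 0\<close> all combinations of degree \<open>n\<close> are positive. For
  \<open>n = 0\<close> two images have to be shown to meet trivially: the functionals with
  \<open>(i, j) \<noteq> (0, 0)\<close> vanish modulo their orders on multiples of
  \<open>1 \<otimes> 1\<close>, and they detect the elements of the positive part.\<close>

lemma carrier_divpoly2_pos_deg:
  assumes k: "0 < k" "0 < l"
  shows "carrier (divpoly2_pos_deg p a k l n)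
    = psi ` {c. Poly_Mapping.keys c \<subseteq> {(i, j). k * i + l * j = n \<and> (i, j) \<noteq> (0, 0)}}"
proof -
  let ?K = "{(i, j). k * i + l * j = n}"
  have "{divpow2 p a i j |i j. k * i + l * j = n} = {divpow2 p a i j |i j. (i, j) \<in> ?K}" by simp
  hence deg: "divpoly2_deg p a k l n = psi ` {c. Poly_Mapping.keys c \<subseteq> ?K}"
    unfolding divpoly2_deg_def by (simp only: generate_divpow2)
  show ?thesis
  proof (cases "n = 0")
    case False
    hence "{(i, j). k * i + l * j = n \<and> (i, j) \<noteq> (0, 0)} = ?K" "?K \<subseteq> - {(0, 0)}" by auto
    thus ?thesis by (auto simp: divpoly2_pos_deg_def deg carrier_divpoly2_pos[OF k])
  next
    case True
    have e: "{(i, j). k * i + l * j = n \<and> (i, j) \<noteq> (0, 0)} = {}" "?K = {(0, 0)}" using True k by auto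
    have h1: "x = psi 0" if x: "x \<in> psi ` {c. Poly_Mapping.keys c \<subseteq> - {(0, 0)}}" "x \<in> psi ` {c. Poly_Mapping.keys c \<subseteq> ?K}" for x
    proof -
      obtain c d where cd: "Poly_Mapping.keys c \<subseteq> - {(0, 0)}" "x = psi c" "Poly_Mapping.keys d \<subseteq> {(0, 0)}" "x = psi d"
        using x e by auto
      hence "lift (c - d) \<in> R" using psi_eq_iff_lift by blast
      have "int (tors_order p a i j) dvd poly_mapping.lookup c (i, j)" for i j
      proof (cases "(i, j) = (0, 0)")
        case True thus ?thesis using cd(1) by (auto simp: in_keys_iff)
      next
        case False
        have "poly_mapping.lookup d (i, j) = 0" using cd(3) False by (metis in_keys_iff singletonD subsetD)
        with dvd_diff[OF dvd_coef_form[OF \<open>lift (c - d) \<in> R\<close> False] coef_form_lift[OF False, of "c - d"]]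
        show ?thesis by (simp add: lookup_minus)
      qed
      thus "x = psi 0" using cd(1,2) by (subst cd(2), subst psi_eq_iff) auto
    qed
    have h2: "psi 0 \<in> psi ` {c. Poly_Mapping.keys c \<subseteq> - {(0, 0)}}" "psi 0 \<in> psi ` {c. Poly_Mapping.keys c \<subseteq> ?K}"
      by (auto intro!: imageI)
    have "psi ` {c. Poly_Mapping.keys c \<subseteq> - {(0, 0)}} \<inter> psi ` {c. Poly_Mapping.keys c \<subseteq> ?K} = {psi 0}" (is "?A \<inter> ?B = _")
    proof (rule equalityI)
      show "?A \<inter> ?B \<subseteq> {psi 0}"
      proof
        fix x assume "x \<in> ?A \<inter> ?B"
        from h1[OF IntD1[OF this] IntD2[OF this]] show "x \<in> {psi 0}" by (simp only: singleton_iff)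
      qed
      show "{psi 0} \<subseteq> ?A \<inter> ?B" using h2 by (simp only: insert_subset Int_iff empty_subsetI simp_thms)
    qed
    moreover have "{c :: nat \<times> nat \<Rightarrow>\<^sub>0 int. Poly_Mapping.keys c \<subseteq> {}} = {0}" by auto
    ultimately show ?thesis
      unfolding e(1) divpoly2_pos_deg_def deg carrier_divpoly2_pos[OF k] by simp
  qed
qed

end

section \<open>Torsion in the first cohomology\<close>

text \<open>Equality of the fibres makes the assignment of \<open>\<psi> c\<close> to
  \<open>\<theta> c\<close> well defined and injective. Here \<open>D\<close> will consist of the
  formal combinations supported on a set of pairs.\<close>

lemma iso_of_common_cover:
  fixes \<theta> :: "'d::plus \<Rightarrow> 'a" and \<psi> :: "'d \<Rightarrow> 'b"
  assumes D: "\<And>c d. c \<in> D \<Longrightarrow> d \<in> D \<Longrightarrow> c + d \<in> D"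
    and \<theta>: "\<theta> ` D = carrier A" "\<And>c d. c \<in> D \<Longrightarrow> d \<in> D \<Longrightarrow> \<theta> (c + d) = \<theta> c \<otimes>\<^bsub>A\<^esub> \<theta> d"
    and \<psi>: "\<psi> ` D = carrier B" "\<And>c d. c \<in> D \<Longrightarrow> d \<in> D \<Longrightarrow> \<psi> (c + d) = \<psi> c \<otimes>\<^bsub>B\<^esub> \<psi> d"
    and eq: "\<And>c d. c \<in> D \<Longrightarrow> d \<in> D \<Longrightarrow> \<theta> c = \<theta> d \<longleftrightarrow> \<psi> c = \<psi> d"
  shows "\<exists>\<phi>\<in>iso A B. \<forall>c\<in>D. \<phi> (\<theta> c) = \<psi> c"
proof -
  define \<phi> where "\<phi> x = \<psi> (SOME c. c \<in> D \<and> \<theta> c = x)" for x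
  have \<phi>: "\<phi> (\<theta> c) = \<psi> c" if "c \<in> D" for c
  proof -
    have "(SOME d. d \<in> D \<and> \<theta> d = \<theta> c) \<in> D \<and> \<theta> (SOME d. d \<in> D \<and> \<theta> d = \<theta> c) = \<theta> c"
      by (rule someI[of _ c]) (simp add: that)
    thus ?thesis unfolding \<phi>_def using eq that by blast
  qed
  have "\<phi> \<in> hom A B"
  proof (rule homI)
    fix x assume "x \<in> carrier A"
    then obtain c where "c \<in> D" "x = \<theta> c" using \<theta>(1) by blast
    thus "\<phi> x \<in> carrier B" using \<phi> \<psi>(1) by auto
  next
    fix x y assume "x \<in> carrier A" "y \<in> carrier A"
    then obtain c d where "c \<in> D" "x = \<theta> c" "d \<in> D" "y = \<theta> d" using \<theta>(1) by blast
    thus "\<phi> (x \<otimes>\<^bsub>A\<^esub> y) = \<phi> x \<otimes>\<^bsub>B\<^esub> \<phi> y" using \<phi> \<psi>(2) \<theta>(2) D by metis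
  qed
  moreover have "bij_betw \<phi> (carrier A) (carrier B)"
    unfolding \<theta>(1)[symmetric] \<psi>(1)[symmetric] bij_betw_def inj_on_def image_image
    using \<phi> eq by simp
  ultimately show ?thesis using \<phi> by (auto simp: iso_def)
qed

section \<open>First cohomology as crossed homomorphisms modulo principal ones\<close>

lemma merge_at_pair: "merge_at G 0 [g, h] = [g \<otimes>\<^bsub>G\<^esub> h]"
  by (simp add: merge_at_def)

text \<open>\<open>S\<close> is later \<open>carrier SL2Z\<close> or \<open>Gamma m\<close> and the
  module any graded part, so both groups share one development and can be interpreted side by side
  when they are compared by restriction.\<close>

locale SL2_module =
  fixes S :: "(int^2^2) set" and T :: "nat set"
  assumes S: "subgroup S SL2Z"
begin

abbreviation "GS \<equiv> SL2Z\<lparr>carrier := S\<rparr>"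
abbreviation "N \<equiv> graded T"
definition "args = cochain_args GS 1"
definition "C1 T' = cochains GS (graded T') 1"
definition "Z1 = cocycles GS SL2_act N 1"
definition "CG = cocycle_group GS SL2_act N 1"
definition "CB = coboundaries GS SL2_act N 1"
definition "H = cohomology GS SL2_act N 1"

definition d0 :: "int poly poly \<Rightarrow> (int^2^2) list \<Rightarrow> int poly poly" where
  "d0 v gs = (if gs \<in> args then act (hd gs) v - v else 0)"

definition cocycle :: "((int^2^2) list \<Rightarrow> int poly poly) \<Rightarrow> bool" where
  "cocycle f \<longleftrightarrow> f \<in> C1 T \<and> (\<forall>g\<in>S. \<forall>h\<in>S. f [g ** h] = act g (f [h]) + f [g])"

lemma S_mult: "g \<in> S \<Longrightarrow> h \<in> S \<Longrightarrow> g ** h \<in> S"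
  using subgroup.m_closed[OF S, of g h] by (simp add: SL2Z_mult)

lemma args_1: "gs \<in> args \<longleftrightarrow> (\<exists>g\<in>S. gs = [g])"
  by (auto simp: args_def cochain_args_def length_Suc_conv)

lemma args_2: "gs \<in> cochain_args GS (Suc 1) \<longleftrightarrow> (\<exists>g\<in>S. \<exists>h\<in>S. gs = [g, h])"
  by (auto simp: cochain_args_def length_Suc_conv)

lemma cochains_1: "f \<in> C1 T' \<longleftrightarrow> (\<forall>g\<in>S. f [g] \<in> graded T') \<and> (\<forall>gs. gs \<notin> args \<longrightarrow> f gs = 0)"
  unfolding C1_def cochains_def mem_Collect_eq args_def[symmetric] by (simp add: args_1 Ball_def, blast)

lemma cochain_eqI:
  assumes "\<And>gs. gs \<notin> args \<Longrightarrow> f gs = 0" "\<And>gs. gs \<notin> args \<Longrightarrow> f' gs = 0"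
    "\<And>g. g \<in> S \<Longrightarrow> f [g] = f' [g]"
  shows "f = f'"
proof
  fix gs show "f gs = f' gs"
    using assms by (cases "gs \<in> args") (auto simp: args_1)
qed

lemma cocycles_iff: "f \<in> Z1 \<longleftrightarrow> cocycle f"
proof -
  have "coboundary GS SL2_act 1 f [g, h] = act g (f [h]) - f [g ** h] + f [g]" if "g \<in> S" "h \<in> S" for g h
  proof -
    have "[g, h] \<in> cochain_args GS (Suc 1)" using that args_2 by blast
    thus ?thesis by (simp add: coboundary_def merge_at_pair signed_def SL2Z_mult)
  qed
  moreover have "coboundary GS SL2_act 1 f gs = 0" if "gs \<notin> cochain_args GS (Suc 1)" for gs
    using that by (simp add: coboundary_def)
  ultimately have "coboundary GS SL2_act 1 f = (\<lambda>_. 0) \<longleftrightarrow> (\<forall>g\<in>S. \<forall>h\<in>S. act g (f [h]) - f [g ** h] + f [g] = 0)"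
    unfolding fun_eq_iff using args_2 by metis
  moreover have "act g (f [h]) - f [g ** h] + f [g] = 0 \<longleftrightarrow> f [g ** h] = act g (f [h]) + f [g]" for g h
    by (auto simp: algebra_simps eq_diff_eq)
  ultimately show ?thesis by (simp only: Z1_def cocycles_def cocycle_def C1_def mem_Collect_eq)
qed

lemma d0_single: "g \<in> S \<Longrightarrow> d0 v [g] = act g v - v"
  by (simp add: d0_def args_1)

lemma d0_off: "gs \<notin> args \<Longrightarrow> d0 v gs = 0"
  by (simp add: d0_def)

lemma CB_eq: "CB = d0 ` N"
proof -
  have cob: "coboundary GS SL2_act 0 f = d0 (f [])" for f
  proof
    fix gs show "coboundary GS SL2_act 0 f gs = d0 (f []) gs"
      by (auto simp: coboundary_def d0_def signed_def args_def cochain_args_def length_Suc_conv)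
  qed
  have c0: "cochain_args GS 0 = {[]}" by (auto simp: cochain_args_def)
  have "(\<lambda>f. f []) ` cochains GS N 0 = N"
  proof (intro equalityI subsetI)
    fix v assume "v \<in> N"
    thus "v \<in> (\<lambda>f. f []) ` cochains GS N 0"
      by (intro image_eqI[of _ _ "\<lambda>gs. if gs = [] then v else 0"]) (auto simp: cochains_def c0)
  qed (auto simp: cochains_def c0)
  hence "d0 ` N = (\<lambda>f. d0 (f [])) ` cochains GS N 0" by (metis image_image)
  thus ?thesis by (simp add: CB_def coboundaries_def cob)
qed

lemma cocycle_off: "cocycle f \<Longrightarrow> gs \<notin> args \<Longrightarrow> f gs = 0"
  by (simp add: cocycle_def cochains_1)

lemma cocycle_val: "cocycle f \<Longrightarrow> g \<in> S \<Longrightarrow> f [g] \<in> N"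
  by (simp add: cocycle_def cochains_1)

lemma cocycle_add: "cocycle f \<Longrightarrow> cocycle h \<Longrightarrow> cocycle (\<lambda>gs. f gs + h gs)"
  by (auto simp: cocycle_def cochains_1 act_add graded_add)

lemma cocycle_scale: "cocycle f \<Longrightarrow> cocycle (\<lambda>gs. of_int c * f gs)"
  by (auto simp: cocycle_def cochains_1 act_mult graded_of_int_mult distrib_left)

lemma cocycle_0: "cocycle (\<lambda>gs. 0)"
  by (simp add: cocycle_def cochains_1)

lemma cocycle_diff: "cocycle f \<Longrightarrow> cocycle h \<Longrightarrow> cocycle (\<lambda>gs. f gs - h gs)"
  using cocycle_add[of f "\<lambda>gs. of_int (-1) * h gs"] cocycle_scale[of h "-1"] by simp

lemma d0_cocycle: "v \<in> N \<Longrightarrow> cocycle (d0 v)"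
  unfolding cocycle_def cochains_1
  by (auto simp: d0_single d0_off S_mult act_matrix_mult act_diff intro!: graded_diff act_graded)

lemma CG_simps: "carrier CG = Collect cocycle" "f \<otimes>\<^bsub>CG\<^esub> h = (\<lambda>gs. f gs + h gs)" "\<one>\<^bsub>CG\<^esub> = (\<lambda>_. 0)"
  using cocycles_iff by (auto simp: CG_def cocycle_group_def Z1_def)

lemma group_CG: "comm_group CG"
proof (rule comm_groupI)
  fix f assume "f \<in> carrier CG"
  hence "cocycle (\<lambda>gs. of_int (-1) * f gs)" unfolding CG_simps mem_Collect_eq by (rule cocycle_scale)
  thus "\<exists>h\<in>carrier CG. h \<otimes>\<^bsub>CG\<^esub> f = \<one>\<^bsub>CG\<^esub>"
    unfolding CG_simps by (intro bexI[of _ "\<lambda>gs. of_int (-1) * f gs"]) auto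
qed (auto simp: CG_simps cocycle_0 cocycle_add add.assoc add.commute)

lemma inv_CG: "cocycle f \<Longrightarrow> inv\<^bsub>CG\<^esub> f = (\<lambda>gs. - f gs)"
  using cocycle_scale[of f "-1"]
  by (intro group.inv_equality comm_group.axioms(2)[OF group_CG]) (auto simp: CG_simps)

lemma d0_add: "d0 (v + w) = (\<lambda>gs. d0 v gs + d0 w gs)"
  by (auto simp: d0_def act_add)

lemma d0_uminus: "d0 (- v) = (\<lambda>gs. - d0 v gs)"
  using act_diff[of _ 0 v] by (auto simp: d0_def)

lemma subgroup_CB: "subgroup CB CG"
proof (rule group.subgroupI[OF comm_group.axioms(2)[OF group_CG]])
  show "CB \<subseteq> carrier CG" by (auto simp: CB_eq CG_simps d0_cocycle)
  show "CB \<noteq> {}" using graded_0[of T] unfolding CB_eq by blast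
next
  fix f assume "f \<in> CB"
  then obtain v where "f = d0 v" "v \<in> N" by (auto simp: CB_eq)
  thus "inv\<^bsub>CG\<^esub> f \<in> CB"
    by (auto simp: CB_eq inv_CG d0_cocycle d0_uminus[symmetric] graded_uminus)
next
  fix f h assume "f \<in> CB" "h \<in> CB"
  then obtain v w where "f = d0 v" "v \<in> N" "h = d0 w" "w \<in> N" by (auto simp: CB_eq)
  thus "f \<otimes>\<^bsub>CG\<^esub> h \<in> CB" by (auto simp: CB_eq CG_simps d0_add[symmetric] graded_add)
qed

lemma normal_CB: "CB \<lhd> CG"
  using comm_group.normal_iff_subgroup[OF group_CG] subgroup_CB by blast

definition cl :: "((int^2^2) list \<Rightarrow> int poly poly) \<Rightarrow> ((int^2^2) list \<Rightarrow> int poly poly) set" where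
  "cl f = CB #>\<^bsub>CG\<^esub> f"

lemma H_eq: "H = CG Mod CB"
  by (simp add: H_def CG_def CB_def cohomology_def)

lemma carrier_H: "carrier H = cl ` Collect cocycle"
  by (simp add: H_eq carrier_FactGroup cl_def CG_simps)

lemma cl_eq_iff: "cocycle f \<Longrightarrow> cocycle h \<Longrightarrow> cl f = cl h \<longleftrightarrow> (\<exists>v\<in>N. \<forall>g\<in>S. f [g] - h [g] = act g v - v)"
proof -
  assume f: "cocycle f" and h: "cocycle h"
  have "cl f = cl h \<longleftrightarrow> (\<lambda>gs. f gs - h gs) \<in> CB"
    unfolding cl_def using f h
    by (subst group.rcos_eq_iff[OF comm_group.axioms(2)[OF group_CG] subgroup_CB]) (simp_all add: CG_simps inv_CG)
  also have "\<dots> \<longleftrightarrow> (\<exists>v\<in>N. (\<lambda>gs. f gs - h gs) = d0 v)" by (auto simp: CB_eq)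
  also have "\<dots> \<longleftrightarrow> (\<exists>v\<in>N. \<forall>g\<in>S. f [g] - h [g] = act g v - v)"
  proof (rule bex_cong[OF refl])
    fix v assume "v \<in> N"
    show "(\<lambda>gs. f gs - h gs) = d0 v \<longleftrightarrow> (\<forall>g\<in>S. f [g] - h [g] = act g v - v)"
    proof
      assume "(\<lambda>gs. f gs - h gs) = d0 v"
      hence "f [g] - h [g] = d0 v [g]" for g by metis
      thus "\<forall>g\<in>S. f [g] - h [g] = act g v - v" by (simp add: d0_single)
    next
      assume "\<forall>g\<in>S. f [g] - h [g] = act g v - v"
      thus "(\<lambda>gs. f gs - h gs) = d0 v"
        by (intro cochain_eqI) (auto simp: d0_single d0_off cocycle_off[OF f] cocycle_off[OF h])
    qed
  qed
  finally show ?thesis .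
qed

lemma cl_add: "cocycle f \<Longrightarrow> cocycle h \<Longrightarrow> cl (\<lambda>gs. f gs + h gs) = cl f \<otimes>\<^bsub>H\<^esub> cl h"
  using normal.rcos_sum[OF normal_CB, of f h] by (simp add: cl_def H_eq CG_simps)

lemma one_H: "\<one>\<^bsub>H\<^esub> = cl (\<lambda>_. 0)"
  using group.coset_join2[OF comm_group.axioms(2)[OF group_CG] _ subgroup_CB, of "\<lambda>_. 0"]
    subgroup.one_closed[OF subgroup_CB] by (simp add: cl_def H_eq CG_simps cocycle_0)

lemma cl_pow: "cocycle f \<Longrightarrow> cl f [^]\<^bsub>H\<^esub> n = cl (\<lambda>gs. of_int (int n) * f gs)" for n :: nat
proof (induction n)
  case 0 thus ?case by (simp add: one_H)
next
  case (Suc n)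
  have "cl f [^]\<^bsub>H\<^esub> Suc n = cl (\<lambda>gs. of_int (int n) * f gs) \<otimes>\<^bsub>H\<^esub> cl f" using Suc by simp
  also have "\<dots> = cl (\<lambda>gs. of_int (int n) * f gs + f gs)"
    using Suc.prems cocycle_scale[OF Suc.prems] by (intro cl_add[symmetric])
  finally show ?case by (simp add: distrib_right add.commute)
qed

lemma mem_cl:
  assumes "cocycle f" "f' \<in> cl f" shows "cocycle f'" "cl f' = cl f"
proof -
  have g: "group CG" by (rule comm_group.axioms(2)[OF group_CG])
  have f: "f \<in> carrier CG" using assms(1) by (simp add: CG_simps)
  have "f' \<in> carrier CG"
    using monoid.r_coset_subset_G[OF group.is_monoid[OF g] _ f] subgroup.subset[OF subgroup_CB] assms(2) unfolding cl_def by blast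
  thus "cocycle f'" by (simp add: CG_simps)
  show "cl f' = cl f"
    using group.repr_independence[OF g _ f subgroup_CB] assms(2) unfolding cl_def by metis
qed

lemma self_mem_cl: "cocycle f \<Longrightarrow> f \<in> cl f"
  unfolding cl_def by (rule group.rcos_self[OF comm_group.axioms(2)[OF group_CG] _ subgroup_CB]) (simp add: CG_simps)

text \<open>\<open>v\<close> witnesses that \<open>q\<close> times the cocycle \<open>f\<close> is a
  coboundary. For \<open>q \<noteq> 0\<close> it determines \<open>f\<close> on \<open>S\<close>, as
  polynomials are torsion free, so torsion classes can be studied through their witnesses.\<close>

definition tors_by :: "int \<Rightarrow> int poly poly \<Rightarrow> ((int^2^2) list \<Rightarrow> int poly poly) \<Rightarrow> bool" where
  "tors_by q v f \<longleftrightarrow> v \<in> N \<and> (\<forall>g\<in>S. of_int q * f [g] = act g v - v)"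

lemma carrier_p_torsion:
  "carrier (p_torsion p H) = cl ` {f. cocycle f \<and> (\<exists>k v. tors_by (int p ^ k) v f)}"
proof -
  have "cl f [^]\<^bsub>H\<^esub> (p ^ k) = \<one>\<^bsub>H\<^esub> \<longleftrightarrow> (\<exists>v. tors_by (int p ^ k) v f)" if "cocycle f" for f and k :: nat
    unfolding cl_pow[OF that] one_H cl_eq_iff[OF cocycle_scale[OF that] cocycle_0]
    by (auto simp: tors_by_def)
  thus ?thesis by (auto simp: p_torsion_def carrier_H intro!: imageI)
qed

lemma mult_p_torsion: "x \<otimes>\<^bsub>p_torsion p H\<^esub> y = x \<otimes>\<^bsub>H\<^esub> y"
  by (simp add: p_torsion_def)

lemma tors_by_inv_mod: "tors_by q v f \<Longrightarrow> inv_mod S q v"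
  unfolding tors_by_def inv_mod_def by (metis dvd_triv_left)

lemma tors_by_diff:
  assumes "tors_by q v f" "tors_by r w h"
  shows "tors_by (q * r) (of_int r * v - of_int q * w) (\<lambda>gs. f gs - h gs)"
  unfolding tors_by_def
proof (intro conjI ballI)
  show "of_int r * v - of_int q * w \<in> N"
    using assms by (intro graded_diff graded_of_int_mult) (auto simp: tors_by_def)
  fix g assume "g \<in> S"
  hence f: "of_int q * f [g] = act g v - v" and h: "of_int r * h [g] = act g w - w"
    using assms by (auto simp: tors_by_def)
  have "of_int (q * r) * (f [g] - h [g]) = of_int r * (of_int q * f [g]) - of_int q * (of_int r * h [g])"
    by (simp add: algebra_simps)
  also have "\<dots> = act g (of_int r * v - of_int q * w) - (of_int r * v - of_int q * w)"
    unfolding f h by (simp add: act_diff act_mult algebra_simps)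
  finally show "of_int (q * r) * (f [g] - h [g]) = act g (of_int r * v - of_int q * w) - (of_int r * v - of_int q * w)" .
qed

text \<open>The division is exact if and only if \<open>v\<close> is invariant modulo \<open>q\<close>.\<close>

definition dq :: "int \<Rightarrow> int poly poly \<Rightarrow> (int^2^2) list \<Rightarrow> int poly poly" where
  "dq q v gs = d0 v gs div of_int q"

lemma
  assumes "q \<noteq> 0" "v \<in> graded T'" "T' \<subseteq> T" "inv_mod S q v"
  shows dq_eq: "g \<in> S \<Longrightarrow> of_int q * dq q v [g] = act g v - v"
    and dq_cocycle: "cocycle (dq q v)"
    and dq_tors: "tors_by q v (dq q v)"
    and dq_graded: "dq q v \<in> C1 T'"
proof -
  show eq: "of_int q * dq q v [g] = act g v - v" if "g \<in> S" for g
    using assms(4) that by (simp add: dq_def d0_single inv_mod_def)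
  have off: "dq q v gs = 0" if "gs \<notin> args" for gs
    using that by (simp add: dq_def d0_off)
  have "of_int q * dq q v [g] \<in> graded T'" if "g \<in> S" for g
    unfolding eq[OF that] using assms(2) by (intro graded_diff act_graded)
  hence val: "dq q v [g] \<in> graded T'" if "g \<in> S" for g
    using graded_of_int_mult_iff[OF assms(1)] that by blast
  show "dq q v \<in> C1 T'" using val off by (simp add: cochains_1)
  have TT: "graded T' \<subseteq> N" using assms(3) by (auto simp: graded_def)
  have "dq q v [g ** h] = act g (dq q v [h]) + dq q v [g]" if "g \<in> S" "h \<in> S" for g h
  proof -
    have "of_int q * dq q v [g ** h] = act g (of_int q * dq q v [h]) + of_int q * dq q v [g]"
      using that by (simp add: eq S_mult act_matrix_mult act_diff)
    also have "\<dots> = of_int q * (act g (dq q v [h]) + dq q v [g])" by (simp add: act_mult distrib_left)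
    finally show ?thesis using assms(1) by simp
  qed
  thus "cocycle (dq q v)" using val TT off by (auto simp: cocycle_def cochains_1)
  show "tors_by q v (dq q v)" using eq assms(2) TT by (auto simp: tors_by_def)
qed

end

section \<open>Cyclic decomposition of the torsion\<close>

definition scale :: "('a \<Rightarrow> int) \<Rightarrow> ('a \<Rightarrow>\<^sub>0 int) \<Rightarrow> ('a \<Rightarrow>\<^sub>0 int)" where
  "scale h c = (\<Sum>z\<in>Poly_Mapping.keys c. frag_cmul (h z) (frag_of z))"

lemma lookup_scale: "poly_mapping.lookup (scale h c) z = (if z \<in> Poly_Mapping.keys c then h z else 0)"
proof -
  have "poly_mapping.lookup (scale h c) z = (\<Sum>y\<in>Poly_Mapping.keys c. if y = z then h z else 0)"
    unfolding scale_def lookup_sum by (intro sum.cong) auto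
  thus ?thesis by simp
qed

lemma keys_scale: "Poly_Mapping.keys (scale h c) \<subseteq> Poly_Mapping.keys c"
  by (auto simp: in_keys_iff lookup_scale split: if_splits)

lemma comb_scale: "comb e (scale h c) = (\<Sum>z\<in>Poly_Mapping.keys c. of_int (h z) * e z)"
proof -
  have "comb e (scale h c) = (\<Sum>z\<in>Poly_Mapping.keys c. of_int (poly_mapping.lookup (scale h c) z) * e z)"
    by (rule comb_superset) (simp_all add: keys_scale)
  thus ?thesis by (simp add: lookup_scale)
qed

lemma scale_lookup: "scale (poly_mapping.lookup c) c = c"
  by (rule poly_mapping_eqI) (simp add: lookup_scale in_keys_iff)

lemma comb_graded:
  "(\<And>z. z \<in> Poly_Mapping.keys c \<Longrightarrow> e z \<in> graded T) \<Longrightarrow> comb e c \<in> graded T"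
  unfolding comb_def by (intro graded_sum graded_of_int_mult)

lemma act_comb: "act g (comb e c) = comb (\<lambda>z. act g (e z)) c"
  by (simp add: comb_def act_sum act_mult)

lemma comb_diff_fun: "comb (\<lambda>z. e z - e' z) c = comb e c - comb e' c"
  by (simp add: comb_def right_diff_distrib sum_subtractf)

text \<open>Both cases of the theorem satisfy these axioms, with \<open>e (i, j)\<close> equal to
  \<open>x^i y^j\<close> or \<open>P^i Q^j\<close>. In \<open>spanning\<close>, the multiple of
  \<open>p^k\<close> contributes a coboundary and the honest invariant \<open>u\<close> contributes
  nothing; \<open>u\<close> absorbs the constants in degree 0. The lower bound on orders comes from
  \<open>independent\<close>.\<close>

locale SL2_torsion = SL2_module S T for S T +
  fixes p a :: nat and I :: "(nat \<times> nat) set" and e :: "nat \<times> nat \<Rightarrow> int poly poly"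
  assumes p: "prime p"
    and e_graded: "z \<in> I \<Longrightarrow> e z \<in> graded T"
    and e_inv: "z \<in> I \<Longrightarrow> inv_mod S (int (tors_order p a (fst z) (snd z))) (e z)"
    and independent: "\<lbrakk>Poly_Mapping.keys d \<subseteq> I; w \<in> graded T; inv_mod S 0 (comb e d - of_int q * w)\<rbrakk>
      \<Longrightarrow> q dvd poly_mapping.lookup d z"
    and spanning: "\<lbrakk>v \<in> graded T; inv_mod S (int p ^ k) v\<rbrakk> \<Longrightarrow>
      \<exists>d w u. Poly_Mapping.keys d \<subseteq> I \<and> w \<in> graded T \<and> inv_mod S 0 u
        \<and> (\<forall>i j. int p ^ k dvd int (tors_order p a i j) * poly_mapping.lookup d (i, j))
        \<and> v = comb e d + of_int (int p ^ k) * w + u"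
begin

definition ord_of :: "nat \<times> nat \<Rightarrow> int" where
  "ord_of z = int (tors_order p a (fst z) (snd z))"

lemma ord_of_pos: "ord_of z > 0"
  using tors_order_pos[OF p] by (simp add: ord_of_def)

text \<open>Its class, that of the fraction \<open>e z / ord_of z\<close>, generates one cyclic
  summand.\<close>

definition zc :: "nat \<times> nat \<Rightarrow> (int^2^2) list \<Rightarrow> int poly poly" where
  "zc z = dq (ord_of z) (e z)"

lemma zc:
  assumes "z \<in> I"
  shows "g \<in> S \<Longrightarrow> of_int (ord_of z) * zc z [g] = act g (e z) - e z" "cocycle (zc z)"
  using dq_eq[of "ord_of z" "e z" T g] dq_cocycle[of "ord_of z" "e z" T] assms ord_of_pos[of z]
    e_graded[OF assms] e_inv[OF assms]
  by (simp_all add: zc_def ord_of_def)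

definition Theta :: "(nat \<times> nat \<Rightarrow>\<^sub>0 int) \<Rightarrow> (int^2^2) list \<Rightarrow> int poly poly" where
  "Theta c gs = comb (\<lambda>z. zc z gs) c"

definition theta :: "(nat \<times> nat \<Rightarrow>\<^sub>0 int) \<Rightarrow> ((int^2^2) list \<Rightarrow> int poly poly) set" where
  "theta c = cl (Theta c)"

lemma Theta_0: "Theta 0 = (\<lambda>_. 0)" and Theta_of: "Theta (frag_of z) = zc z"
  and Theta_add: "Theta (c + d) = (\<lambda>gs. Theta c gs + Theta d gs)"
  and Theta_diff: "Theta (c - d) = (\<lambda>gs. Theta c gs - Theta d gs)"
  by (auto simp: Theta_def comb_add comb_diff)

lemma Theta_cocycle:
  assumes "Poly_Mapping.keys c \<subseteq> I" shows "cocycle (Theta c)"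
  using assms
proof (induction c rule: frag_induction)
  case zero show ?case by (simp add: Theta_0 cocycle_0)
next
  case (one z) thus ?case by (simp add: Theta_of zc)
next
  case (diff c d) thus ?case by (simp add: Theta_diff cocycle_diff)
qed

lemma Theta_torsion:
  assumes "Poly_Mapping.keys c \<subseteq> I" shows "\<exists>k v. tors_by (int p ^ k) v (Theta c)"
  using assms
proof (induction c rule: frag_induction)
  case zero show ?case by (intro exI[of _ 0]) (simp add: Theta_0 tors_by_def)
next
  case (one z)
  have "tors_by (int p ^ (a + multiplicity p (gcd (fst z) (snd z)))) (e z) (zc z)"
    using zc(1)[OF one] e_graded[OF one] by (simp add: tors_by_def ord_of_def tors_order_def)
  thus ?case unfolding Theta_of by blast
next
  case (diff c d)
  then obtain k v l w where "tors_by (int p ^ k) v (Theta c)" "tors_by (int p ^ l) w (Theta d)" by blast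
  from tors_by_diff[OF this] show ?case unfolding Theta_diff power_add[symmetric] by blast
qed

text \<open>The hypothesis \<open>h\<close> says that \<open>h z / ord_of z = h' z / q\<close>, so
  the fractions \<open>h z * e z / ord_of z\<close> are brought to the common denominator
  \<open>q\<close>.\<close>

lemma Theta_scale:
  assumes keys: "Poly_Mapping.keys d \<subseteq> I" and g: "g \<in> S"
    and h: "\<And>z. z \<in> Poly_Mapping.keys d \<Longrightarrow> q * h z = ord_of z * h' z"
  shows "of_int q * Theta (scale h d) [g] = act g (comb e (scale h' d)) - comb e (scale h' d)"
proof -
  have "of_int q * Theta (scale h d) [g] = (\<Sum>z\<in>Poly_Mapping.keys d. of_int (q * h z) * zc z [g])"
    by (simp add: Theta_def comb_scale sum_distrib_left mult.assoc)
  also have "\<dots> = (\<Sum>z\<in>Poly_Mapping.keys d. of_int (h' z) * (act g (e z) - e z))"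
  proof (intro sum.cong refl)
    fix z assume z: "z \<in> Poly_Mapping.keys d"
    have "of_int (q * h z) * zc z [g] = of_int (h' z) * (of_int (ord_of z) * zc z [g])"
      unfolding h[OF z] by (simp add: mult_ac)
    thus "of_int (q * h z) * zc z [g] = of_int (h' z) * (act g (e z) - e z)"
      using zc(1)[of z g] z keys g by auto
  qed
  also have "\<dots> = act g (comb e (scale h' d)) - comb e (scale h' d)"
    unfolding act_comb comb_diff_fun[symmetric] by (simp add: comb_scale)
  finally show ?thesis .
qed

text \<open>Dividing \<open>v\<close> by \<open>p^k\<close> leaves the \<open>e z\<close> with
  coefficients \<open>lookup d z / p^k\<close>, up to the coboundary of \<open>w\<close> and the
  invariant \<open>u\<close>. Over the denominator \<open>ord_of z\<close> such a coefficient has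
  numerator \<open>ord_of z * lookup d z / p^k\<close>, an integer by \<open>dvd\<close>.\<close>

lemma cl_eq_theta:
  assumes f: "cocycle f" and tors: "\<And>g. g \<in> S \<Longrightarrow> of_int (int p ^ k) * f [g] = act g v - v"
    and keys: "Poly_Mapping.keys d \<subseteq> I" and w: "w \<in> N" and u: "inv_mod S 0 u"
    and dvd: "\<And>i j. int p ^ k dvd int (tors_order p a i j) * poly_mapping.lookup d (i, j)"
    and v: "v = comb e d + of_int (int p ^ k) * w + u"
  shows "cl f = theta (scale (\<lambda>z. ord_of z * poly_mapping.lookup d z div int p ^ k) d)"
proof -
  let ?c = "scale (\<lambda>z. ord_of z * poly_mapping.lookup d z div int p ^ k) d"
  define q where "q = int p ^ k"
  have keys_c: "Poly_Mapping.keys ?c \<subseteq> I" by (rule order_trans[OF keys_scale keys])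
  have "f [g] - Theta ?c [g] = act g w - w" if g: "g \<in> S" for g
  proof -
    have "int p ^ k * (ord_of z * poly_mapping.lookup d z div int p ^ k) = ord_of z * poly_mapping.lookup d z" for z
      using dvd[of "fst z" "snd z"] by (simp add: ord_of_def)
    from Theta_scale[OF keys g this] have Th: "of_int q * Theta ?c [g] = act g (comb e d) - comb e d"
      unfolding scale_lookup q_def .
    have "act g u = u" using u g by (simp add: inv_mod_def)
    hence "of_int q * (f [g] - Theta ?c [g]) = of_int q * (act g w - w)"
      unfolding right_diff_distrib tors[OF g, folded q_def] Th
      by (simp add: v[folded q_def] act_add act_mult algebra_simps)
    thus ?thesis using p by (simp add: q_def prime_gt_0_nat)
  qed
  thus ?thesis unfolding theta_def cl_eq_iff[OF f Theta_cocycle[OF keys_c]] using w by blast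
qed

lemma theta_image: "theta ` {c. Poly_Mapping.keys c \<subseteq> I} = carrier (p_torsion p H)"
  unfolding carrier_p_torsion
proof (intro equalityI subsetI)
  fix x assume "x \<in> theta ` {c. Poly_Mapping.keys c \<subseteq> I}"
  thus "x \<in> cl ` {f. cocycle f \<and> (\<exists>k v. tors_by (int p ^ k) v f)}"
    unfolding theta_def using Theta_cocycle Theta_torsion by blast
next
  fix x assume "x \<in> cl ` {f. cocycle f \<and> (\<exists>k v. tors_by (int p ^ k) v f)}"
  then obtain f k v where f: "cocycle f" "tors_by (int p ^ k) v f" "x = cl f" by blast
  obtain d w u where "Poly_Mapping.keys d \<subseteq> I" "w \<in> graded T" "inv_mod S 0 u"
    "\<And>i j. int p ^ k dvd int (tors_order p a i j) * poly_mapping.lookup d (i, j)"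
    "v = comb e d + of_int (int p ^ k) * w + u"
    using spanning[OF _ tors_by_inv_mod[OF f(2)]] f(2) unfolding tors_by_def by blast
  note d = this
  have "x = theta (scale (\<lambda>z. ord_of z * poly_mapping.lookup d z div int p ^ k) d)"
    unfolding f(3) by (rule cl_eq_theta[OF f(1) _ d]) (use f(2) in \<open>simp add: tors_by_def\<close>)
  thus "x \<in> theta ` {c. Poly_Mapping.keys c \<subseteq> I}"
    using order_trans[OF keys_scale d(1)] by (intro image_eqI) auto
qed

lemma theta_add:
  "Poly_Mapping.keys c \<subseteq> I \<Longrightarrow> Poly_Mapping.keys d \<subseteq> I \<Longrightarrow> theta (c + d) = theta c \<otimes>\<^bsub>H\<^esub> theta d"
  unfolding theta_def Theta_add by (intro cl_add Theta_cocycle)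

lemma theta_eq_0_iff:
  assumes keys: "Poly_Mapping.keys c \<subseteq> I"
  shows "(\<exists>w\<in>N. \<forall>g\<in>S. Theta c [g] = act g w - w) \<longleftrightarrow> (\<forall>z. ord_of z dvd poly_mapping.lookup c z)"
proof
  {
    assume dvd: "\<forall>z. ord_of z dvd poly_mapping.lookup c z"
    let ?b = "scale (\<lambda>z. poly_mapping.lookup c z div ord_of z) c"
    have "1 * poly_mapping.lookup c z = ord_of z * (poly_mapping.lookup c z div ord_of z)" for z
      using dvd[rule_format, of z] by simp
    from Theta_scale[OF keys _ this] have "\<forall>g\<in>S. Theta c [g] = act g (comb e ?b) - comb e ?b"
      unfolding scale_lookup by simp
    moreover have "comb e ?b \<in> N" using order_trans[OF keys_scale keys] by (intro comb_graded e_graded) auto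
    ultimately show "\<exists>w\<in>N. \<forall>g\<in>S. Theta c [g] = act g w - w" by blast
  next
    assume "\<exists>w\<in>N. \<forall>g\<in>S. Theta c [g] = act g w - w"
    then obtain w where w: "w \<in> N" "\<And>g. g \<in> S \<Longrightarrow> Theta c [g] = act g w - w" by blast
    \<comment> \<open>A common denominator for the support of \<open>c\<close>. Independence gives
      that \<open>q\<close> divides \<open>lookup c z * (q / ord_of z)\<close>, and cancelling
      \<open>q / ord_of z\<close> leaves the claim.\<close>
    define q where "q = (\<Prod>z\<in>Poly_Mapping.keys c. ord_of z)"
    let ?d = "scale (\<lambda>z. poly_mapping.lookup c z * (q div ord_of z)) c"
    have q: "ord_of z dvd q" if "z \<in> Poly_Mapping.keys c" for z
      unfolding q_def using that by (intro dvd_prodI) auto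
    have q0: "q > 0" unfolding q_def using ord_of_pos by (intro prod_pos) auto
    have "q * poly_mapping.lookup c z = ord_of z * (poly_mapping.lookup c z * (q div ord_of z))"
      if "z \<in> Poly_Mapping.keys c" for z using q[OF that] by (metis dvd_mult_div_cancel mult.commute mult.left_commute)
    from Theta_scale[OF keys _ this] have E: "of_int q * Theta c [g] = act g (comb e ?d) - comb e ?d" if "g \<in> S" for g
      unfolding scale_lookup using that by simp
    have "act g (comb e ?d - of_int q * w) - (comb e ?d - of_int q * w) = 0" if "g \<in> S" for g
    proof -
      have "act g (comb e ?d - of_int q * w) - (comb e ?d - of_int q * w)
          = (act g (comb e ?d) - comb e ?d) - of_int q * (act g w - w)"
        by (simp add: act_diff act_mult algebra_simps)
      also have "\<dots> = 0" unfolding E[OF that, symmetric] w(2)[OF that, symmetric] by simp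
      finally show ?thesis .
    qed
    hence "inv_mod S 0 (comb e ?d - of_int q * w)" by (simp add: inv_mod_def)
    hence dvd: "q dvd poly_mapping.lookup ?d z" for z
      by (rule independent[OF order_trans[OF keys_scale keys] w(1)])
    show "\<forall>z. ord_of z dvd poly_mapping.lookup c z"
    proof
      fix z show "ord_of z dvd poly_mapping.lookup c z"
      proof (cases "z \<in> Poly_Mapping.keys c")
        case True
        obtain r where r: "q = ord_of z * r" using q[OF True] by blast
        have "ord_of z * r dvd poly_mapping.lookup c z * r"
          using dvd[of z] True ord_of_pos[of z] by (simp add: lookup_scale r)
        moreover have "r \<noteq> 0" using q0 r by auto
        ultimately show ?thesis by simp
      qed (simp add: in_keys_iff)
    qed
  }
qed

lemma theta_eq_iff:
  assumes "Poly_Mapping.keys c \<subseteq> I" "Poly_Mapping.keys d \<subseteq> I"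
  shows "theta c = theta d
    \<longleftrightarrow> (\<forall>i j. int (tors_order p a i j) dvd poly_mapping.lookup c (i, j) - poly_mapping.lookup d (i, j))"
proof -
  have keys: "Poly_Mapping.keys (c - d) \<subseteq> I" using assms keys_diff[of c d] by blast
  have "theta c = theta d \<longleftrightarrow> (\<exists>w\<in>N. \<forall>g\<in>S. Theta (c - d) [g] = act g w - w)"
    unfolding theta_def Theta_diff by (rule cl_eq_iff) (use assms in \<open>auto intro: Theta_cocycle\<close>)
  also have "\<dots> \<longleftrightarrow> (\<forall>z. ord_of z dvd poly_mapping.lookup (c - d) z)" by (rule theta_eq_0_iff[OF keys])
  finally show ?thesis by (simp add: ord_of_def lookup_minus)
qed

lemma torsion_iso:
  assumes I0: "(0, 0) \<notin> I" and B: "carrier B = divpoly_tensor.psi p a ` {c. Poly_Mapping.keys c \<subseteq> I}"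
    "monoid.mult B = monoid.mult (divpoly2 p a)"
  shows "\<exists>\<phi>\<in>iso (p_torsion p H) B. \<forall>c. Poly_Mapping.keys c \<subseteq> I \<longrightarrow> \<phi> (theta c) = divpoly_tensor.psi p a c"
proof -
  interpret divpoly_tensor p a by unfold_locales (rule p)
  have "\<exists>\<phi>\<in>iso (p_torsion p H) B. \<forall>c\<in>{c. Poly_Mapping.keys c \<subseteq> I}. \<phi> (theta c) = psi c"
  proof (rule iso_of_common_cover)
    show "c + d \<in> {c. Poly_Mapping.keys c \<subseteq> I}" if "c \<in> {c. Poly_Mapping.keys c \<subseteq> I}" "d \<in> {c. Poly_Mapping.keys c \<subseteq> I}" for c d
      using that keys_add[of c d] by blast
    show "theta c = theta d \<longleftrightarrow> psi c = psi d" if "c \<in> {c. Poly_Mapping.keys c \<subseteq> I}" "d \<in> {c. Poly_Mapping.keys c \<subseteq> I}" for c d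
    proof -
      have "(0, 0) \<notin> Poly_Mapping.keys c" "(0, 0) \<notin> Poly_Mapping.keys d" using that I0 by auto
      from psi_eq_iff[OF this] show ?thesis using that theta_eq_iff by simp
    qed
  qed (use theta_image B theta_add in \<open>simp_all add: mult_p_torsion psi_add\<close>)
  thus ?thesis by blast
qed

end

section \<open>The case where \<open>p\<close> divides \<open>m\<close>\<close>

lemma SL2_torsion_Gamma:
  assumes p: "prime p" and m: "1 < m" and a: "multiplicity p m = a" "0 < a"
  shows "SL2_torsion (Gamma m) {0<..} p a (- {(0, 0)}) (\<lambda>z. mon (fst z) (snd z))"
proof (intro SL2_torsion.intro SL2_module.intro SL2_torsion_axioms.intro)
  have low: "lower (int m) \<in> Gamma m" "upper (int m) \<in> Gamma m" by (simp_all add: shear_in_Gamma)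
  show "subgroup (Gamma m) SL2Z" by (rule subgroup_Gamma)
  show "prime p" by (rule p)
  show "mon (fst z) (snd z) \<in> graded {0<..}" if "z \<in> - {(0, 0)}" for z
    using that by (intro mon_graded) (cases z, auto)
  show "inv_mod (Gamma m) (int (tors_order p a (fst z) (snd z))) (mon (fst z) (snd z))" for z
  proof -
    have "p ^ a dvd m" using multiplicity_dvd a(1) by metis
    hence "int p ^ a dvd int m" by (metis of_nat_dvd_iff of_nat_power)
    from inv_mod_Gamma_var[OF this] show ?thesis
      unfolding mon_eq by (intro inv_mod_tors_order p a)
  qed
  show "q dvd poly_mapping.lookup d z"
    if d: "Poly_Mapping.keys d \<subseteq> - {(0, 0)}" and w: "w \<in> graded {0<..}"
      and inv: "inv_mod (Gamma m) 0 (comb (\<lambda>z. mon (fst z) (snd z)) d - of_int q * w)" for d w q z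
  proof -
    have "comb (\<lambda>z. mon (fst z) (snd z)) d \<in> graded {0<..}"
    proof (rule comb_graded)
      fix z assume "z \<in> Poly_Mapping.keys d"
      hence "z \<noteq> (0, 0)" using d by blast
      thus "mon (fst z) (snd z) \<in> graded {0<..}" by (intro mon_graded) (cases z, auto)
    qed
    \<comment> \<open>There are no nonzero invariants in positive degree, so the combination equals
      \<open>q w\<close> and coefficients can be compared.\<close>
    hence "comb (\<lambda>z. mon (fst z) (snd z)) d - of_int q * w = 0"
      using w by (intro invariant_eq_0[OF m low] graded_diff graded_of_int_mult inv)
    hence "cf (comb (\<lambda>z. mon (fst z) (snd z)) d) (fst z) (snd z) = cf (of_int q * w) (fst z) (snd z)" by simp
    thus ?thesis by (simp add: cf_comb_mon)
  qed
  show "\<exists>d w u. Poly_Mapping.keys d \<subseteq> - {(0, 0)} \<and> w \<in> graded {0<..} \<and> inv_mod (Gamma m) 0 u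
      \<and> (\<forall>i j. int p ^ k dvd int (tors_order p a i j) * poly_mapping.lookup d (i, j))
      \<and> v = comb (\<lambda>z. mon (fst z) (snd z)) d + of_int (int p ^ k) * w + u"
    if v: "v \<in> graded {0<..}" and inv: "inv_mod (Gamma m) (int p ^ k) v" for v k
  proof -
    \<comment> \<open>The monomials form a basis, so \<open>v\<close> itself is the combination,
      with \<open>w = u = 0\<close>; the condition on its coefficients is
      \<open>dvd_tors_order_cf\<close>.\<close>
    obtain d where d: "v = comb (\<lambda>z. mon (fst z) (snd z)) d" by (rule poly2_comb)
    have l: "poly_mapping.lookup d (i, j) = cf v i j" for i j by (simp add: d cf_comb_mon)
    have "cf v 0 0 = 0" using v by (auto simp: graded_def)
    hence d0: "poly_mapping.lookup d (0, 0) = 0" by (simp add: l)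
    have "int p ^ k dvd int (tors_order p a i j) * poly_mapping.lookup d (i, j)" for i j
    proof (cases "(i, j) = (0, 0)")
      case True thus ?thesis using d0 by simp
    next
      case False
      thus ?thesis unfolding l using m by (intro dvd_tors_order_cf[OF p _ a low inv]) auto
    qed
    moreover have "Poly_Mapping.keys d \<subseteq> - {(0, 0)}" using d0 by (auto simp: in_keys_iff)
    moreover have "inv_mod (Gamma m) 0 0" using inv_mod_const[of _ _ 0] by simp
    ultimately show ?thesis using d by (intro exI[of _ d] exI[of _ 0]) simp
  qed
qed

text \<open>The isomorphism sends \<open>theta c\<close> to \<open>psi c\<close>. Compatibility with
  degrees amounts to showing that a torsion class containing a cocycle with values in degree
  \<open>n\<close> is \<open>theta c\<close> for some \<open>c\<close> supported on pairs of sum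
  \<open>n\<close>.\<close>

lemma torsion_Gamma_graded:
  assumes p: "prime p" and m: "1 < m" and a: "multiplicity p m = a" "0 < a"
  shows "\<exists>\<phi>\<in>iso (p_torsion p (cohomology (Gamma_group m) SL2_act M_pos 1)) (divpoly2_pos p a 1 1).
    \<forall>n. \<phi> ` (carrier (p_torsion p (cohomology (Gamma_group m) SL2_act M_pos 1))
               \<inter> classes_with_values (Gamma_group m) SL2_act M_pos 1 (M_part 1 n))
         = carrier (divpoly2_pos_deg p a 1 1 n)"
proof -
  interpret SL2_torsion "Gamma m" "{0<..}" p a "- {(0, 0)}" "\<lambda>z. mon (fst z) (snd z)"
    by (rule SL2_torsion_Gamma[OF assms])
  interpret divpoly_tensor p a by unfold_locales (rule p)
  have H: "cohomology (Gamma_group m) SL2_act M_pos 1 = H" by (simp only: H_def M_pos_eq)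
  have "\<exists>\<phi>\<in>iso (p_torsion p H) (divpoly2_pos p a 1 1).
      \<forall>c. Poly_Mapping.keys c \<subseteq> - {(0, 0)} \<longrightarrow> \<phi> (theta c) = psi c"
    by (rule torsion_iso) (simp_all only: carrier_divpoly2_pos zero_less_one, simp_all add: divpoly2_pos_def)
  then obtain \<phi> where \<phi>: "\<phi> \<in> iso (p_torsion p H) (divpoly2_pos p a 1 1)"
    "\<And>c. Poly_Mapping.keys c \<subseteq> - {(0, 0)} \<Longrightarrow> \<phi> (theta c) = psi c" by blast
  have classes: "carrier (p_torsion p H) \<inter> classes_with_values (Gamma_group m) SL2_act M_pos 1 (M_part 1 n)
      = theta ` {c. Poly_Mapping.keys c \<subseteq> {(i, j). 1 * i + 1 * j = n \<and> (i, j) \<noteq> (0, 0)}}" (is "?L = theta ` ?K") for n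
  proof (intro equalityI subsetI)
    have cw: "classes_with_values (Gamma_group m) SL2_act M_pos 1 (M_part 1 n) = {c \<in> carrier H. \<exists>f\<in>c. f \<in> C1 {k. 1 * k = n}}"
      by (simp only: classes_with_values_def H C1_def M_part_eq)
    {
      fix x assume "x \<in> ?L"
      then obtain f f' k v where f: "cocycle f" "x = cl f" "tors_by (int p ^ k) v f"
        and f': "f' \<in> x" "f' \<in> C1 {k. 1 * k = n}"
        unfolding cw carrier_p_torsion by blast
      have f'c: "cocycle f'" "cl f' = x" using mem_cl[OF f(1)] f' f(2) by auto
      obtain w where w: "w \<in> N" "\<And>g. g \<in> Gamma m \<Longrightarrow> f' [g] - f [g] = act g w - w"
        using cl_eq_iff[OF f'c(1) f(1)] f'c(2) f(2) by auto
      \<comment> \<open>Replacing the representative \<open>f\<close> by \<open>f'\<close> changes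
        the witness by \<open>p^k w\<close>. As the values of \<open>f'\<close> have degree
        \<open>n\<close> and the action preserves degrees, the degree \<open>n\<close> part of
        \<open>v'\<close> is still a witness.\<close>
      define v' where "v' = v + of_int (int p ^ k) * w"
      have v'_pos: "v' \<in> graded {0<..}"
        unfolding v'_def using f(3) w(1) by (intro graded_add graded_of_int_mult) (auto simp: tors_by_def)
      define u where "u = hcomp n v'"
      have tors: "of_int (int p ^ k) * f' [g] = act g u - u" if g: "g \<in> Gamma m" for g
      proof -
        have "of_int (int p ^ k) * f' [g] = of_int (int p ^ k) * f [g] + of_int (int p ^ k) * (f' [g] - f [g])"
          by (simp only: distrib_left[symmetric]) simp
        also have "\<dots> = (act g v - v) + of_int (int p ^ k) * (act g w - w)"
          using f(3) g w(2)[OF g] by (simp only: tors_by_def)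
        also have "\<dots> = act g v' - v'"
          unfolding v'_def act_add act_mult act_of_int by (simp only: algebra_simps)
        finally have "hcomp n (of_int (int p ^ k) * f' [g]) = act g u - u"
          by (simp only: hcomp_diff hcomp_act u_def)
        moreover have "f' [g] \<in> graded {n}" using f'(2) g by (simp add: cochains_1)
        ultimately show ?thesis by (simp only: hcomp_of_int_mult hcomp_graded if_True refl)
      qed
      obtain d where d: "u = comb (\<lambda>z. mon (fst z) (snd z)) d" by (rule poly2_comb)
      have l: "poly_mapping.lookup d (i, j) = (if i + j = n then cf v' i j else 0)" for i j
      proof -
        have "cf u i j = (if i + j = n then cf v' i j else 0)" unfolding u_def by (rule cf_hcomp)
        moreover have "cf u i j = poly_mapping.lookup d (i, j)" unfolding d by (rule cf_comb_mon)
        ultimately show ?thesis by (simp only:)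
      qed
      have "cf v' 0 0 = 0" using v'_pos by (auto simp: graded_def)
      have keys: "Poly_Mapping.keys d \<subseteq> {(i, j). 1 * i + 1 * j = n \<and> (i, j) \<noteq> (0, 0)}"
      proof
        fix z assume z: "z \<in> Poly_Mapping.keys d"
        obtain i j where [simp]: "z = (i, j)" by (metis surj_pair)
        have "i + j = n" "cf v' i j \<noteq> 0" using z by (auto simp: in_keys_iff l split: if_splits)
        moreover have "(i, j) \<noteq> (0, 0)" using \<open>cf v' 0 0 = 0\<close> \<open>cf v' i j \<noteq> 0\<close> by (metis Pair_inject)
        ultimately show "z \<in> {(i, j). 1 * i + 1 * j = n \<and> (i, j) \<noteq> (0, 0)}" by simp
      qed
      have u_pos: "u \<in> graded {0<..}" using v'_pos by (auto simp: u_def graded_def)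
      have "inv_mod (Gamma m) (int p ^ k) u" unfolding inv_mod_def using tors by (metis dvd_triv_left)
      have "int p ^ k dvd int (tors_order p a i j) * poly_mapping.lookup d (i, j)" for i j
      proof (cases "(i, j) = (0, 0)")
        case True thus ?thesis using \<open>cf v' 0 0 = 0\<close> by (simp add: l)
      next
        case False
        have u: "poly_mapping.lookup d (i, j) = cf u i j" by (simp add: d cf_comb_mon)
        show ?thesis unfolding u using m False \<open>inv_mod (Gamma m) (int p ^ k) u\<close>
          by (intro dvd_tors_order_cf[OF p _ a]) (auto simp: shear_in_Gamma)
      qed
      hence "cl f' = theta (scale (\<lambda>z. ord_of z * poly_mapping.lookup d z div int p ^ k) d)"
        using keys d inv_mod_const[of _ _ 0]
        by (intro cl_eq_theta[OF f'c(1) tors, where w = 0 and u = 0]) auto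
      thus "x \<in> theta ` ?K" using order_trans[OF keys_scale keys] f'c(2) by (intro image_eqI) auto
    next
      fix x assume "x \<in> theta ` ?K"
      then obtain c where c: "c \<in> ?K" "x = theta c" by blast
      have keys: "Poly_Mapping.keys c \<subseteq> - {(0, 0)}" using c by auto
      have co: "cocycle (Theta c)" by (rule Theta_cocycle[OF keys])
      have "Theta c [g] \<in> graded {k. 1 * k = n}" if g: "g \<in> Gamma m" for g
        unfolding Theta_def
      proof (rule comb_graded)
        fix z assume z: "z \<in> Poly_Mapping.keys c"
        hence zn: "fst z + snd z = n" "n > 0" using c by auto
        have "zc z \<in> C1 {k. 1 * k = n}"
          unfolding zc_def
        proof (rule dq_graded)
          show "ord_of z \<noteq> 0" using ord_of_pos[of z] by simp
          show "mon (fst z) (snd z) \<in> graded {k. 1 * k = n}" using zn by (intro mon_graded) simp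
          show "{k. 1 * k = n} \<subseteq> {0<..}" using zn by auto
          show "inv_mod (Gamma m) (ord_of z) (mon (fst z) (snd z))"
            unfolding ord_of_def using z keys by (intro e_inv) auto
        qed
        thus "zc z [g] \<in> graded {k. 1 * k = n}" using g by (simp add: cochains_1)
      qed
      hence "Theta c \<in> C1 {k. 1 * k = n}" using cocycle_off[OF co] by (simp add: cochains_1)
      moreover have "Theta c \<in> x" unfolding c(2) theta_def by (rule self_mem_cl[OF co])
      moreover have "x \<in> carrier (p_torsion p H)" using theta_image c(2) keys by blast
      moreover have "x \<in> carrier H" unfolding c(2) theta_def carrier_H using co by blast
      ultimately show "x \<in> ?L" unfolding cw by blast
    }
  qed
  have "\<phi> ` (carrier (p_torsion p H) \<inter> classes_with_values (Gamma_group m) SL2_act M_pos 1 (M_part 1 n))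
      = carrier (divpoly2_pos_deg p a 1 1 n)" for n
  proof -
    have "\<phi> (theta c) = psi c" if "c \<in> {c. Poly_Mapping.keys c \<subseteq> {(i, j). 1 * i + 1 * j = n \<and> (i, j) \<noteq> (0, 0)}}" for c
      using that by (intro \<phi>(2)) auto
    thus ?thesis unfolding classes carrier_divpoly2_pos_deg[OF zero_less_one zero_less_one] image_image
      by (rule image_cong[OF refl])
  qed
  thus ?thesis unfolding H using \<phi>(1) by blast
qed

section \<open>The group SL_2(Z) and restriction to \<Gamma>(m)\<close>

lemma SL2_torsion_SL2Z:
  assumes p: "prime p"
  shows "SL2_torsion (carrier SL2Z) {k. 2 * k = n} p 1
    {(i, j). 2 * (p + 1) * i + 2 * p * (p - 1) * j = n \<and> (i, j) \<noteq> (0, 0)} (dickson_mon p)"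
    (is "SL2_torsion _ ?T _ _ ?I _")
proof -
  have p1: "1 < p" using p prime_gt_1_nat by blast
  \<comment> \<open>\<open>invariant_eq_0\<close> asks for the shears of some level above 1; here
    the level is 2.\<close>
  have low: "lower (int 2) \<in> carrier SL2Z" "upper (int 2) \<in> carrier SL2Z"
    by (simp_all add: SL2Z_carrier_iff lower_def upper_def)
  have eq: "2 * (p + 1) * i + 2 * p * (p - 1) * j = 2 * ((p + 1) * i + p * (p - 1) * j)" for i j
    unfolding distrib_left[of 2 "(p + 1) * i"] mult.assoc ..
  \<comment> \<open>Since \<open>(0, 0)\<close> is excluded, a nonempty index set forces
    \<open>n\<close> to be even and positive, and \<open>k = n / 2\<close> is the polynomial
    degree.\<close>
  have idx: "\<exists>k. 2 * k = n \<and> 0 < k \<and> ?I = dickson_index p k \<and> ?T = {k}" if I: "?I \<noteq> {}"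
  proof -
    obtain z where z: "z \<in> ?I" using I by blast
    obtain i j where [simp]: "z = (i, j)" by (metis surj_pair)
    have "2 * (p + 1) * i + 2 * p * (p - 1) * j = n \<and> (i, j) \<noteq> (0, 0)"
      using z unfolding \<open>z = (i, j)\<close> mem_Collect_eq case_prod_conv .
    note ij = conjunct1[OF this] conjunct2[OF this]
    define k where "k = (p + 1) * i + p * (p - 1) * j"
    have k: "2 * k = n" using ij(1) unfolding k_def eq .
    have "0 < p * (p - 1)" using p1 by simp
    hence k0: "0 < k" using ij(2) unfolding k_def by (cases "i = 0") auto
    have "?I = dickson_index p k" unfolding eq k[symmetric] dickson_index_def using k0 by auto
    thus ?thesis using k k0 by auto
  qed
  show ?thesis
  proof (intro SL2_torsion.intro SL2_module.intro SL2_torsion_axioms.intro)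
    show "subgroup (carrier SL2Z) SL2Z" by (rule group.subgroup_self[OF group_SL2Z])
    show "prime p" by (rule p)
    show "dickson_mon p z \<in> graded ?T" if z: "z \<in> ?I" for z
    proof -
      obtain k where "?I = dickson_index p k" "?T = {k}" using idx z by auto
      thus ?thesis using dickson_mon_graded[of p z k] z p1 by simp
    qed
    show "inv_mod (carrier SL2Z) (int (tors_order p 1 (fst z) (snd z))) (dickson_mon p z)" for z
      unfolding dickson_mon_def using inv_mod_dickson_P[OF p] inv_mod_dickson_Q[OF p]
      by (intro inv_mod_tors_order p) auto
    show "q dvd poly_mapping.lookup d z"
      if d: "Poly_Mapping.keys d \<subseteq> ?I" and w: "w \<in> graded ?T"
        and inv: "inv_mod (carrier SL2Z) 0 (comb (dickson_mon p) d - of_int q * w)" for d w q z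
    proof (cases "?I = {}")
      case True
      have "Poly_Mapping.keys d = {}" using d unfolding True by (simp only: subset_empty)
      hence "d = 0" by (simp only: keys_eq_empty)
      thus ?thesis by simp
    next
      case False
      then obtain k where k: "0 < k" "?I = dickson_index p k" "?T = {k}" using idx by blast
      have "comb (dickson_mon p) d - of_int q * w \<in> graded {k}"
        using d w k(2,3) p1 by (intro graded_diff comb_graded graded_of_int_mult dickson_mon_graded) auto
      hence "comb (dickson_mon p) d - of_int q * w \<in> graded {0<..}" using k(1) by (auto simp: graded_def)
      hence "comb (dickson_mon p) d - of_int q * w = 0"
        by (intro invariant_eq_0[OF _ low] inv) auto
      hence "of_int q dvd comb (dickson_mon p) d" by simp
      thus ?thesis using dickson_mon_independent[OF p1 d[unfolded k(2)], of q "fst z" "snd z"] by simp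
    qed
    show "\<exists>d w u. Poly_Mapping.keys d \<subseteq> ?I \<and> w \<in> graded ?T \<and> inv_mod (carrier SL2Z) 0 u
        \<and> (\<forall>i j. int p ^ k dvd int (tors_order p 1 i j) * poly_mapping.lookup d (i, j))
        \<and> v = comb (dickson_mon p) d + of_int (int p ^ k) * w + u"
      if v: "v \<in> graded ?T" and inv: "inv_mod (carrier SL2Z) (int p ^ k) v" for v k
    proof (cases "\<exists>l. 0 < l \<and> 2 * l = n")
      case True
      then obtain l where l: "0 < l" "2 * l = n" by blast
      have T: "?T = {l}" using l by auto
      have "dickson_index p l \<subseteq> ?I"
      proof
        fix z assume "z \<in> dickson_index p l"
        hence "(p + 1) * fst z + p * (p - 1) * snd z = l" by (auto simp: dickson_index_def)
        hence "2 * ((p + 1) * fst z + p * (p - 1) * snd z) = n" "z \<noteq> (0, 0)" using l by auto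
        thus "z \<in> ?I" unfolding eq by (simp only: case_prod_beta mem_Collect_eq prod.collapse simp_thms)
      qed
      moreover have "inv_mod (carrier SL2Z) 0 0" using inv_mod_const[of _ _ 0] by simp
      moreover obtain d w where "Poly_Mapping.keys d \<subseteq> dickson_index p l" "w \<in> graded {l}"
        "\<forall>i j. int p ^ k dvd int (tors_order p 1 i j) * poly_mapping.lookup d (i, j)"
        "v = comb (dickson_mon p) d + of_int (int p ^ k) * w"
        using invariant_mod_prime_power_dickson[OF p l(1) v[unfolded T] inv] by blast
      ultimately show ?thesis unfolding T by (intro exI[of _ d] exI[of _ w] exI[of _ 0]) auto
    next
      \<comment> \<open>Now \<open>n\<close> is 0 or odd. In both cases \<open>v\<close> is a
        constant, hence invariant, and is absorbed by \<open>u\<close>.\<close>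
      case False
      have "cf v i j = 0" if "(i, j) \<noteq> (0, 0)" for i j
      proof (rule ccontr)
        assume "cf v i j \<noteq> 0"
        hence "2 * (i + j) = n" using v by (auto simp: graded_def)
        moreover have "0 < i + j" using that by auto
        ultimately show False using False by blast
      qed
      hence "v = of_int (cf v 0 0) * mon 0 0" by (intro poly2_eqI) auto
      hence "v = of_int (cf v 0 0)" by (simp add: mon_eq)
      hence "inv_mod (carrier SL2Z) 0 v" using inv_mod_const by metis
      thus ?thesis by (intro exI[of _ 0] exI[of _ v]) simp
    qed
  qed
qed

lemma restrict_cochain_single: "restrict_cochain K f [g] = (if g \<in> K then f [g] else 0)"
  by (simp add: restrict_cochain_def)

text \<open>A witness for a torsion class of \<open>Gamma m\<close> is invariant modulo
  \<open>p^k\<close> under all of \<open>SL2Z\<close>, so dividing its coboundary by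
  \<open>p^k\<close> extends the cocycle; this is surjectivity. If two torsion classes agree on
  \<open>Gamma m\<close>, the witness of their difference minus a multiple \<open>q w\<close> is
  invariant under \<open>Gamma m\<close>, hence under \<open>SL2Z\<close>, so the difference is the
  coboundary of \<open>w\<close> there too.\<close>

lemma restriction_torsion_iso:
  assumes p: "prime p" "\<not> p dvd m"
  shows "restriction SL2Z (Gamma m) SL2_act (graded T) 1
    \<in> iso (p_torsion p (cohomology SL2Z SL2_act (graded T) 1))
          (p_torsion p (cohomology (Gamma_group m) SL2_act (graded T) 1))"
proof -
  interpret G: SL2_module "carrier SL2Z" T by (rule SL2_module.intro) (rule group.subgroup_self[OF group_SL2Z])
  interpret L: SL2_module "Gamma m" T by (rule SL2_module.intro) (rule subgroup_Gamma)
  let ?r = "restrict_cochain (Gamma m)" and ?R = "restriction SL2Z (Gamma m) SL2_act (graded T) 1"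
  have sub: "Gamma m \<subseteq> carrier SL2Z" by (rule subgroup.subset[OF subgroup_Gamma])
  have H: "cohomology SL2Z SL2_act (graded T) 1 = G.H" "cohomology (Gamma_group m) SL2_act (graded T) 1 = L.H"
    by (simp_all add: G.H_def L.H_def)
  have single: "?r f [g] = f [g]" if "g \<in> Gamma m" for f :: "(int^2^2) list \<Rightarrow> int poly poly" and g
    using that by (simp add: restrict_cochain_single)
  have r: "L.cocycle (?r f)" if f: "G.cocycle f" for f
    unfolding L.cocycle_def L.cochains_1
  proof (intro conjI ballI allI impI)
    show "?r f [g] \<in> graded T" if "g \<in> Gamma m" for g
      using G.cocycle_val[OF f] that sub by (auto simp: single)
    show "?r f [g ** h] = act g (?r f [h]) + ?r f [g]" if "g \<in> Gamma m" "h \<in> Gamma m" for g h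
      using f that sub by (auto simp: single L.S_mult G.cocycle_def)
    show "?r f gs = 0" if "gs \<notin> L.args" for gs
    proof (cases "set gs \<subseteq> Gamma m")
      case True
      hence "gs \<notin> G.args" using that by (auto simp: G.args_1 L.args_1)
      thus ?thesis using G.cocycle_off[OF f] by (simp add: restrict_cochain_def)
    qed (simp add: restrict_cochain_def)
  qed
  have cl_r: "L.cl (?r f) = L.cl (?r f')" if ff: "G.cocycle f" "G.cocycle f'" "G.cl f = G.cl f'" for f f'
  proof -
    obtain v where "v \<in> graded T" "\<forall>g\<in>carrier SL2Z. f [g] - f' [g] = act g v - v"
      using G.cl_eq_iff[OF ff(1,2)] ff(3) by blast
    thus ?thesis using sub unfolding L.cl_eq_iff[OF r[OF ff(1)] r[OF ff(2)]]
      by (intro bexI[of _ v] ballI) (auto simp: single)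
  qed
  have R: "?R (G.cl f) = L.cl (?r f)" if f: "G.cocycle f" for f
  proof -
    have "?R (G.cl f) = (\<Union>f'\<in>G.cl f. L.cl (?r f'))"
      by (simp only: restriction_def Let_def L.cl_def L.CB_def L.CG_def)
    also have "\<dots> = (\<Union>f'\<in>G.cl f. L.cl (?r f))"
      using cl_r[OF G.mem_cl(1)[OF f] f G.mem_cl(2)[OF f]] by (intro SUP_cong refl)
    also have "\<dots> = L.cl (?r f)" using G.self_mem_cl[OF f] by blast
    finally show ?thesis .
  qed
  have tors_r: "L.tors_by q v (?r f)" if "G.tors_by q v f" for q v f
    using that sub by (auto simp: G.tors_by_def L.tors_by_def single)
  have inj: "G.cl f = G.cl f'"
    if f: "G.cocycle f" "G.tors_by (int p ^ k) v f" and f': "G.cocycle f'" "G.tors_by (int p ^ l) v' f'"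
      and eq: "L.cl (?r f) = L.cl (?r f')" for f f' k l v v'
  proof -
    define q where "q = int p ^ k * int p ^ l"
    define x where "x = of_int (int p ^ l) * v - of_int (int p ^ k) * v'"
    have q0: "q \<noteq> 0" using p by (simp add: q_def prime_gt_0_nat)
    have x: "x \<in> graded T" "\<And>g. g \<in> carrier SL2Z \<Longrightarrow> of_int q * (f [g] - f' [g]) = act g x - x"
      using G.tors_by_diff[OF f(2) f'(2)] unfolding x_def[symmetric] q_def[symmetric] by (auto simp: G.tors_by_def)
    obtain w where w: "w \<in> graded T" "\<And>g. g \<in> Gamma m \<Longrightarrow> f [g] - f' [g] = act g w - w"
      using eq L.cl_eq_iff[OF r[OF f(1)] r[OF f'(1)]] by (auto simp: single)
    have d: "act g (x - of_int q * w) - (x - of_int q * w) = (act g x - x) - of_int q * (act g w - w)" for g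
      by (simp add: act_diff act_mult algebra_simps)
    have "inv_mod (Gamma m) 0 (x - of_int q * w)"
      unfolding inv_mod_def d using x(2) w(2) sub by (metis cancel_comm_monoid_add_class.diff_cancel dvd_0_right subsetD)
    hence inv: "inv_mod (carrier SL2Z) 0 (x - of_int q * w)"
      by (rule inv_mod_0_Gamma_imp_SL2Z[OF p])
    have "f [g] - f' [g] = act g w - w" if g: "g \<in> carrier SL2Z" for g
    proof -
      have "(act g x - x) - of_int q * (act g w - w) = 0" using inv g unfolding inv_mod_def d by simp
      hence "of_int q * (f [g] - f' [g]) = of_int q * (act g w - w)" using x(2)[OF g] by simp
      thus ?thesis using q0 by simp
    qed
    thus ?thesis using w(1) unfolding G.cl_eq_iff[OF f(1) f'(1)] by blast
  qed
  have surj: "\<exists>F. G.cocycle F \<and> G.tors_by (int p ^ k) v F \<and> ?r F = f"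
    if f: "L.cocycle f" "L.tors_by (int p ^ k) v f" for f k v
  proof -
    define q where "q = int p ^ k"
    have q0: "q \<noteq> 0" using p by (simp add: q_def prime_gt_0_nat)
    have "coprime m p" using p prime_imp_coprime_nat[of p m] by (simp add: coprime_commute)
    hence inv: "inv_mod (carrier SL2Z) q v"
      using L.tors_by_inv_mod[OF f(2)] by (intro inv_mod_Gamma_imp_SL2Z) (simp_all add: q_def)
    have v: "v \<in> graded T" "\<And>g. g \<in> Gamma m \<Longrightarrow> of_int q * f [g] = act g v - v"
      using f(2) by (auto simp: L.tors_by_def q_def)
    note dq = G.dq_eq[OF q0 v(1) subset_refl inv] G.dq_cocycle[OF q0 v(1) subset_refl inv]
      G.dq_tors[OF q0 v(1) subset_refl inv]
    have "?r (G.dq q v) = f"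
    proof (rule L.cochain_eqI)
      fix g assume g: "g \<in> Gamma m"
      hence "of_int q * G.dq q v [g] = of_int q * f [g]" using dq(1)[of g] v(2)[OF g] sub by auto
      thus "?r (G.dq q v) [g] = f [g]" using q0 g by (simp add: single)
    qed (use L.cocycle_off[OF f(1)] L.cocycle_off[OF r[OF dq(2)]] in auto)
    thus ?thesis using dq(2,3) unfolding q_def by blast
  qed
  have carr: "x \<in> carrier (p_torsion p G.H) \<longleftrightarrow> (\<exists>f k v. x = G.cl f \<and> G.cocycle f \<and> G.tors_by (int p ^ k) v f)" for x
    unfolding G.carrier_p_torsion by blast
  have carrL: "x \<in> carrier (p_torsion p L.H) \<longleftrightarrow> (\<exists>f k v. x = L.cl f \<and> L.cocycle f \<and> L.tors_by (int p ^ k) v f)" for x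
    unfolding L.carrier_p_torsion by blast
  have "?R \<in> hom (p_torsion p G.H) (p_torsion p L.H)"
  proof (rule homI)
    fix x assume "x \<in> carrier (p_torsion p G.H)"
    thus "?R x \<in> carrier (p_torsion p L.H)" unfolding carr carrL using R r tors_r by metis
  next
    fix x y assume "x \<in> carrier (p_torsion p G.H)" "y \<in> carrier (p_torsion p G.H)"
    then obtain f h where fh: "x = G.cl f" "G.cocycle f" "y = G.cl h" "G.cocycle h" unfolding carr by blast
    have "?R (x \<otimes>\<^bsub>G.H\<^esub> y) = L.cl (?r (\<lambda>gs. f gs + h gs))"
      unfolding fh(1,3) G.cl_add[OF fh(2,4), symmetric] by (rule R[OF G.cocycle_add[OF fh(2,4)]])
    also have "?r (\<lambda>gs. f gs + h gs) = (\<lambda>gs. ?r f gs + ?r h gs)" by (auto simp: restrict_cochain_def)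
    also have "L.cl \<dots> = ?R x \<otimes>\<^bsub>L.H\<^esub> ?R y"
      unfolding fh(1,3) R[OF fh(2)] R[OF fh(4)] by (rule L.cl_add[OF r[OF fh(2)] r[OF fh(4)]])
    finally show "?R (x \<otimes>\<^bsub>p_torsion p G.H\<^esub> y) = ?R x \<otimes>\<^bsub>p_torsion p L.H\<^esub> ?R y"
      by (simp only: G.mult_p_torsion L.mult_p_torsion)
  qed
  moreover have "inj_on ?R (carrier (p_torsion p G.H))"
  proof (rule inj_onI)
    fix x y assume "x \<in> carrier (p_torsion p G.H)" "y \<in> carrier (p_torsion p G.H)" and eq: "?R x = ?R y"
    then obtain f k v f' l v' where
      f: "x = G.cl f" "G.cocycle f" "G.tors_by (int p ^ k) v f" and f': "y = G.cl f'" "G.cocycle f'" "G.tors_by (int p ^ l) v' f'"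
      unfolding carr by blast
    have "L.cl (?r f) = L.cl (?r f')" using eq unfolding f(1) f'(1) R[OF f(2)] R[OF f'(2)] .
    thus "x = y" unfolding f(1) f'(1) by (rule inj[OF f(2,3) f'(2,3)])
  qed
  moreover have "?R ` carrier (p_torsion p G.H) = carrier (p_torsion p L.H)"
  proof (rule equalityI)
    show "?R ` carrier (p_torsion p G.H) \<subseteq> carrier (p_torsion p L.H)"
      by (rule hom_carrier[OF calculation(1)])
    show "carrier (p_torsion p L.H) \<subseteq> ?R ` carrier (p_torsion p G.H)"
    proof
      fix x assume "x \<in> carrier (p_torsion p L.H)"
      then obtain f k v where f: "x = L.cl f" "L.cocycle f" "L.tors_by (int p ^ k) v f" unfolding carrL by blast
      obtain F where F: "G.cocycle F" "G.tors_by (int p ^ k) v F" "?r F = f" using surj[OF f(2,3)] by blast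
      have "x = ?R (G.cl F)" unfolding R[OF F(1)] F(3) f(1) ..
      moreover have "G.cl F \<in> carrier (p_torsion p G.H)" unfolding carr using F by blast
      ultimately show "x \<in> ?R ` carrier (p_torsion p G.H)" by blast
    qed
  qed
  ultimately show ?thesis unfolding H iso_def bij_betw_def by simp
qed

theorem theorem2p15:
  fixes p m :: nat
  assumes "Factorial_Ring.prime p" and "m > 1"
  shows
    "(\<not> p dvd m \<longrightarrow>
        (\<forall>n.
          restriction SL2Z (Gamma m) SL2_act (M_part 2 n) 1
            \<in> iso (p_torsion p (cohomology SL2Z SL2_act (M_part 2 n) 1))
                  (p_torsion p (cohomology (Gamma_group m) SL2_act (M_part 2 n) 1))
          \<and> p_torsion p (cohomology SL2Z SL2_act (M_part 2 n) 1)
              \<cong> divpoly2_pos_deg p 1 (2 * (p + 1)) (2 * p * (p - 1)) n))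
     \<and>
     (\<forall>a. p dvd m \<and> p ^ a dvd m \<and> \<not> p ^ (a + 1) dvd m \<longrightarrow>
        (\<exists>\<phi> \<in> iso (p_torsion p (cohomology (Gamma_group m) SL2_act M_pos 1)) (divpoly2_pos p a 1 1).
          \<forall>n. \<phi> ` (carrier (p_torsion p (cohomology (Gamma_group m) SL2_act M_pos 1))
                     \<inter> classes_with_values (Gamma_group m) SL2_act M_pos 1 (M_part 1 n))
               = carrier (divpoly2_pos_deg p a 1 1 n)))"
proof (intro conjI allI impI)
  fix n assume "\<not> p dvd m"
  thus "restriction SL2Z (Gamma m) SL2_act (M_part 2 n) 1
            \<in> iso (p_torsion p (cohomology SL2Z SL2_act (M_part 2 n) 1))
                  (p_torsion p (cohomology (Gamma_group m) SL2_act (M_part 2 n) 1))"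
    unfolding M_part_eq by (rule restriction_torsion_iso[OF assms(1)])
next
  fix n
  let ?I = "{(i, j). 2 * (p + 1) * i + 2 * p * (p - 1) * j = n \<and> (i, j) \<noteq> (0, 0)}"
  interpret SL2_torsion "carrier SL2Z" "{k. 2 * k = n}" p 1 ?I "dickson_mon p"
    by (rule SL2_torsion_SL2Z[OF assms(1)])
  interpret divpoly_tensor p 1 by unfold_locales (rule assms(1))
  have pos: "0 < 2 * (p + 1)" "0 < 2 * p * (p - 1)" using prime_gt_1_nat[OF assms(1)] by auto
  have H: "cohomology SL2Z SL2_act (M_part 2 n) 1 = H" by (simp add: H_def M_part_eq)
  have "\<exists>\<phi>\<in>iso (p_torsion p H) (divpoly2_pos_deg p 1 (2 * (p + 1)) (2 * p * (p - 1)) n).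
      \<forall>c. Poly_Mapping.keys c \<subseteq> ?I \<longrightarrow> \<phi> (theta c) = psi c"
  proof (rule torsion_iso)
    show "carrier (divpoly2_pos_deg p 1 (2 * (p + 1)) (2 * p * (p - 1)) n) = psi ` {c. Poly_Mapping.keys c \<subseteq> ?I}"
      by (rule carrier_divpoly2_pos_deg[OF pos])
  qed (simp_all add: divpoly2_pos_deg_def)
  thus "p_torsion p (cohomology SL2Z SL2_act (M_part 2 n) 1)
      \<cong> divpoly2_pos_deg p 1 (2 * (p + 1)) (2 * p * (p - 1)) n"
    unfolding H is_iso_def by blast
next
  fix a assume a: "p dvd m \<and> p ^ a dvd m \<and> \<not> p ^ (a + 1) dvd m"
  have "multiplicity p m = a" using a by (intro multiplicity_eqI) auto
  moreover have "0 < a" using a by (cases a) auto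
  ultimately show "\<exists>\<phi>\<in>iso (p_torsion p (cohomology (Gamma_group m) SL2_act M_pos 1)) (divpoly2_pos p a 1 1).
    \<forall>n. \<phi> ` (carrier (p_torsion p (cohomology (Gamma_group m) SL2_act M_pos 1))
               \<inter> classes_with_values (Gamma_group m) SL2_act M_pos 1 (M_part 1 n))
         = carrier (divpoly2_pos_deg p a 1 1 n)"
    using assms by (intro torsion_Gamma_graded)
qed

end
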